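(* Let $\{F_\theta:\theta\in\Theta\}$ be a standard exponential family generated by $F_0$, with $\Theta=[0,\theta_{\max})$, and for $\theta\in\Theta$ let $X_1,X_2,\dots$ be i.i.d. with law $F_\theta$ under $\mathbb{P}_\theta$. Then there exist constants $C>0$, $r>0$ and $\theta^\ast>0$ with $[0,\theta^\ast]\subset\Theta$ (depending only on the family) such that for every $k\in\mathbb{N}$ ($k\ge 1$), every $b>0$ and every $\theta\in(0,\theta^\ast]$, $$\mathbb{E}_\theta[R_b^{\,k}]\ \le\ \frac{1}{k+1}\,\frac{\mathbb{E}_\theta[(X_1^+)^{k+1}]}{\mu_\theta}\ +\ C\,\frac{k\Gamma(k)}{r^k}\,e^{-rb},\qquad \Gamma(k)=\int_0^\infty z^{k-1}e^{-z}\,dz .$$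
   Context: Standard exponential family: $F_0$ is a probability measure on $\mathbb{R}$ and $\Theta=[0,\theta_{\max})$, $\theta_{\max}\in(0,\infty]$, is such that $\int e^{\theta x}F_0(dx)<\infty$ for all $\theta\in\Theta$. Put $\psi(\theta)=\ln\int e^{\theta x}F_0(dx)$ and $F_\theta(dx)=e^{\theta x-\psi(\theta)}F_0(dx)$. The family $\{F_\theta\}$ is called standard if, for $X\sim F_0$, $\mathbb{E}[X]=0$ and $\mathrm{Var}(X)=1$, and $F_0$ is strongly non-lattice, i.e. $\limsup_{|t|\to\infty}\left|\int e^{itx}F_0(dx)\right|<1$. $\mathbb{P}_\theta,\mathbb{E}_\theta$ denote probability and expectation when $X_1,X_2,\dots$ are i.i.d. with law $F_\theta$; $\mu_\theta:=\mathbb{E}_\theta[X_1]=\psi'(\theta)$, which is $>0$ for $\theta>0$. $S_0=0$, $S_n=X_1+\dots+X_n$. For $b\ge 0$: $\tau(b)=\inf\{n\ge1:S_n>b\}$ and the overshoot is $R_b=S_{\tau(b)}-b$. $x^+=\max\{x,0\}$. *)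

theory Defs
  imports "HOL-Probability.Probability"
begin

definition log_mgf :: "real measure \<Rightarrow> real \<Rightarrow> real" where
  "log_mgf F0 \<theta> = ln (\<integral>x. exp (\<theta> * x) \<partial>F0)"

definition tilted :: "real measure \<Rightarrow> real \<Rightarrow> real measure" where
  "tilted F0 \<theta> = density F0 (\<lambda>x. ennreal (exp (\<theta> * x - log_mgf F0 \<theta>)))"

definition strongly_nonlattice :: "real measure \<Rightarrow> bool" where
  "strongly_nonlattice F0 \<longleftrightarrow> Limsup at_infinity (\<lambda>t. ereal (cmod (char F0 t))) < 1"

definition param_space :: "ereal \<Rightarrow> real set" where
  "param_space \<theta>max = {\<theta>. 0 \<le> \<theta> \<and> ereal \<theta> < \<theta>max}"

locale standard_exponential_family = real_distribution F0
  for F0 :: "real measure" +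
  fixes \<theta>max :: ereal
  assumes \<theta>max_pos: "0 < \<theta>max"
    and exp_integrable: "\<theta> \<in> param_space \<theta>max \<Longrightarrow> integrable F0 (\<lambda>x. exp (\<theta> * x))"
    and square_integrable: "integrable F0 (\<lambda>x. x\<^sup>2)"
    and mean_zero: "expectation (\<lambda>x. x) = 0"
    and variance_one: "variance (\<lambda>x. x) = 1"
    and nonlattice: "strongly_nonlattice F0"

(* The i.i.d. sequence is realised canonically, as the coordinates of sequence space under the
   product measure. Coordinates are numbered from 0, so X_i is the map \<omega> \<mapsto> \<omega> (i - 1). *)

definition iid_law :: "real measure \<Rightarrow> real \<Rightarrow> (nat \<Rightarrow> real) measure" where
  "iid_law F0 \<theta> = Pi\<^sub>M UNIV (\<lambda>_. tilted F0 \<theta>)"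

definition walk :: "(nat \<Rightarrow> real) \<Rightarrow> nat \<Rightarrow> real" where
  "walk \<omega> n = (\<Sum>i<n. \<omega> i)"

definition passage_time :: "real \<Rightarrow> (nat \<Rightarrow> real) \<Rightarrow> enat" where
  "passage_time b \<omega> = Inf {enat n | n. 1 \<le> n \<and> walk \<omega> n > b}"

(* The overshoot is \<infinity> on paths that never exceed b, so a finite bound on one of its moments
   also says that such paths form a null set. On all other paths it is positive, and the
   coercion to ennreal truncates nothing. *)

definition overshoot :: "real \<Rightarrow> (nat \<Rightarrow> real) \<Rightarrow> ennreal" where
  "overshoot b \<omega> =
     (case passage_time b \<omega> of enat n \<Rightarrow> ennreal (walk \<omega> n - b) | \<infinity> \<Rightarrow> \<infinity>)"

end

theory Submission
  imports Defs "HOL-Complex_Analysis.Complex_Analysis" "HOL-Real_Asymp.Real_Asymp"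
begin

text \<open>
  At the passage time the walk jumps from some s \<open>\<le>\<close> b to a point above b. Dropping the
  requirement that this is the first passage bounds the k-th overshoot moment by a sum over all n,
  which the layer-cake formula turns into the renewal measure U of the intervals (b - L, b]. Inserting
  U(z, z + L] \<open>\<le>\<close> L / \<open>\<mu>\<close> + C exp(-r z), with C and r uniform in \<open>\<theta>\<close>, gives the theorem: the first
  summand produces the main term and the second one the factor k! / r^k exp(-r b).

  For the renewal bound let M be the moment generating function of the step. On a line Re s < 0 with
  |M| < 1 the smoothed renewal density is the Fourier integral of 1 / (1 - M(s)); moving the line to
  Re s = r crosses only the simple pole at 0, with residue \<open>-1 / \<mu>\<close>, and the rest is O(exp(-r y)).
  Since \<open>1 / \<mu>\<close> is unbounded as \<open>\<theta>\<close> tends to 0, no fixed smoothing scale loses little enough. The law of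
  S_n is therefore smoothed at a scale q^(2n): at high frequencies |M|^n decays like q^(3n), which
  pays for the integral of length q^(-2n), and the smoothing errors are summable in n.
\<close>

section \<open>Gaussian smoothing on vertical lines\<close>

text \<open>Exponents below 0 are not assumed integrable under \<open>F0\<close>: the left tail has
  only two moments, so the transform is controlled on Re w \<ge> 0 alone and 0 is a boundary point.
  After tilting by \<theta> the strip reaches left only to -\<theta>. The line -\<theta>/2 therefore
  serves for convergence only, since its bound m < 1 may tend to 1. Uniformity in \<theta> rests on
  a one-sided second-order expansion at 0 (mean 0, variance 1), which gives |1 - M(s)| \<ge> |s| |s
  + 2 \<theta>| / (4 M_0) at low frequency, M_0 being the transform of \<open>F0\<close> at
  \<theta>. The second root -2 \<theta> merges with the pole at 0 as \<theta> tends to 0, whence the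
  growth of 1 / \<mu>; but it stays to the left of the strip, so 1 - M is bounded below on Re s = r.
  On Re s = r, M may exceed 1 in modulus, with growth rate A per step. Undoing the smoothing uses a
  margin q^n: Chebyshev loses the fraction (q^(2n) / q^n)^2, and the two edges of length q^n carry
  density of order A^n. Both errors are at most of order (A q)^n, hence the requirement A q <
  1.\<close>

definition gauss_kernel :: "real \<Rightarrow> real \<Rightarrow> complex \<Rightarrow> complex" where
  "gauss_kernel \<epsilon> y s = exp (of_real (\<epsilon>\<^sup>2 / 2) * s\<^sup>2 - s * of_real y)"

lemma norm_gauss_kernel:
  "norm (gauss_kernel \<epsilon> y (Complex \<sigma> t)) = exp (\<epsilon>\<^sup>2 * \<sigma>\<^sup>2 / 2 - \<sigma> * y) * exp (- (\<epsilon>\<^sup>2 * t\<^sup>2 / 2))"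
  unfolding gauss_kernel_def norm_exp_eq_Re exp_add [symmetric]
  by (simp add: power2_eq_square algebra_simps diff_divide_distrib)

lemma gauss_kernel_measurable [measurable]:
  "(\<lambda>t. gauss_kernel \<epsilon> y (Complex \<sigma> t)) \<in> borel_measurable borel"
  unfolding gauss_kernel_def complex_eq_iff Complex_eq by measurable

lemma gaussian_integral:
  assumes "\<epsilon> > 0"
  shows "integrable lborel (\<lambda>t::real. exp (- (\<epsilon>\<^sup>2 * t\<^sup>2 / 2)))"
    and "(LBINT t. exp (- (\<epsilon>\<^sup>2 * t\<^sup>2 / 2))) = sqrt (2 * pi) / \<epsilon>"
proof -
  have eq: "exp (- (\<epsilon>\<^sup>2 * t\<^sup>2 / 2)) = sqrt (2 * pi) / \<epsilon> * normal_density 0 (1 / \<epsilon>) t" for t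
    using assms by (simp add: normal_density_def real_sqrt_divide power_divide field_simps real_sqrt_mult)
  show "integrable lborel (\<lambda>t::real. exp (- (\<epsilon>\<^sup>2 * t\<^sup>2 / 2)))"
    unfolding eq using assms by (intro integrable_mult_right) simp
  show "(LBINT t. exp (- (\<epsilon>\<^sup>2 * t\<^sup>2 / 2))) = sqrt (2 * pi) / \<epsilon>"
    unfolding eq using assms by simp
qed

lemma integrable_gauss_kernel:
  assumes "\<epsilon> > 0"
  shows "integrable lborel (\<lambda>t. gauss_kernel \<epsilon> y (Complex \<sigma> t))"
  by (rule Bochner_Integration.integrable_bound
        [OF integrable_mult_right [OF gaussian_integral(1) [OF assms], of "exp (\<epsilon>\<^sup>2 * \<sigma>\<^sup>2 / 2 - \<sigma> * y)"]])
     (auto simp: norm_gauss_kernel)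

lemma fourier_gaussian:
  assumes "\<epsilon> > 0"
  shows "(CLBINT t. complex_of_real (exp (- (\<epsilon>\<^sup>2 * t\<^sup>2 / 2))) * iexp (t * c)) = sqrt (2 * pi) / \<epsilon> * exp (- c\<^sup>2 / (2 * \<epsilon>\<^sup>2))"
proof -
  have "complex_of_real (exp (- ((c / \<epsilon>)\<^sup>2) / 2)) = (CLINT x|std_normal_distribution. iexp ((c / \<epsilon>) * x))"
    using fun_cong [OF char_std_normal_distribution, of "c / \<epsilon>"] by (simp only: char_def)
  also have "\<dots> = (CLBINT x. std_normal_density x *\<^sub>R iexp ((c / \<epsilon>) * x))"
    by (intro integral_density) auto
  also have "\<dots> = \<bar>\<epsilon>\<bar> *\<^sub>R (CLBINT t. std_normal_density (0 + \<epsilon> * t) *\<^sub>R iexp ((c / \<epsilon>) * (0 + \<epsilon> * t)))"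
    using assms by (subst lborel_integral_real_affine [where c = \<epsilon> and t = 0]) auto
  also have "\<dots> = (CLBINT t. (\<epsilon> / sqrt (2 * pi)) *\<^sub>R (complex_of_real (exp (- (\<epsilon>\<^sup>2 * t\<^sup>2 / 2))) * iexp (t * c)))"
    using assms
    by (subst integral_scaleR_right [symmetric])
       (auto intro!: Bochner_Integration.integral_cong simp: std_normal_density_def power_mult_distrib scaleR_conv_of_real mult_ac)
  also have "\<dots> = (\<epsilon> / sqrt (2 * pi)) *\<^sub>R (CLBINT t. complex_of_real (exp (- (\<epsilon>\<^sup>2 * t\<^sup>2 / 2))) * iexp (t * c))"
    by (rule integral_scaleR_right)
  finally show ?thesis
    using assms by (simp add: scaleR_conv_of_real field_simps power_divide)
qed

text \<open>The kernel is exp(-s y) times E exp(s Z) for Z centred normal with standard deviation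
  \<epsilon>. Completing the square removes \<sigma> from the value, so inversion may be carried out
  on any vertical line.\<close>

lemma integral_gauss_kernel:
  assumes "\<epsilon> > 0"
  shows "(CLBINT t. gauss_kernel \<epsilon> y (Complex \<sigma> t)) = 2 * pi * normal_density 0 \<epsilon> y"
proof -
  have eq: "gauss_kernel \<epsilon> y (Complex \<sigma> t) =
      exp (\<epsilon>\<^sup>2 * \<sigma>\<^sup>2 / 2 - \<sigma> * y) * (exp (- (\<epsilon>\<^sup>2 * t\<^sup>2 / 2)) * iexp (t * (\<epsilon>\<^sup>2 * \<sigma> - y)))" for t
    unfolding gauss_kernel_def exp_of_real [symmetric] exp_add [symmetric] Complex_eq
    by (intro arg_cong [where f = exp])
       (simp add: complex_eq_iff power2_eq_square algebra_simps diff_divide_distrib add_divide_distrib)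
  have "(CLBINT t. gauss_kernel \<epsilon> y (Complex \<sigma> t)) =
      exp (\<epsilon>\<^sup>2 * \<sigma>\<^sup>2 / 2 - \<sigma> * y) * (sqrt (2 * pi) / \<epsilon> * exp (- (\<epsilon>\<^sup>2 * \<sigma> - y)\<^sup>2 / (2 * \<epsilon>\<^sup>2)))"
    unfolding eq integral_mult_right_zero fourier_gaussian [OF assms] by simp
  also have "\<dots> = (sqrt (2 * pi) / \<epsilon>) *
      exp ((\<epsilon>\<^sup>2 * \<sigma>\<^sup>2 / 2 - \<sigma> * y) + (- (\<epsilon>\<^sup>2 * \<sigma> - y)\<^sup>2 / (2 * \<epsilon>\<^sup>2)))"
    by (simp only: exp_add) simp
  also have "(\<epsilon>\<^sup>2 * \<sigma>\<^sup>2 / 2 - \<sigma> * y) + (- (\<epsilon>\<^sup>2 * \<sigma> - y)\<^sup>2 / (2 * \<epsilon>\<^sup>2)) = - y\<^sup>2 / (2 * \<epsilon>\<^sup>2)"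
    using assms by (simp add: field_simps power2_eq_square)
  also have "complex_of_real (sqrt (2 * pi) / \<epsilon> * exp (- y\<^sup>2 / (2 * \<epsilon>\<^sup>2))) = 2 * pi * normal_density 0 \<epsilon> y"
  proof -
    have "sqrt (2 * pi) / \<epsilon> = 2 * pi / sqrt (2 * pi * \<epsilon>\<^sup>2)"
      using assms by (simp add: real_sqrt_mult field_simps)
    then show ?thesis
      by (simp add: normal_density_def flip: of_real_mult)
  qed
  finally show ?thesis .
qed

lemma gauss_kernel_diff: "gauss_kernel \<epsilon> (y - x) s = gauss_kernel \<epsilon> y s * exp (s * of_real x)"
  unfolding gauss_kernel_def exp_add [symmetric] by (simp add: algebra_simps)

text \<open>Fubini for the kernel at y - x: integrating over t first produces the smoothed density,
  integrating over x first the transform. The Gaussian factor in t gives absolute convergence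
  whatever the decay of the transform.\<close>

lemma gaussian_smoothing_inversion:
  assumes "\<epsilon> > 0" "prob_space N" and [measurable_cong]: "sets N = sets borel"
    and int: "integrable N (\<lambda>x. exp (\<sigma> * x))"
  shows "complex_of_real (2 * pi * (LINT x|N. normal_density 0 \<epsilon> (y - x))) =
    (CLBINT t. gauss_kernel \<epsilon> y (Complex \<sigma> t) * (CLINT x|N. exp (Complex \<sigma> t * of_real x)))"
proof -
  interpret N: prob_space N by fact
  interpret pair_sigma_finite lborel N ..
  define F where "F = (\<lambda>(t, x). gauss_kernel \<epsilon> (y - x) (Complex \<sigma> t))"
  have meas: "F \<in> borel_measurable (lborel \<Otimes>\<^sub>M N)"
    unfolding F_def gauss_kernel_def Complex_eq by measurable
  have normF: "norm (F (t, x)) = exp (\<epsilon>\<^sup>2 * \<sigma>\<^sup>2 / 2 - \<sigma> * y) * exp (- (\<epsilon>\<^sup>2 * t\<^sup>2 / 2)) * exp (\<sigma> * x)" for t x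
    by (simp add: F_def norm_gauss_kernel exp_add [symmetric] algebra_simps)
  have "integrable (lborel \<Otimes>\<^sub>M N) F"
  proof (rule Fubini_integrable [OF meas])
    show "integrable lborel (\<lambda>t. LINT x|N. norm (F (t, x)))"
      unfolding normF using gaussian_integral(1) [OF assms(1)] by simp
    have "integrable N (\<lambda>x. F (t, x))" for t
      by (rule Bochner_Integration.integrable_bound
            [OF integrable_mult_right [OF int, of "exp (\<epsilon>\<^sup>2 * \<sigma>\<^sup>2 / 2 - \<sigma> * y) * exp (- (\<epsilon>\<^sup>2 * t\<^sup>2 / 2))"]])
         (use meas in \<open>auto simp: normF\<close>)
    then show "AE t in lborel. integrable N (\<lambda>x. F (t, x))" by simp
  qed
  then have "(CLINT x|N. (CLBINT t. F (t, x))) = (CLBINT t. (CLINT x|N. F (t, x)))"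
    by (subst Fubini_integral [symmetric]) (auto simp: case_prod_unfold)
  moreover have "(CLBINT t. F (t, x)) = of_real (2 * pi * normal_density 0 \<epsilon> (y - x))" for x
    by (simp add: F_def integral_gauss_kernel [OF assms(1)])
  moreover have "(CLINT x|N. F (t, x)) =
      gauss_kernel \<epsilon> y (Complex \<sigma> t) * (CLINT x|N. exp (Complex \<sigma> t * of_real x))" for t
    by (simp add: F_def gauss_kernel_diff)
  ultimately show ?thesis
    by (metis (mono_tags, lifting) Bochner_Integration.integral_cong integral_complex_of_real integral_mult_right_zero)
qed

section \<open>The moment generating function near the imaginary axis\<close>

text \<open>Two-sided Laplace transform as a total function; where the integrand is not integrable
  the value is the default 0.\<close>

definition cmgf :: "real measure \<Rightarrow> complex \<Rightarrow> complex" where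
  "cmgf F w = (CLINT x|F. exp (w * of_real x))"

lemma norm_exp_minus_one_le:
  fixes z :: complex
  shows "norm (exp z - 1) \<le> norm z * max 1 (exp (Re z))"
proof -
  have "norm (exp z - exp 0) \<le> max 1 (exp (Re z)) * norm (z - 0)"
  proof (rule field_differentiable_bound [where S = "closed_segment 0 z" and f' = exp])
    fix w assume "w \<in> closed_segment 0 z"
    then obtain u where u: "0 \<le> u" "u \<le> 1" "w = of_real u * z"
      by (auto simp: in_segment scaleR_conv_of_real)
    have "u * Re z \<le> max 0 (Re z)"
      using u by (cases "Re z \<ge> 0") (auto simp: mult_left_le_one_le mult_nonneg_nonpos intro: order_trans)
    then show "norm (exp w) \<le> max 1 (exp (Re z))"
      using u by (auto simp: max_def split: if_splits)
  qed (auto intro!: derivative_eq_intros)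
  then show ?thesis by (simp add: mult.commute)
qed

text \<open>Mean value bound on the segment from 0 to z, where exp w - 1 is estimated in two ways.
  The cap 2 in the minimum is what permits dominated convergence with a second moment only: the
  uncapped quadratic remainder, multiplied by x, would ask for a third moment of the left
  tail.\<close>

lemma norm_exp_minus_one_minus_le:
  fixes z :: complex
  shows "norm (exp z - 1 - z) \<le> norm z * (min (norm z) 2 * max 1 (exp (Re z)))"
proof -
  have "norm ((exp z - z) - (exp 0 - 0)) \<le> (min (norm z) 2 * max 1 (exp (Re z))) * norm (z - 0)"
  proof (rule field_differentiable_bound [where S = "closed_segment 0 z" and f' = "\<lambda>w. exp w - 1"])
    fix w assume "w \<in> closed_segment 0 z"
    then obtain u where u: "0 \<le> u" "u \<le> 1" "w = of_real u * z"
      by (auto simp: in_segment scaleR_conv_of_real)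
    have "u * Re z \<le> max 0 (Re z)"
      using u by (cases "Re z \<ge> 0") (auto simp: mult_left_le_one_le mult_nonneg_nonpos intro: order_trans)
    then have mx: "max 1 (exp (Re w)) \<le> max 1 (exp (Re z))"
      using u by (auto simp: max_def split: if_splits)
    have "norm w \<le> norm z" using u by (simp add: norm_mult mult_left_le_one_le)
    then have "norm w * max 1 (exp (Re w)) \<le> norm z * max 1 (exp (Re z))"
      using mx by (intro mult_mono) auto
    moreover have "norm (exp w - 1) \<le> norm w * max 1 (exp (Re w))"
      by (rule norm_exp_minus_one_le)
    moreover have "norm (exp w - 1) \<le> exp (Re w) + 1"
      using norm_triangle_ineq4 [of "exp w" 1] by simp
    ultimately show "norm (exp w - 1) \<le> min (norm z) 2 * max 1 (exp (Re z))"
      using mx by (auto simp: min_def)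
  qed (auto intro!: derivative_eq_intros)
  then show ?thesis by (simp add: algebra_simps)
qed

lemma cmgf_of_real: "cmgf F (of_real \<sigma>) = of_real (LINT x|F. exp (\<sigma> * x))"
proof -
  have "cmgf F (of_real \<sigma>) = (CLINT x|F. of_real (exp (\<sigma> * x)))"
    unfolding cmgf_def by (intro Bochner_Integration.integral_cong) (auto simp flip: exp_of_real of_real_mult)
  then show ?thesis by simp
qed

section \<open>Characteristic functions of strongly non-lattice laws\<close>

context real_distribution
begin

text \<open>
  Equality in \<open>|E Z| \<le> 1\<close> makes \<open>exp (i t X)\<close> almost surely constant, which would put modulus 1
  at all multiples of t.
\<close>
lemma char_lattice:
  assumes "cmod (char M t) = 1"
  shows "char M (of_nat n * t) = char M t ^ n"
proof -
  define c where "c = cnj (char M t)"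
  have c: "c * char M t = 1" "cmod c = 1"
    using assms complex_norm_square [of "char M t"] by (simp_all add: c_def mult.commute)
  have int: "integrable M (\<lambda>x. Re (c * iexp (t * x)))"
    by (intro integrable_Re integrable_mult_right integrable_iexp) auto
  have "(LINT x|M. 1 - Re (c * iexp (t * x))) = 1 - (LINT x|M. Re (c * iexp (t * x)))"
    using prob_space by (subst Bochner_Integration.integral_diff [OF _ int]) auto
  also have "(LINT x|M. Re (c * iexp (t * x))) = Re (CLINT x|M. c * iexp (t * x))"
    by (intro integral_Re integrable_mult_right integrable_iexp) auto
  also have "(CLINT x|M. c * iexp (t * x)) = 1"
    using c by (simp add: char_def)
  finally have "(LINT x|M. 1 - Re (c * iexp (t * x))) = 0" by simp
  moreover have le: "Re (c * iexp (t * x)) \<le> 1" for x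
    using complex_Re_le_cmod [of "c * iexp (t * x)"] c(2) by (simp add: norm_mult)
  ultimately have "AE x in M. 1 - Re (c * iexp (t * x)) = 0"
    using int by (subst (asm) integral_nonneg_eq_0_iff_AE) (auto simp del: times_complex.sel)
  then have ae: "AE x in M. iexp (t * x) = char M t"
  proof eventually_elim
    case (elim x)
    have "cmod (c * iexp (t * x)) = 1" using c by (simp add: norm_mult)
    with elim have "c * iexp (t * x) = 1"
      by (simp add: complex_eq_iff cmod_def)
    then have "c * iexp (t * x) = c * char M t" using c by simp
    then show ?case using c(2) by auto
  qed
  have "char M (of_nat n * t) = (CLINT x|M. char M t ^ n)"
    unfolding char_def
  proof (rule integral_cong_AE)
    show "AE x in M. iexp (real n * t * x) = (CLINT x|M. iexp (t * x)) ^ n"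
      using ae
    proof eventually_elim
      case (elim x)
      have "iexp (real n * t * x) = iexp (t * x) ^ n"
        by (simp flip: exp_of_nat_mult add: algebra_simps)
      then show ?case using elim by (simp add: char_def)
    qed
  qed auto
  then show ?thesis using prob_space by simp
qed

text \<open>The limsup condition controls only large frequencies. Modulus 1 at some t \<noteq> 0
  would recur at all multiples of t, so it is excluded everywhere, and compactness handles the
  frequencies between T and the large ones.\<close>

lemma strongly_nonlattice_bound:
  assumes "strongly_nonlattice M" "T > 0"
  obtains \<kappa> where "\<kappa> < 1" "\<And>t. \<bar>t\<bar> \<ge> T \<Longrightarrow> cmod (char M t) \<le> \<kappa>"
proof -
  obtain y where y: "Limsup at_infinity (\<lambda>t. ereal (cmod (char M t))) < y" "y < 1"
    using assms(1) dense unfolding strongly_nonlattice_def by blast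
  obtain B where B: "\<And>t. B \<le> \<bar>t\<bar> \<Longrightarrow> ereal (cmod (char M t)) < y"
    using Limsup_lessD [OF y(1)] by (auto simp: eventually_at_infinity)
  have "0 \<le> y"
    using B [of B] B [of "\<bar>B\<bar>"] by (metis abs_ge_self abs_idempotent ereal_less_eq(5) less_imp_le norm_ge_zero order_trans)
  then obtain \<kappa>1 where \<kappa>1: "y = ereal \<kappa>1" "\<kappa>1 < 1"
    using y(2) by (cases y) auto
  have lt1: "cmod (char M t) < 1" if "t \<noteq> 0" for t
  proof (rule ccontr)
    assume "\<not> cmod (char M t) < 1"
    then have eq: "cmod (char M t) = 1" using cmod_char_le_1 [of t] by simp
    \<comment> \<open>A multiple of t beyond B, where the modulus is already known to be below
      1.\<close>
    obtain n :: nat where "B / \<bar>t\<bar> \<le> n" using real_arch_simple by blast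
    then have "B \<le> \<bar>real n * t\<bar>" using that by (simp add: abs_mult field_simps)
    then have "cmod (char M (real n * t)) < \<kappa>1" using B \<kappa>1 by fastforce
    then show False using char_lattice [OF eq] \<kappa>1(2) eq by (simp add: norm_power)
  qed
  define K where "K = {t. T \<le> \<bar>t\<bar> \<and> \<bar>t\<bar> \<le> max T B}"
  have "K = {- max T B..- T} \<union> {T..max T B}" using assms(2) by (auto simp: K_def)
  then have "compact K" by (metis compact_Icc compact_Un)
  moreover have "K \<noteq> {}" using assms(2) by (auto simp: K_def intro!: exI [of _ T])
  moreover have "continuous_on K (\<lambda>t. cmod (char M t))"
    by (intro continuous_on_norm continuous_at_imp_continuous_on) (auto simp: isCont_char)
  ultimately obtain t0 where t0: "t0 \<in> K" "\<And>t. t \<in> K \<Longrightarrow> cmod (char M t) \<le> cmod (char M t0)"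
    using continuous_attains_sup by metis
  show ?thesis
  proof (rule that [of "max \<kappa>1 (cmod (char M t0))"])
    show "max \<kappa>1 (cmod (char M t0)) < 1"
      using \<kappa>1(2) lt1 [of t0] t0(1) assms(2) by (auto simp: K_def)
    show "cmod (char M t) \<le> max \<kappa>1 (cmod (char M t0))" if "\<bar>t\<bar> \<ge> T" for t
      using that B [of t] t0(2) [of t] \<kappa>1 by (cases "B \<le> \<bar>t\<bar>") (auto simp: K_def)
  qed
qed

end

section \<open>The transform of \<open>F0\<close> in the right half-plane\<close>

context standard_exponential_family
begin

lemma param_space_mono: "c \<in> param_space \<theta>max \<Longrightarrow> 0 \<le> \<sigma> \<Longrightarrow> \<sigma> \<le> c \<Longrightarrow> \<sigma> \<in> param_space \<theta>max"
  by (auto simp: param_space_def intro: le_less_trans [of "ereal \<sigma>" "ereal c"])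

lemma integrable_exp_of_real [simp]:
  "Re w \<in> param_space \<theta>max \<Longrightarrow> integrable F0 (\<lambda>x. exp (w * complex_of_real x))"
  by (rule Bochner_Integration.integrable_bound [OF exp_integrable, of "Re w"]) auto

text \<open>Common majorant for the differentiations and comparisons below. For x < 0 it is 1 + x^2,
  which is all that the left tail allows; for x \<ge> 0 the factor x^2 is absorbed by the spare
  exponent c - \<sigma>.\<close>

lemma integrable_weight:
  assumes c: "c \<in> param_space \<theta>max" and \<sigma>: "0 \<le> \<sigma>" "\<sigma> < c"
  shows "integrable F0 (\<lambda>x. (1 + x\<^sup>2) * max 1 (exp (\<sigma> * x)))"
proof (rule Bochner_Integration.integrable_bound)
  show "integrable F0 (\<lambda>x. 1 + x\<^sup>2 + (1 + 2 / (c - \<sigma>)\<^sup>2) * exp (c * x))"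
    using square_integrable exp_integrable [OF c] by auto
  show "AE x in F0. norm ((1 + x\<^sup>2) * max 1 (exp (\<sigma> * x)))
      \<le> norm (1 + x\<^sup>2 + (1 + 2 / (c - \<sigma>)\<^sup>2) * exp (c * x))"
  proof (rule AE_I2)
    fix x :: real
    have "(1 + x\<^sup>2) * max 1 (exp (\<sigma> * x)) \<le> 1 + x\<^sup>2 + (1 + 2 / (c - \<sigma>)\<^sup>2) * exp (c * x)"
    proof (cases "x \<ge> 0")
      case True
      have "((c - \<sigma>) * x)\<^sup>2 / 2 \<le> exp ((c - \<sigma>) * x)"
        using exp_lower_Taylor_quadratic [of "(c - \<sigma>) * x"] True \<sigma> by (smt (verit) mult_nonneg_nonneg)
      then have "(c - \<sigma>)\<^sup>2 * x\<^sup>2 \<le> 2 * exp ((c - \<sigma>) * x)"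
        by (simp add: power_mult_distrib)
      then have "x\<^sup>2 \<le> 2 / (c - \<sigma>)\<^sup>2 * exp ((c - \<sigma>) * x)"
        using \<sigma> by (simp add: pos_le_divide_eq mult.commute)
      then have "x\<^sup>2 * exp (\<sigma> * x) \<le> 2 / (c - \<sigma>)\<^sup>2 * exp ((c - \<sigma>) * x) * exp (\<sigma> * x)"
        by (intro mult_right_mono) auto
      also have "\<dots> = 2 / (c - \<sigma>)\<^sup>2 * exp (c * x)"
        by (simp add: mult.assoc algebra_simps flip: exp_add)
      finally have "x\<^sup>2 * exp (\<sigma> * x) \<le> 2 / (c - \<sigma>)\<^sup>2 * exp (c * x)" .
      moreover have "exp (\<sigma> * x) \<le> exp (c * x)" using True \<sigma> by (simp add: mult_right_mono)
      moreover have "max 1 (exp (\<sigma> * x)) = exp (\<sigma> * x)" using True \<sigma> by simp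
      ultimately have "(1 + x\<^sup>2) * max 1 (exp (\<sigma> * x)) \<le> (1 + 2 / (c - \<sigma>)\<^sup>2) * exp (c * x)"
        using add_mono [of "exp (\<sigma> * x)" "exp (c * x)" "x\<^sup>2 * exp (\<sigma> * x)" "2 / (c - \<sigma>)\<^sup>2 * exp (c * x)"]
        by (simp add: ring_distribs)
      then show ?thesis by (smt (verit) zero_le_power2)
    next
      case False
      then have "\<sigma> * x \<le> 0" using \<sigma> by (simp add: mult_nonneg_nonpos)
      then have "max 1 (exp (\<sigma> * x)) = 1" by simp
      then show ?thesis by simp
    qed
    then show "norm ((1 + x\<^sup>2) * max 1 (exp (\<sigma> * x))) \<le> norm (1 + x\<^sup>2 + (1 + 2 / (c - \<sigma>)\<^sup>2) * exp (c * x))"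
      by simp
  qed
qed simp

lemma abs_le_weight: "\<bar>x\<bar> \<le> 1 + (x::real)\<^sup>2"
  using zero_le_power2 [of "\<bar>x\<bar> - 1"] by (simp add: power2_eq_square algebra_simps)

lemma max_exp_mono: "0 \<le> \<sigma> \<Longrightarrow> \<sigma> \<le> \<sigma>' \<Longrightarrow> max 1 (exp (\<sigma> * x)) \<le> max 1 (exp (\<sigma>' * x))" for x :: real
  by (cases "x \<ge> 0") (auto simp: mult_right_mono max_def mult_nonneg_nonpos zero_le_mult_iff)

lemma integrable_times_exp:
  assumes c: "c \<in> param_space \<theta>max" and w: "0 \<le> Re w" "Re w < c"
  shows "integrable F0 (\<lambda>x. of_real x * exp (w * complex_of_real x))"
proof (rule Bochner_Integration.integrable_bound [OF integrable_weight [OF c w]], goal_cases)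
  case 2
  have "norm (of_real x * exp (w * complex_of_real x)) \<le> (1 + x\<^sup>2) * max 1 (exp (Re w * x))" for x
    unfolding norm_mult by (intro mult_mono) (auto simp: abs_le_weight)
  then show ?case by (auto intro: order_trans)
qed simp

text \<open>Differentiation under the integral, done by hand: the Taylor remainder of exp in h is at
  most |h|^2 times the weight of \<open>integrable_weight\<close>, so the difference quotient errs
  by O(|h|).\<close>

lemma cmgf_has_field_derivative:
  assumes c: "c \<in> param_space \<theta>max" and w: "0 < Re w" "Re w < c"
  shows "(cmgf F0 has_field_derivative (CLINT x|F0. of_real x * exp (w * of_real x))) (at w)"
  unfolding DERIV_def
proof (rule Lim_null [THEN iffD2], rule Lim_null_comparison)
  \<comment> \<open>The midpoint leaves room on both sides: Re (w + h) stays below \<sigma> for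
    small h, and \<sigma> < c keeps the weight integrable.\<close>
  define \<sigma> where "\<sigma> = (Re w + c) / 2"
  define G where "G = (LINT x|F0. (1 + x\<^sup>2) * max 1 (exp (\<sigma> * x)))"
  have \<sigma>: "0 \<le> \<sigma>" "\<sigma> < c" using w by (auto simp: \<sigma>_def)
  show "\<forall>\<^sub>F h in at 0. norm ((cmgf F0 (w + h) - cmgf F0 w) / h - (CLINT x|F0. of_real x * exp (w * of_real x)))
      \<le> norm h * G"
    unfolding eventually_at
  proof (intro exI [of _ "min (Re w) (\<sigma> - Re w)"] conjI ballI impI)
    show "0 < min (Re w) (\<sigma> - Re w)" using w by (auto simp: \<sigma>_def)
    fix h :: complex assume h: "h \<noteq> 0 \<and> dist h 0 < min (Re w) (\<sigma> - Re w)"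
    have Reh: "0 < Re (w + h)" "Re (w + h) \<le> \<sigma>" "Re w \<le> \<sigma>"
      using h abs_Re_le_cmod [of h] w by (auto simp: \<sigma>_def)
    have p: "Re w \<in> param_space \<theta>max" "Re (w + h) \<in> param_space \<theta>max"
      using c w Reh \<sigma> by (auto intro: param_space_mono)
    have ie: "integrable F0 (\<lambda>x. exp (w * complex_of_real x))"
        "integrable F0 (\<lambda>x. exp ((w + h) * complex_of_real x))"
        "integrable F0 (\<lambda>x. h * (of_real x * exp (w * complex_of_real x)))"
      using p integrable_times_exp [OF c, of w] w by auto
    have pt: "norm (exp ((w + h) * of_real x) - exp (w * of_real x) - h * (of_real x * exp (w * of_real x)))
        \<le> (norm h)\<^sup>2 * ((1 + x\<^sup>2) * max 1 (exp (\<sigma> * x)))" (is "?l \<le> _") for x :: real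
    proof -
      have "?l = norm (exp (w * of_real x) * (exp (h * of_real x) - 1 - h * of_real x))"
        by (intro arg_cong [where f = norm]) (simp add: algebra_simps exp_add)
      also have "\<dots> \<le> exp (Re w * x) * (norm (h * of_real x) * (norm (h * of_real x) * max 1 (exp (Re (h * of_real x)))))"
        unfolding norm_mult [of "exp (w * of_real x)"]
        by (intro mult_mono order_trans [OF norm_exp_minus_one_minus_le] mult_left_mono mult_right_mono) auto
      also have "\<dots> = (norm h)\<^sup>2 * (x\<^sup>2 * max (exp (Re w * x)) (exp (Re (w + h) * x)))"
        by (simp add: norm_mult power2_eq_square max_mult_distrib_left exp_add algebra_simps abs_mult_self_eq)
      also have "max (exp (Re w * x)) (exp (Re (w + h) * x)) \<le> max 1 (exp (\<sigma> * x))"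
        using max_exp_mono [of "Re w" \<sigma> x] max_exp_mono [of "Re (w + h)" \<sigma> x] w Reh by linarith
      finally show ?thesis
        by (smt (verit, best) mult_left_mono mult_right_mono zero_le_power2)
    qed
    have "(cmgf F0 (w + h) - cmgf F0 w) / h - (CLINT x|F0. of_real x * exp (w * of_real x)) =
        (CLINT x|F0. exp ((w + h) * of_real x) - exp (w * of_real x) - h * (of_real x * exp (w * of_real x))) / h"
      using h ie unfolding cmgf_def by (simp add: diff_divide_distrib)
    also have "norm \<dots> \<le> (norm h)\<^sup>2 * G / norm h"
      unfolding norm_divide G_def integral_mult_right_zero [symmetric]
      by (intro divide_right_mono Bochner_Integration.integral_norm_bound_integral integrable_mult_right integrable_weight [OF c \<sigma>] Bochner_Integration.integrable_diff ie pt) auto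
    finally show "norm ((cmgf F0 (w + h) - cmgf F0 w) / h - (CLINT x|F0. of_real x * exp (w * of_real x))) \<le> norm h * G"
      using h by (simp add: power2_eq_square)
  qed
  show "((\<lambda>h. norm h * G) \<longlongrightarrow> 0) (at 0)"
    by (auto intro!: tendsto_eq_intros)
qed

lemma expectation_square: "(LINT x|F0. x\<^sup>2) = 1"
  using variance_one mean_zero by simp

text \<open>The derivative is v + o(|v|), because mean 0 and variance 1 are the first two Taylor
  coefficients of the integrand. The estimate includes the imaginary axis but only one side of
  it.\<close>

lemma cmgf_deriv_near_zero:
  obtains \<rho> where "\<rho> > 0" "\<rho> \<in> param_space \<theta>max"
    "\<And>v. 0 \<le> Re v \<Longrightarrow> norm v \<le> \<rho> \<Longrightarrow> norm ((CLINT x|F0. of_real x * exp (v * of_real x)) - v) \<le> norm v / 4"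
proof -
  obtain c0 where c0: "0 < ereal c0" "ereal c0 < \<theta>max" using \<theta>max_pos ereal_dense2 by blast
  then have c: "c0 \<in> param_space \<theta>max" "0 < c0" by (auto simp: param_space_def)
  define c1 where "c1 = c0 / 2"
  have c1: "0 \<le> c1" "c1 < c0" "0 < c1" using c by (auto simp: c1_def)
  \<comment> \<open>Remainder of the expansion divided by |v|, with |v| replaced by its bound 1 / (n
    + 1). It is dominated by twice the weight and tends to 0 pointwise, so its integral drops below
    1/4 for some n.\<close>
  define g where "g = (\<lambda>(n::nat) x. x\<^sup>2 * (min (\<bar>x\<bar> / Suc n) 2 * max 1 (exp (c1 * x))))"
  have dom: "norm (g n x) \<le> 2 * ((1 + x\<^sup>2) * max 1 (exp (c1 * x)))" for n x
  proof -
    have "g n x \<le> (1 + x\<^sup>2) * (2 * max 1 (exp (c1 * x)))"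
      unfolding g_def by (intro mult_mono) auto
    moreover have "0 \<le> g n x" by (auto simp: g_def)
    ultimately show ?thesis by simp
  qed
  have "(\<lambda>n. LINT x|F0. g n x) \<longlonglongrightarrow> (LINT x|F0. 0)"
  proof (rule integral_dominated_convergence)
    show "integrable F0 (\<lambda>x. 2 * ((1 + x\<^sup>2) * max 1 (exp (c1 * x))))"
      using integrable_weight [OF c(1) c1(1,2)] by (rule integrable_mult_right)
    show "AE x in F0. (\<lambda>n. g n x) \<longlonglongrightarrow> 0"
    proof (rule AE_I2)
      fix x
      have "(\<lambda>n. x\<^sup>2 * (min (\<bar>x\<bar> / real (Suc n)) 2 * max 1 (exp (c1 * x)))) \<longlonglongrightarrow> x\<^sup>2 * (min 0 2 * max 1 (exp (c1 * x)))"
        by (intro tendsto_intros LIMSEQ_Suc [OF lim_const_over_n])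
      then show "(\<lambda>n. g n x) \<longlonglongrightarrow> 0" by (simp add: g_def)
    qed
  qed (use dom in \<open>auto simp: g_def\<close>)
  then have "\<forall>\<^sub>F n in sequentially. (LINT x|F0. g n x) < 1 / 4"
    by (auto intro: order_tendstoD(2) [where y = 0])
  then obtain n where n: "(LINT x|F0. g n x) < 1 / 4" by (auto simp: eventually_sequentially)
  define \<rho> where "\<rho> = min c1 (1 / real (Suc n))"
  show ?thesis
  proof (rule that [of \<rho>])
    show "\<rho> > 0" using c1 by (auto simp: \<rho>_def)
    show "\<rho> \<in> param_space \<theta>max" using c c1 by (intro param_space_mono [OF c(1)]) (auto simp: \<rho>_def)
    fix v :: complex assume v: "0 \<le> Re v" "norm v \<le> \<rho>"
    have Rev: "Re v \<le> c1" using v complex_Re_le_cmod [of v] by (auto simp: \<rho>_def)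
    have ix: "integrable F0 (\<lambda>x. complex_of_real x)"
      using integrable_times_exp [OF c(1), of 0] c by simp
    have ix2: "integrable F0 (\<lambda>x. v * complex_of_real (x\<^sup>2))"
      using square_integrable by (intro integrable_mult_right integrable_of_real)
    have ie: "integrable F0 (\<lambda>x. of_real x * exp (v * complex_of_real x))"
      using c1 Rev by (intro integrable_times_exp [OF c(1)] v) simp
    have pt: "norm (of_real x * exp (v * complex_of_real x) - of_real x - v * of_real (x\<^sup>2)) \<le> norm v * g n x" (is "?l \<le> _") for x
    proof -
      have "?l = norm (of_real x * (exp (v * of_real x) - 1 - v * of_real x))"
        by (intro arg_cong [where f = norm]) (simp add: algebra_simps power2_eq_square)
      also have "\<dots> \<le> \<bar>x\<bar> * (norm (v * of_real x) * (min (norm (v * of_real x)) 2 * max 1 (exp (Re (v * of_real x)))))"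
        unfolding norm_mult [of "of_real x"] norm_of_real
        by (intro mult_left_mono norm_exp_minus_one_minus_le) auto
      also have "\<dots> = norm v * (x\<^sup>2 * (min (norm v * \<bar>x\<bar>) 2 * max 1 (exp (Re v * x))))"
        by (simp add: norm_mult power2_eq_square algebra_simps abs_mult_self_eq)
      also have "\<dots> \<le> norm v * g n x"
        unfolding g_def
      proof (intro mult_left_mono mult_mono max_exp_mono)
        have "norm v * \<bar>x\<bar> \<le> 1 / real (Suc n) * \<bar>x\<bar>"
          using v by (intro mult_right_mono) (auto simp: \<rho>_def)
        then show "min (norm v * \<bar>x\<bar>) 2 \<le> min (\<bar>x\<bar> / real (Suc n)) 2" by auto
      qed (use v Rev in auto)
      finally show ?thesis .
    qed
    have "(CLINT x|F0. of_real x * exp (v * of_real x)) - v =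
        (CLINT x|F0. of_real x * exp (v * of_real x) - of_real x - v * of_real (x\<^sup>2))"
    proof -
      have "(CLINT x|F0. of_real x * exp (v * of_real x) - of_real x - v * of_real (x\<^sup>2)) =
        (CLINT x|F0. of_real x * exp (v * of_real x)) - (CLINT x|F0. complex_of_real x) - (CLINT x|F0. v * of_real (x\<^sup>2))"
        using ix ix2 ie by (simp del: of_real_power)
      also have "(CLINT x|F0. complex_of_real x) = 0" using mean_zero by simp
      also have "(CLINT x|F0. v * of_real (x\<^sup>2)) = v"
        using expectation_square by (simp only: integral_mult_right_zero integral_complex_of_real of_real_1 mult_1_right)
      finally show ?thesis by simp
    qed
    also have "norm \<dots> \<le> (LINT x|F0. norm v * g n x)"
    proof (intro Bochner_Integration.integral_norm_bound_integral pt)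
      have "integrable F0 (g n)"
        by (rule Bochner_Integration.integrable_bound [OF integrable_mult_right [OF integrable_weight [OF c(1) c1(1,2)], of 2]])
           (use dom [of n] in \<open>auto intro!: AE_I2 simp: g_def intro: order_trans\<close>)
      then show "integrable F0 (\<lambda>x. norm v * g n x)" by (rule integrable_mult_right)
    qed (use ix ix2 ie in auto)
    also have "\<dots> \<le> norm v * (1 / 4)"
      using n by (simp only: integral_mult_right_zero) (intro mult_left_mono, auto)
    finally show "norm ((CLINT x|F0. of_real x * exp (v * of_real x)) - v) \<le> norm v / 4" by simp
  qed
qed

text \<open>Subtracting w^2 / 2 leaves a function whose derivative is at most R / 4 on a convex
  half-disc of radius R. Hence the difference deviates from (w^2 - \<theta>^2) / 2 by at most half
  of its modulus, and 1/2 - 1/4 = 1/4 remains. Thus w = \<theta> is the only solution of equality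
  there.\<close>

lemma cmgf_diff_lower_bound:
  assumes \<rho>: "\<rho> \<in> param_space \<theta>max" "\<And>v. 0 \<le> Re v \<Longrightarrow> norm v \<le> \<rho> \<Longrightarrow>
      norm ((CLINT x|F0. of_real x * exp (v * of_real x)) - v) \<le> norm v / 4"
    and w: "0 < Re w" "norm w < \<rho>" and \<theta>: "0 < \<theta>" "\<theta> < \<rho>"
  shows "norm (w - of_real \<theta>) * norm (w + of_real \<theta>) / 4 \<le> norm (cmgf F0 w - cmgf F0 (of_real \<theta>))"
proof -
  define R where "R = max (norm w) \<theta>"
  define S where "S = {v. 0 < Re v} \<inter> cball 0 R"
  have "norm ((cmgf F0 w - w\<^sup>2 / 2) - (cmgf F0 (of_real \<theta>) - (of_real \<theta>)\<^sup>2 / 2)) \<le> (R / 4) * norm (w - of_real \<theta>)"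
  proof (rule field_differentiable_bound [where S = S and f' = "\<lambda>v. (CLINT x|F0. of_real x * exp (v * of_real x)) - v"])
    show "convex S" unfolding S_def by (intro convex_Int convex_halfspace_Re_gt convex_cball)
    fix v assume v: "v \<in> S"
    then have v': "0 < Re v" "norm v \<le> R" "Re v < \<rho>" "norm v \<le> \<rho>"
      using w \<theta> complex_Re_le_cmod [of v] by (auto simp: S_def R_def)
    show "((\<lambda>v. cmgf F0 v - v\<^sup>2 / 2) has_field_derivative (CLINT x|F0. of_real x * exp (v * of_real x)) - v) (at v within S)"
      by (rule derivative_eq_intros has_field_derivative_at_within [OF cmgf_has_field_derivative [OF \<rho>(1) v'(1,3)]] refl | simp)+
    show "norm ((CLINT x|F0. of_real x * exp (v * of_real x)) - v) \<le> R / 4"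
      using \<rho>(2) [of v] v' by simp
  qed (use w \<theta> in \<open>auto simp: S_def R_def\<close>)
  \<comment> \<open>This converts the additive error into a multiple of |w - \<theta>| |w +
    \<theta>|; it uses that w and \<theta> both lie to the right of the imaginary axis.\<close>
  moreover have "R \<le> norm (w + of_real \<theta>)"
  proof -
    have "(norm w)\<^sup>2 \<le> (norm (w + of_real \<theta>))\<^sup>2"
      using w \<theta> unfolding cmod_power2 by (intro add_mono) (auto intro: power_mono)
    then have "norm w \<le> norm (w + of_real \<theta>)" by (rule power2_le_imp_le) simp
    moreover have "\<theta> \<le> norm (w + of_real \<theta>)"
      using complex_Re_le_cmod [of "w + of_real \<theta>"] w by simp
    ultimately show ?thesis by (simp add: R_def)
  qed
  then have "(R / 4) * norm (w - of_real \<theta>) \<le> norm (w + of_real \<theta>) / 4 * norm (w - of_real \<theta>)"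
    by (intro mult_right_mono) auto
  moreover have "norm ((w\<^sup>2 - (of_real \<theta>)\<^sup>2) / 2) = norm (w - of_real \<theta>) * norm (w + of_real \<theta>) / 2"
    by (simp add: norm_divide norm_mult [symmetric]) (simp add: power2_eq_square algebra_simps)
  moreover have "norm ((w\<^sup>2 - (of_real \<theta>)\<^sup>2) / 2) \<le>
      norm (cmgf F0 w - cmgf F0 (of_real \<theta>)) +
      norm ((cmgf F0 w - w\<^sup>2 / 2) - (cmgf F0 (of_real \<theta>) - (of_real \<theta>)\<^sup>2 / 2))"
    using norm_triangle_ineq4 [of "cmgf F0 w - cmgf F0 (of_real \<theta>)"
        "(cmgf F0 w - w\<^sup>2 / 2) - (cmgf F0 (of_real \<theta>) - (of_real \<theta>)\<^sup>2 / 2)"]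
    by (simp add: diff_divide_distrib algebra_simps)
  ultimately show ?thesis by (simp add: mult.commute)
qed

lemma mgf_ge_1:
  assumes "\<sigma> \<in> param_space \<theta>max"
  shows "1 \<le> (LINT x|F0. exp (\<sigma> * x))"
proof -
  have ix: "integrable F0 (\<lambda>x. x)"
    by (rule Bochner_Integration.integrable_bound [where f = "\<lambda>x. 1 + x\<^sup>2"])
       (use square_integrable abs_le_weight in auto)
  have "(LINT x|F0. 1 + \<sigma> * x) \<le> (LINT x|F0. exp (\<sigma> * x))"
    using ix exp_integrable [OF assms] by (intro integral_mono) auto
  moreover have "(LINT x|F0. 1 + \<sigma> * x) = 1"
    using ix mean_zero prob_space by simp
  ultimately show ?thesis by simp
qed

lemma norm_cmgf_le:
  assumes "Re w \<in> param_space \<theta>max"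
  shows "norm (cmgf F0 w) \<le> (LINT x|F0. exp (Re w * x))"
  unfolding cmgf_def
  by (rule Bochner_Integration.integral_norm_bound_integral) (use assms exp_integrable in auto)

text \<open>Transfers the non-lattice bound from the imaginary axis to nearby vertical lines,
  uniformly in Im w.\<close>

lemma cmgf_near_char:
  assumes c: "c \<in> param_space \<theta>max" "0 \<le> \<sigma>" "\<sigma> < c" and w: "0 \<le> Re w" "Re w \<le> \<sigma>"
  shows "norm (cmgf F0 w - char F0 (Im w)) \<le> Re w * (LINT x|F0. (1 + x\<^sup>2) * max 1 (exp (\<sigma> * x)))"
proof -
  have p: "Re w \<in> param_space \<theta>max" using c w by (auto intro: param_space_mono)
  have i: "integrable F0 (\<lambda>x. exp (w * complex_of_real x))" "integrable F0 (\<lambda>x. iexp (Im w * x))"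
    using p by (auto intro: integrable_iexp)
  have "cmgf F0 w - char F0 (Im w) = (CLINT x|F0. exp (w * of_real x) - iexp (Im w * x))"
    unfolding cmgf_def char_def by (rule Bochner_Integration.integral_diff [symmetric]; fact i)
  also have "norm \<dots> \<le> (LINT x|F0. Re w * ((1 + x\<^sup>2) * max 1 (exp (\<sigma> * x))))"
  proof (intro Bochner_Integration.integral_norm_bound_integral Bochner_Integration.integrable_diff i integrable_mult_right integrable_weight [OF c])
    fix x :: real
    have e: "exp (w * of_real x) = iexp (Im w * x) * exp (of_real (Re w * x))"
      unfolding exp_add [symmetric] by (intro arg_cong [where f = exp]) (simp add: complex_eq_iff algebra_simps)
    have "norm (exp (w * of_real x) - iexp (Im w * x)) = norm (iexp (Im w * x) * (exp (of_real (Re w * x)) - 1))"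
      unfolding e by (simp add: algebra_simps)
    also have "\<dots> = norm (exp (complex_of_real (Re w * x)) - 1)"
      unfolding norm_mult by simp
    also have "\<dots> \<le> norm (complex_of_real (Re w * x)) * max 1 (exp (Re (of_real (Re w * x))))"
      by (rule norm_exp_minus_one_le)
    also have "\<dots> \<le> Re w * \<bar>x\<bar> * max 1 (exp (Re w * x))"
      using w by (simp add: abs_mult norm_mult)
    also have "\<dots> \<le> Re w * (1 + x\<^sup>2) * max 1 (exp (\<sigma> * x))"
      using w by (intro mult_mono max_exp_mono mult_left_mono abs_le_weight) auto
    finally show "norm (exp (w * of_real x) - iexp (Im w * x)) \<le> Re w * ((1 + x\<^sup>2) * max 1 (exp (\<sigma> * x)))"
      by (simp add: mult.assoc)
  qed
  finally show ?thesis by simp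
qed

text \<open>All constants are chosen here, before any \<theta> is fixed. The range 3 r accommodates
  \<theta> + s with \<theta> \<le> r and Re s < 2 r.\<close>

lemma spectral_constants:
  obtains r T \<kappa> q A where "r > 0" "T > 0" "0 < \<kappa>" "\<kappa> < 1" "0 < q" "q < 1" "\<kappa> \<le> q ^ 3" "1 \<le> A" "A * q < 1"
    "3 * r \<in> param_space \<theta>max"
    "\<And>w. 0 \<le> Re w \<Longrightarrow> Re w \<le> 3 * r \<Longrightarrow> T \<le> \<bar>Im w\<bar> \<Longrightarrow> norm (cmgf F0 w) \<le> \<kappa>"
    "\<And>w \<theta>. 0 < Re w \<Longrightarrow> Re w < 3 * r \<Longrightarrow> \<bar>Im w\<bar> \<le> T \<Longrightarrow> 0 < \<theta> \<Longrightarrow> \<theta> < 3 * r \<Longrightarrow>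
       norm (w - of_real \<theta>) * norm (w + of_real \<theta>) / 4 \<le> norm (cmgf F0 w - cmgf F0 (of_real \<theta>))"
    "\<And>\<sigma>. 0 \<le> \<sigma> \<Longrightarrow> \<sigma> \<le> 3 * r \<Longrightarrow> (LINT x|F0. exp (\<sigma> * x)) \<le> A"
    "\<And>\<theta>. 0 < \<theta> \<Longrightarrow> \<theta> \<le> 3 * r \<Longrightarrow> 0 < (LINT x|F0. x * exp (\<theta> * x))"
proof -
  obtain \<rho> where \<rho>: "\<rho> > 0" "\<rho> \<in> param_space \<theta>max"
    "\<And>v. 0 \<le> Re v \<Longrightarrow> norm v \<le> \<rho> \<Longrightarrow> norm ((CLINT x|F0. of_real x * exp (v * of_real x)) - v) \<le> norm v / 4"
    using cmgf_deriv_near_zero by blast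
  \<comment> \<open>With 3 r \<le> \<rho> / 4 the low-frequency rectangle lies inside the disc of
    radius \<rho> where the expansion at 0 holds.\<close>
  define T where "T = \<rho> / 4"
  have T: "T > 0" using \<rho> by (simp add: T_def)
  obtain \<kappa>0 where \<kappa>0: "\<kappa>0 < 1" "\<And>t. \<bar>t\<bar> \<ge> T \<Longrightarrow> cmod (char F0 t) \<le> \<kappa>0"
    using strongly_nonlattice_bound [OF nonlattice T] by blast
  \<comment> \<open>Strictly between \<open>\<kappa>0\<close> and 1: the gap is spent on leaving the
    imaginary axis, and positivity allows the cube root.\<close>
  define \<kappa> where "\<kappa> = (1 + max 0 \<kappa>0) / 2"
  have \<kappa>: "0 < \<kappa>" "\<kappa> < 1" "\<kappa>0 < \<kappa>" using \<kappa>0 by (auto simp: \<kappa>_def max_def)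
  define q where "q = root 3 \<kappa>"
  have q: "0 < q" "q < 1" "q ^ 3 = \<kappa>" using \<kappa> by (auto simp: q_def)
  \<comment> \<open>Midpoint of 1 and 1 / q, so A > 1 leaves room for the transform at positive
    exponents while A q < 1.\<close>
  define A where "A = (1 + 1 / q) / 2"
  have A: "1 < A" "A * q < 1" using q by (auto simp: A_def field_simps)
  define G where "G = (LINT x|F0. (1 + x\<^sup>2) * max 1 (exp (\<rho> / 2 * x)))"
  have "G \<ge> 0" unfolding G_def by (intro integral_nonneg_AE AE_I2) auto
  \<comment> \<open>Small enough that moving up to 3 r away from the imaginary axis changes the
    transform by no more than either gap, \<kappa> - \<open>\<kappa>0\<close> at high frequency and
    A - 1 at frequency 0.\<close>
  define r where "r = min (\<rho> / 12) (min (\<kappa> - \<kappa>0) (A - 1) / (3 * (G + 1)))"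
  have r: "0 < r" "3 * r \<le> \<rho> / 4" "3 * r * (G + 1) \<le> \<kappa> - \<kappa>0" "3 * r * (G + 1) \<le> A - 1"
  proof -
    show "0 < r" "3 * r \<le> \<rho> / 4" using \<rho> \<kappa> A \<open>G \<ge> 0\<close> by (auto simp: r_def)
    have "r \<le> min (\<kappa> - \<kappa>0) (A - 1) / (3 * (G + 1))" by (simp add: r_def)
    then have "r * (3 * (G + 1)) \<le> min (\<kappa> - \<kappa>0) (A - 1)"
      using \<open>G \<ge> 0\<close> by (subst (asm) pos_le_divide_eq) auto
    then show "3 * r * (G + 1) \<le> \<kappa> - \<kappa>0" "3 * r * (G + 1) \<le> A - 1" by (auto simp: algebra_simps)
  qed
  have near: "norm (cmgf F0 w - char F0 (Im w)) \<le> 3 * r * (G + 1)" if "0 \<le> Re w" "Re w \<le> 3 * r" for w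
  proof -
    have "norm (cmgf F0 w - char F0 (Im w)) \<le> Re w * G"
      unfolding G_def using that r \<rho> by (intro cmgf_near_char [OF \<rho>(2)]) auto
    also have "\<dots> \<le> 3 * r * (G + 1)" using that \<open>G \<ge> 0\<close> by (intro mult_mono) auto
    finally show ?thesis .
  qed
  show ?thesis
  proof (rule that [of r T \<kappa> q A])
    show "3 * r \<in> param_space \<theta>max" using r \<rho> by (intro param_space_mono [OF \<rho>(2)]) auto
    show "norm (cmgf F0 w) \<le> \<kappa>" if "0 \<le> Re w" "Re w \<le> 3 * r" "T \<le> \<bar>Im w\<bar>" for w
      using near [OF that(1,2)] \<kappa>0(2) [OF that(3)] r(3) norm_triangle_ineq2 [of "cmgf F0 w" "char F0 (Im w)"] by linarith
    show "norm (w - of_real \<theta>) * norm (w + of_real \<theta>) / 4 \<le> norm (cmgf F0 w - cmgf F0 (of_real \<theta>))"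
      if "0 < Re w" "Re w < 3 * r" "\<bar>Im w\<bar> \<le> T" "0 < \<theta>" "\<theta> < 3 * r" for w \<theta>
    proof (rule cmgf_diff_lower_bound [OF \<rho>(2,3)])
      show "norm w < \<rho>" using cmod_le [of w] that r \<rho>(1) by (auto simp: T_def)
    qed (use that r \<rho> in auto)
    show "(LINT x|F0. exp (\<sigma> * x)) \<le> A" if "0 \<le> \<sigma>" "\<sigma> \<le> 3 * r" for \<sigma>
    proof -
      have "norm (cmgf F0 (of_real \<sigma>) - 1) \<le> A - 1"
        using near [of "of_real \<sigma>"] that r(4) char_zero by simp
      also have "cmgf F0 (of_real \<sigma>) - 1 = of_real ((LINT x|F0. exp (\<sigma> * x)) - 1)"
        by (simp add: cmgf_of_real)
      finally show ?thesis unfolding norm_of_real by linarith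
    qed
    show "0 < (LINT x|F0. x * exp (\<theta> * x))" if "0 < \<theta>" "\<theta> \<le> 3 * r" for \<theta>
    proof -
      have "(CLINT x|F0. of_real x * exp (of_real \<theta> * of_real x)) = of_real (LINT x|F0. x * exp (\<theta> * x))"
        unfolding integral_complex_of_real [symmetric] of_real_mult exp_of_real [symmetric] by simp
      then have "norm (complex_of_real ((LINT x|F0. x * exp (\<theta> * x)) - \<theta>)) \<le> \<theta> / 4"
        using \<rho>(3) [of "of_real \<theta>"] that r \<rho>(1) by simp
      then show ?thesis using that unfolding norm_of_real by linarith
    qed
  qed (use r T \<kappa> q A in auto)
qed

end

section \<open>Contour shift for the geometric resolvent\<close>

text \<open>Passes from the Lebesgue integral over the line to gauge integrals over symmetric
  segments, the form in which contour integrals along vertical sides are available.\<close>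

lemma vertical_line_truncation:
  fixes g :: "real \<Rightarrow> complex"
  assumes "integrable lborel g"
  shows "(\<lambda>n. integral {- real n..real n} g) \<longlonglongrightarrow> (CLBINT t. g t)"
proof -
  have "(\<lambda>n. CLBINT t. indicator {- real n..real n} t *\<^sub>R g t) \<longlonglongrightarrow> (CLBINT t. g t)"
  proof (rule integral_dominated_convergence [where w = "\<lambda>t. norm (g t)"])
    show "AE t in lborel. (\<lambda>n. indicator {- real n..real n} t *\<^sub>R g t) \<longlonglongrightarrow> g t"
    proof (rule AE_I2, rule tendsto_eventually)
      fix t :: real
      obtain n0 :: nat where "\<bar>t\<bar> \<le> n0" using real_arch_simple by blast
      then have "indicator {- real n..real n} t *\<^sub>R g t = g t" if "n \<ge> n0" for n
        using that by (auto simp: indicator_def)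
      then show "\<forall>\<^sub>F n in sequentially. indicator {- real n..real n} t *\<^sub>R g t = g t"
        by (auto simp: eventually_sequentially)
    qed
  qed (use assms in \<open>auto simp: indicator_def\<close>)
  moreover have "(CLBINT t. indicator {- real n..real n} t *\<^sub>R g t) = integral {- real n..real n} g" for n
  proof -
    have "set_integrable lborel {- real n..real n} g"
      unfolding set_integrable_def using assms by (intro integrable_mult_indicator) auto
    then show ?thesis
      using set_borel_integral_eq_integral(2) by (simp add: set_lebesgue_integral_def)
  qed
  ultimately show ?thesis by simp
qed

text \<open>Residue theorem on rectangles of growing height; the horizontal sides vanish by the
  decay of B. The factor \<i> of the vertical parametrisation cancels the one in 2 \<pi>
  \<i>.\<close>

lemma vertical_line_shift:
  assumes str: "\<alpha> < a" "a < 0" "0 < b" "b < \<beta>"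
    and holo: "f holomorphic_on {s. \<alpha> < Re s \<and> Re s < \<beta>} - {0}"
    and int: "integrable lborel (\<lambda>t. f (Complex a t))" "integrable lborel (\<lambda>t. f (Complex b t))"
    and bound: "\<And>x t. a \<le> x \<Longrightarrow> x \<le> b \<Longrightarrow> T \<le> \<bar>t\<bar> \<Longrightarrow> norm (f (Complex x t)) \<le> B \<bar>t\<bar>"
    and decay: "(B \<longlongrightarrow> 0) at_top"
  shows "(CLBINT t. f (Complex b t)) - (CLBINT t. f (Complex a t)) = 2 * pi * residue f 0"
proof -
  define S where "S = {s. \<alpha> < Re s \<and> Re s < \<beta>}"
  have S_eq: "S = {s. \<alpha> < Re s} \<inter> {s. Re s < \<beta>}" by (auto simp: S_def)
  have S: "open S" "convex S"
    unfolding S_eq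
    by (auto intro!: open_Int convex_Int open_halfspace_Re_gt open_halfspace_Re_lt convex_halfspace_Re_gt convex_halfspace_Re_lt)
  have cont: "continuous_on (S - {0}) f"
    using holo holomorphic_on_imp_continuous_on by (auto simp: S_def)
  define I where "I = (\<lambda>n. integral {- real n..real n} (\<lambda>t. f (Complex b t)) - integral {- real n..real n} (\<lambda>t. f (Complex a t)))"
  have bd: "norm (\<i> * I n - 2 * pi * \<i> * residue f 0) \<le> 2 * (B n * (b - a))" if n: "n \<ge> 1" "real n \<ge> T" for n :: nat
  proof -
    define P where "P = rectpath (Complex a (- n)) (Complex b n)"
    have box: "0 \<in> box (Complex a (- n)) (Complex b n)" using str n by (simp add: in_box_complex_iff)
    have img: "path_image P \<subseteq> S - {0}"
    proof -
      have "path_image P \<subseteq> cbox (Complex a (- n)) (Complex b n)"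
        unfolding P_def using str by (intro path_image_rectpath_subset_cbox) auto
      moreover have "0 \<notin> path_image P"
        using box path_image_rectpath_inter_box [of "Complex a (- n)" "Complex b n"] str by (auto simp: P_def)
      moreover have "cbox (Complex a (- n)) (Complex b n) \<subseteq> S"
        using str by (auto simp: S_def in_cbox_complex_iff)
      ultimately show ?thesis by auto
    qed
    have "contour_integral P f = 2 * pi * \<i> * (\<Sum>p\<in>{0}. winding_number P p * residue f p)"
    proof (rule Residue_theorem [of S])
      show "\<forall>z. z \<notin> S \<longrightarrow> winding_number P z = 0"
        using S img by (intro allI impI winding_number_zero_outside [of P S]) (auto simp: P_def)
    qed (use S img holo convex_connected in \<open>auto simp: P_def S_def\<close>)
    also have "\<dots> = 2 * pi * \<i> * residue f 0"
      using winding_number_rectpath [OF box] by (simp add: P_def)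
    finally have res: "contour_integral P f = 2 * pi * \<i> * residue f 0" .
    define c1 c2 c3 c4 where "c1 = Complex a (- n)" "c2 = Complex b (- n)" "c3 = Complex b n" "c4 = Complex a n"
    have P_eq: "P = linepath c1 c2 +++ linepath c2 c3 +++ linepath c3 c4 +++ linepath c4 c1"
      by (simp add: P_def rectpath_def Let_def c1_c2_c3_c4_def)
    have "closed_segment c1 c2 \<union> closed_segment c2 c3 \<union> closed_segment c3 c4 \<union> closed_segment c4 c1 = path_image P"
      unfolding P_eq by (auto simp: path_image_join)
    then have sub: "closed_segment c1 c2 \<subseteq> S - {0}" "closed_segment c2 c3 \<subseteq> S - {0}"
        "closed_segment c3 c4 \<subseteq> S - {0}" "closed_segment c4 c1 \<subseteq> S - {0}"
      using img by blast+
    have ci: "f contour_integrable_on linepath c1 c2" "f contour_integrable_on linepath c2 c3"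
        "f contour_integrable_on linepath c3 c4" "f contour_integrable_on linepath c4 c1"
      using sub by (auto intro!: contour_integrable_continuous_linepath continuous_on_subset [OF cont])
    have "contour_integral P f = contour_integral (linepath c1 c2) f + contour_integral (linepath c2 c3) f
        + contour_integral (linepath c3 c4) f + contour_integral (linepath c4 c1) f"
      unfolding P_eq using ci by simp
    moreover have "contour_integral (linepath c2 c3) f = \<i> * integral {- real n..real n} (\<lambda>t. f (Complex b t))"
      using contour_integral_linepath_same_Re [of c2 b c3 "- real n" "real n" f] n by (simp add: c1_c2_c3_c4_def)
    moreover have "contour_integral (linepath c4 c1) f = - (\<i> * integral {- real n..real n} (\<lambda>t. f (Complex a t)))"
      using contour_integral_linepath_same_Re [of c1 a c4 "- real n" "real n" f] n contour_integral_reverse_linepath [of c1 c4 f]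
        continuous_on_subset [OF cont sub(4)]
      by (simp add: c1_c2_c3_c4_def closed_segment_commute)
    ultimately have "\<i> * I n - 2 * pi * \<i> * residue f 0 =
        - (contour_integral (linepath c1 c2) f + contour_integral (linepath c3 c4) f)"
      using res by (simp add: I_def algebra_simps)
    also have "norm \<dots> \<le> B n * norm (c2 - c1) + B n * norm (c4 - c3)"
      unfolding norm_minus_cancel
    proof (intro order_trans [OF norm_triangle_ineq] add_mono contour_integral_bound_linepath ci)
      have "norm (f (Complex a n)) \<le> B \<bar>real n\<bar>" by (rule bound) (use str n in auto)
      then show "0 \<le> B n" "0 \<le> B n" by (auto intro: order_trans [OF norm_ge_zero])
      fix x assume "x \<in> closed_segment c1 c2"
      then have x: "Re x \<in> {a..b}" "Im x = - n"
        using str by (auto simp: c1_c2_c3_c4_def closed_segment_same_Im closed_segment_eq_real_ivl)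
      have "norm (f (Complex (Re x) (Im x))) \<le> B \<bar>Im x\<bar>" by (rule bound) (use x n in auto)
      then show "norm (f x) \<le> B n" unfolding complex.collapse using x by simp
    next
      fix x assume "x \<in> closed_segment c3 c4"
      then have x: "Re x \<in> {a..b}" "Im x = n"
        using str by (auto simp: c1_c2_c3_c4_def closed_segment_same_Im closed_segment_eq_real_ivl)
      have "norm (f (Complex (Re x) (Im x))) \<le> B \<bar>Im x\<bar>" by (rule bound) (use x n in auto)
      then show "norm (f x) \<le> B n" unfolding complex.collapse using x by simp
    qed
    also have "norm (c2 - c1) = b - a" using str by (simp add: c1_c2_c3_c4_def cmod_def)
    also have "norm (c4 - c3) = b - a" using str by (simp add: c1_c2_c3_c4_def cmod_def)
    finally show ?thesis by simp
  qed
  have "(\<lambda>n. \<i> * I n - 2 * pi * \<i> * residue f 0) \<longlonglongrightarrow> 0"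
  proof (rule Lim_null_comparison)
    obtain n0 :: nat where "T \<le> n0" using real_arch_simple by blast
    then show "\<forall>\<^sub>F n in sequentially. norm (\<i> * I n - 2 * pi * \<i> * residue f 0) \<le> 2 * (B (real n) * (b - a))"
      by (intro eventually_sequentiallyI [of "max 1 n0"] bd) auto
    have "(\<lambda>n. B (real n)) \<longlonglongrightarrow> 0"
      using decay filterlim_real_sequentially by (rule filterlim_compose)
    then show "(\<lambda>n. 2 * (B (real n) * (b - a))) \<longlonglongrightarrow> 0"
      by (auto intro!: tendsto_eq_intros)
  qed
  moreover have "(\<lambda>n. \<i> * I n - 2 * pi * \<i> * residue f 0) \<longlonglongrightarrow>
      \<i> * ((CLBINT t. f (Complex b t)) - (CLBINT t. f (Complex a t))) - 2 * pi * \<i> * residue f 0"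
    unfolding I_def by (intro tendsto_intros vertical_line_truncation int)
  ultimately have "\<i> * ((CLBINT t. f (Complex b t)) - (CLBINT t. f (Complex a t))) - 2 * pi * \<i> * residue f 0 = 0"
    using LIMSEQ_unique by blast
  then have "\<i> * ((CLBINT t. f (Complex b t)) - (CLBINT t. f (Complex a t))) = \<i> * (2 * pi * residue f 0)"
    by (simp add: algebra_simps)
  then show ?thesis by simp
qed

text \<open>The lower bound d makes the two line integrals converge, while \<kappa> keeps 1 - M away
  from 0 on the horizontal sides. The Gaussian factor supplies the decay in t.\<close>

lemma geometric_kernel_shift:
  fixes M :: "complex \<Rightarrow> complex"
  assumes str: "\<alpha> < a" "a < 0" "0 < b" "b < \<beta>" and \<epsilon>: "\<epsilon> > 0"
    and holo: "M holomorphic_on {s. \<alpha> < Re s \<and> Re s < \<beta>}"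
    and ne: "\<And>s. \<alpha> < Re s \<Longrightarrow> Re s < \<beta> \<Longrightarrow> s \<noteq> 0 \<Longrightarrow> M s \<noteq> 1"
    and M0: "M 0 = 1" "(M has_field_derivative \<mu>) (at 0)" "\<mu> \<noteq> 0"
    and \<kappa>: "\<kappa> < 1" "\<And>x t. a \<le> x \<Longrightarrow> x \<le> b \<Longrightarrow> T \<le> \<bar>t\<bar> \<Longrightarrow> norm (M (Complex x t)) \<le> \<kappa>"
    and d: "d > 0" "\<And>t. d \<le> norm (1 - M (Complex a t))" "\<And>t. d \<le> norm (1 - M (Complex b t))"
  shows "(CLBINT t. gauss_kernel \<epsilon> y (Complex a t) / (1 - M (Complex a t))) =
    2 * pi / \<mu> + (CLBINT t. gauss_kernel \<epsilon> y (Complex b t) / (1 - M (Complex b t)))"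
    and "integrable lborel (\<lambda>t. gauss_kernel \<epsilon> y (Complex a t) / (1 - M (Complex a t)))"
    and "integrable lborel (\<lambda>t. gauss_kernel \<epsilon> y (Complex b t) / (1 - M (Complex b t)))"
proof -
  define S where "S = {s. \<alpha> < Re s \<and> Re s < \<beta>}"
  have S_eq: "S = {s. \<alpha> < Re s} \<inter> {s. Re s < \<beta>}" by (auto simp: S_def)
  have S: "open S" "connected S" "0 \<in> S"
    unfolding S_eq using str
    by (auto intro!: open_Int convex_connected convex_Int open_halfspace_Re_gt open_halfspace_Re_lt convex_halfspace_Re_gt convex_halfspace_Re_lt)
  define f where "f = (\<lambda>s. gauss_kernel \<epsilon> y s / (1 - M s))"
  have gh: "gauss_kernel \<epsilon> y holomorphic_on A" for A
    unfolding gauss_kernel_def by (intro holomorphic_intros)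
  have fh: "f holomorphic_on S - {0}"
    unfolding f_def using ne holo by (intro holomorphic_intros gh) (auto simp: S_def intro: holomorphic_on_subset)
  have line: "integrable lborel (\<lambda>t. f (Complex x t))"
    if x: "\<alpha> < x" "x < \<beta>" "x \<noteq> 0" and d': "\<And>t. d \<le> norm (1 - M (Complex x t))" for x
  proof (rule Bochner_Integration.integrable_bound)
    show "integrable lborel (\<lambda>t. norm (gauss_kernel \<epsilon> y (Complex x t)) / d)"
      using integrable_gauss_kernel [OF \<epsilon>] by auto
    have "continuous_on UNIV (\<lambda>t. f (Complex x t))"
      using holomorphic_on_imp_continuous_on [OF fh]
      by (rule continuous_on_compose2) (use x in \<open>auto simp: S_def Complex_eq complex_eq_iff intro!: continuous_intros\<close>)
    then show "(\<lambda>t. f (Complex x t)) \<in> borel_measurable lborel"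
      by (simp add: borel_measurable_continuous_onI)
    show "AE t in lborel. norm (f (Complex x t)) \<le> norm (norm (gauss_kernel \<epsilon> y (Complex x t)) / d)"
    proof (rule AE_I2)
      fix t
      have "0 < norm (1 - M (Complex x t))" using d' [of t] d(1) by linarith
      then have "norm (f (Complex x t)) \<le> norm (gauss_kernel \<epsilon> y (Complex x t)) / d"
        unfolding f_def norm_divide using d' [of t] d(1) by (intro divide_left_mono mult_pos_pos) auto
      then show "norm (f (Complex x t)) \<le> norm (norm (gauss_kernel \<epsilon> y (Complex x t)) / d)"
        using d(1) by simp
    qed
  qed
  have int: "integrable lborel (\<lambda>t. f (Complex a t))" "integrable lborel (\<lambda>t. f (Complex b t))"
    using line [of a] line [of b] str d by auto
  define c where "c = max \<bar>a\<bar> \<bar>b\<bar>"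
  define E where "E = exp (\<epsilon>\<^sup>2 * c\<^sup>2 / 2 + c * \<bar>y\<bar>) / (1 - \<kappa>)"
  have "(CLBINT t. f (Complex b t)) - (CLBINT t. f (Complex a t)) = 2 * pi * residue f 0"
  proof (rule vertical_line_shift [OF str fh [unfolded S_def] int])
    fix x t :: real assume x: "a \<le> x" "x \<le> b" "T \<le> \<bar>t\<bar>"
    have xc: "\<bar>x\<bar> \<le> c" using x by (auto simp: c_def)
    have "x\<^sup>2 \<le> c\<^sup>2" using power_mono [OF xc abs_ge_zero, of 2] by simp
    moreover have "- (x * y) \<le> c * \<bar>y\<bar>"
    proof -
      have "- (x * y) \<le> \<bar>x\<bar> * \<bar>y\<bar>" by (metis abs_ge_minus_self abs_mult)
      also have "\<dots> \<le> c * \<bar>y\<bar>" using xc by (intro mult_right_mono) auto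
      finally show ?thesis .
    qed
    ultimately have "norm (gauss_kernel \<epsilon> y (Complex x t)) \<le> exp (\<epsilon>\<^sup>2 * c\<^sup>2 / 2 + c * \<bar>y\<bar>) * exp (- (\<epsilon>\<^sup>2 * t\<^sup>2 / 2))"
      unfolding norm_gauss_kernel
      using mult_left_mono [of "x\<^sup>2" "c\<^sup>2" "\<epsilon>\<^sup>2"] by (intro mult_right_mono) auto
    moreover have "1 - \<kappa> \<le> norm (1 - M (Complex x t))"
      using \<kappa>(2) [OF x] norm_triangle_ineq2 [of 1 "M (Complex x t)"] by simp
    ultimately have "norm (f (Complex x t)) \<le> exp (\<epsilon>\<^sup>2 * c\<^sup>2 / 2 + c * \<bar>y\<bar>) * exp (- (\<epsilon>\<^sup>2 * t\<^sup>2 / 2)) / (1 - \<kappa>)"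
      unfolding f_def norm_divide using \<kappa>(1) by (intro frac_le) auto
    then show "norm (f (Complex x t)) \<le> E * exp (- (\<epsilon>\<^sup>2 * \<bar>t\<bar>\<^sup>2 / 2))" by (simp add: E_def)
  next
    show "((\<lambda>t. E * exp (- (\<epsilon>\<^sup>2 * t\<^sup>2 / 2))) \<longlongrightarrow> 0) at_top"
      using \<epsilon> by real_asymp
  qed
  \<comment> \<open>The denominator 1 - M has derivative -\<mu> at 0 and the kernel equals 1 there,
    independently of y and \<epsilon>.\<close>
  also have "residue f 0 = - 1 / \<mu>"
  proof -
    have "residue f 0 = gauss_kernel \<epsilon> y 0 / (- \<mu>)"
      unfolding f_def
    proof (rule residue_simple_pole_deriv [where s = S])
      show "((\<lambda>s. 1 - M s) has_field_derivative - \<mu>) (at 0)"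
        by (auto intro!: derivative_eq_intros M0(2))
    qed (use S M0 holo gh in \<open>auto simp: S_def gauss_kernel_def intro!: holomorphic_intros\<close>)
    then show ?thesis by (simp add: gauss_kernel_def)
  qed
  finally show "(CLBINT t. gauss_kernel \<epsilon> y (Complex a t) / (1 - M (Complex a t))) =
    2 * pi / \<mu> + (CLBINT t. gauss_kernel \<epsilon> y (Complex b t) / (1 - M (Complex b t)))"
    by (simp add: f_def algebra_simps)
  show "integrable lborel (\<lambda>t. gauss_kernel \<epsilon> y (Complex a t) / (1 - M (Complex a t)))"
    "integrable lborel (\<lambda>t. gauss_kernel \<epsilon> y (Complex b t) / (1 - M (Complex b t)))"
    using int by (simp_all add: f_def)
qed

section \<open>A renewal theorem with an exponentially small error\<close>

text \<open>M is the transform of one step and \<open>\<nu> n\<close> the law of the walk at time n.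
  The geometric series is summed on Re s = -\<theta>/2, where |M| \<le> m < 1; the estimates are
  made on Re s = r, where |M| \<le> A may exceed 1 but 1 - M is bounded below by D. In the
  application r, T, \<kappa>, q, A and D are independent of \<theta>, whereas \<mu> and m are
  not.\<close>

locale renewal_spectrum =
  fixes M :: "complex \<Rightarrow> complex" and \<nu> :: "nat \<Rightarrow> real measure" and \<mu> \<theta> r T \<kappa> q A D m :: real
  assumes r_pos: "0 < r" and T_pos: "0 < T" and \<kappa>: "0 < \<kappa>" "\<kappa> < 1" and q: "0 < q" "q < 1" "\<kappa> \<le> q ^ 3"
    and A: "1 \<le> A" "A * q < 1" and D_pos: "0 < D" and \<theta>_pos: "0 < \<theta>" and \<mu>_pos: "0 < \<mu>" and m: "0 \<le> m" "m < 1"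
    and holo: "M holomorphic_on {s. - \<theta> < Re s \<and> Re s < 2 * r}"
    and ne1: "\<And>s. - \<theta> < Re s \<Longrightarrow> Re s < 2 * r \<Longrightarrow> s \<noteq> 0 \<Longrightarrow> M s \<noteq> 1"
    and M_0: "M 0 = 1" and M_deriv: "(M has_field_derivative of_real \<mu>) (at 0)"
    and norm_M_high: "\<And>s. - \<theta> < Re s \<Longrightarrow> Re s < 2 * r \<Longrightarrow> T \<le> \<bar>Im s\<bar> \<Longrightarrow> norm (M s) \<le> \<kappa>"
    and norm_M_right: "\<And>t. norm (M (Complex r t)) \<le> A"
    and D_right: "\<And>t. D \<le> norm (1 - M (Complex r t))"
    and norm_M_left: "\<And>t. norm (M (Complex (- \<theta> / 2) t)) \<le> m"
    and prob_\<nu>: "\<And>n. prob_space (\<nu> n)" and sets_\<nu> [measurable_cong]: "\<And>n. sets (\<nu> n) = sets borel"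
    and exp_\<nu>: "\<And>n \<sigma>. \<sigma> \<in> {- \<theta> / 2, r} \<Longrightarrow> integrable (\<nu> n) (\<lambda>x. exp (\<sigma> * x))"
    and transform_\<nu>: "\<And>n s. Re s \<in> {- \<theta> / 2, r} \<Longrightarrow> (CLINT x|\<nu> n. exp (s * of_real x)) = M s ^ n"
begin

definition smooth_density :: "real \<Rightarrow> nat \<Rightarrow> real \<Rightarrow> real" where
  "smooth_density \<epsilon> n y = (LINT x|\<nu> n. normal_density 0 \<epsilon> (y - x))"

lemma smooth_density_nonneg: "0 \<le> smooth_density \<epsilon> n y"
  unfolding smooth_density_def by (intro integral_nonneg_AE AE_I2) (simp add: normal_density_nonneg)

lemma M_line_measurable:
  assumes "- \<theta> < \<sigma>" "\<sigma> < 2 * r"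
  shows "(\<lambda>t. M (Complex \<sigma> t)) \<in> borel_measurable borel"
proof -
  have "continuous_on UNIV (\<lambda>t. M (Complex \<sigma> t))"
    using holomorphic_on_imp_continuous_on [OF holo]
    by (rule continuous_on_compose2) (use assms in \<open>auto simp: Complex_eq intro!: continuous_intros\<close>)
  then show ?thesis by (rule borel_measurable_continuous_onI)
qed

lemma M_right_measurable [measurable]: "(\<lambda>t. M (Complex r t)) \<in> borel_measurable borel"
  using M_line_measurable [of r] r_pos \<theta>_pos by simp

lemma M_left_measurable [measurable]: "(\<lambda>t. M (Complex (- \<theta> / 2) t)) \<in> borel_measurable borel"
  using M_line_measurable [of "- \<theta> / 2"] r_pos \<theta>_pos by simp

lemma smooth_density_inversion:
  assumes "\<epsilon> > 0" "\<sigma> \<in> {- \<theta> / 2, r}"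
  shows "complex_of_real (2 * pi * smooth_density \<epsilon> n y) = (CLBINT t. gauss_kernel \<epsilon> y (Complex \<sigma> t) * M (Complex \<sigma> t) ^ n)"
  using gaussian_smoothing_inversion [OF assms(1) prob_\<nu> sets_\<nu> exp_\<nu> [OF assms(2)], of n y] transform_\<nu> assms(2)
  by (simp add: smooth_density_def)

lemma integrable_kernel_times:
  assumes "\<epsilon> > 0" and [measurable]: "h \<in> borel_measurable borel" and B: "\<And>t. norm (h t) \<le> B"
  shows "integrable lborel (\<lambda>t. gauss_kernel \<epsilon> y (Complex \<sigma> t) * h t)"
proof (rule Bochner_Integration.integrable_bound)
  show "integrable lborel (\<lambda>t. norm (gauss_kernel \<epsilon> y (Complex \<sigma> t)) * B)"
    using integrable_gauss_kernel [OF assms(1)] by auto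
  have "0 \<le> B" using B norm_ge_zero order_trans by blast
  then show "AE t in lborel. norm (gauss_kernel \<epsilon> y (Complex \<sigma> t) * h t) \<le> norm (norm (gauss_kernel \<epsilon> y (Complex \<sigma> t)) * B)"
    using B by (auto simp: norm_mult intro!: mult_left_mono)
qed simp

lemma norm_M_right_pow: "norm (M (Complex r t) ^ n) \<le> A ^ n"
  using norm_M_right by (simp add: norm_power power_mono)

lemma norm_M_left_pow: "norm (M (Complex (- \<theta> / 2) t) ^ n) \<le> m ^ n"
  using norm_M_left by (simp add: norm_power power_mono)

lemma norm_one_minus_M_left: "1 - m \<le> norm (1 - M (Complex (- \<theta> / 2) t))"
  using norm_M_left [of t] norm_triangle_ineq2 [of 1 "M (Complex (- \<theta> / 2) t)"] by simp

lemma kernel_resolvent: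
  assumes "\<epsilon> > 0"
  shows "(CLBINT t. gauss_kernel \<epsilon> y (Complex (- \<theta> / 2) t) / (1 - M (Complex (- \<theta> / 2) t))) =
      2 * pi / \<mu> + (CLBINT t. gauss_kernel \<epsilon> y (Complex r t) / (1 - M (Complex r t)))"
    and "integrable lborel (\<lambda>t. gauss_kernel \<epsilon> y (Complex (- \<theta> / 2) t) / (1 - M (Complex (- \<theta> / 2) t)))"
    and "integrable lborel (\<lambda>t. gauss_kernel \<epsilon> y (Complex r t) / (1 - M (Complex r t)))"
proof -
  note * = geometric_kernel_shift [where \<alpha> = "- \<theta>" and a = "- \<theta> / 2" and b = r and \<beta> = "2 * r" and M = M
      and \<mu> = \<mu> and \<kappa> = \<kappa> and T = T and d = "min D (1 - m)" and y = y, OF _ _ _ _ assms holo ne1 M_0 M_deriv]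
  have d: "min D (1 - m) \<le> norm (1 - M (Complex (- \<theta> / 2) t))" "min D (1 - m) \<le> norm (1 - M (Complex r t))" for t
    using D_right [of t] norm_one_minus_M_left [of t] by linarith+
  have h: "norm (M (Complex x t)) \<le> \<kappa>" if "- \<theta> / 2 \<le> x" "x \<le> r" "T \<le> \<bar>t\<bar>" for x t
    using norm_M_high [of "Complex x t"] that \<theta>_pos r_pos by simp
  show "(CLBINT t. gauss_kernel \<epsilon> y (Complex (- \<theta> / 2) t) / (1 - M (Complex (- \<theta> / 2) t))) =
      2 * pi / \<mu> + (CLBINT t. gauss_kernel \<epsilon> y (Complex r t) / (1 - M (Complex r t)))"
    by (rule *) (use d h \<theta>_pos r_pos \<mu>_pos \<kappa> D_pos m in auto)
  show "integrable lborel (\<lambda>t. gauss_kernel \<epsilon> y (Complex (- \<theta> / 2) t) / (1 - M (Complex (- \<theta> / 2) t)))"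
    by (rule *) (use d h \<theta>_pos r_pos \<mu>_pos \<kappa> D_pos m in auto)
  show "integrable lborel (\<lambda>t. gauss_kernel \<epsilon> y (Complex r t) / (1 - M (Complex r t)))"
    by (rule *) (use d h \<theta>_pos r_pos \<mu>_pos \<kappa> D_pos m in auto)
qed

text \<open>With one bandwidth for all n, the inverted transforms form a geometric series on the
  left line; its sum, the resolvent, is then moved to Re s = r.\<close>

lemma sum_smooth_density_le:
  assumes "\<epsilon> > 0"
  shows "2 * pi * (\<Sum>n<N. smooth_density \<epsilon> n y) \<le>
    2 * pi / \<mu> + Re (CLBINT t. gauss_kernel \<epsilon> y (Complex r t) / (1 - M (Complex r t)))"
proof -
  define \<Phi> where "\<Phi> = (\<lambda>t. gauss_kernel \<epsilon> y (Complex (- \<theta> / 2) t))"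
  define M' where "M' = (\<lambda>t. M (Complex (- \<theta> / 2) t))"
  have [measurable]: "\<Phi> \<in> borel_measurable borel" "M' \<in> borel_measurable borel"
    unfolding \<Phi>_def M'_def by measurable
  have \<Phi>: "integrable lborel \<Phi>" unfolding \<Phi>_def by (rule integrable_gauss_kernel [OF assms])
  define S where "S = (\<lambda>K. 2 * pi * (\<Sum>n<K. smooth_density \<epsilon> n y))"
  define l where "l = 2 * pi / \<mu> + (CLBINT t. gauss_kernel \<epsilon> y (Complex r t) / (1 - M (Complex r t)))"
  have l: "l = (CLBINT t. \<Phi> t / (1 - M' t))" "integrable lborel (\<lambda>t. \<Phi> t / (1 - M' t))"
    using kernel_resolvent [OF assms, of y] by (auto simp: \<Phi>_def M'_def l_def)
  have int_pow: "integrable lborel (\<lambda>t. \<Phi> t * M' t ^ n)" for n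
    unfolding \<Phi>_def M'_def by (rule integrable_kernel_times [OF assms _ norm_M_left_pow]) measurable
  have diff: "norm (of_real (S K) - l) \<le> m ^ K * ((LBINT t. norm (\<Phi> t)) / (1 - m))" for K
  proof -
    have "complex_of_real (S K) = (\<Sum>n<K. complex_of_real (2 * pi * smooth_density \<epsilon> n y))"
      by (simp add: S_def sum_distrib_left)
    also have "\<dots> = (\<Sum>n<K. (CLBINT t. \<Phi> t * M' t ^ n))"
      using smooth_density_inversion [OF assms, of "- \<theta> / 2" _ y] by (simp add: \<Phi>_def M'_def)
    also have "\<dots> = (CLBINT t. (\<Sum>n<K. \<Phi> t * M' t ^ n))"
      using int_pow by (subst Bochner_Integration.integral_sum) auto
    finally have "of_real (S K) - l = (CLBINT t. (\<Sum>n<K. \<Phi> t * M' t ^ n) - \<Phi> t / (1 - M' t))"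
      using l int_pow by (simp add: Bochner_Integration.integrable_sum)
    also have "norm \<dots> \<le> (LBINT t. norm (\<Phi> t) * (m ^ K / (1 - m)))"
    proof (intro Bochner_Integration.integral_norm_bound_integral Bochner_Integration.integrable_diff Bochner_Integration.integrable_sum int_pow l(2))
      fix t
      have ne: "1 - m \<le> norm (1 - M' t)" unfolding M'_def by (rule norm_one_minus_M_left)
      then have "M' t \<noteq> 1" using m by auto
      then have "(\<Sum>n<K. M' t ^ n) = (1 - M' t ^ K) / (1 - M' t)"
        by (simp add: sum_gp_strict)
      then have "(\<Sum>n<K. \<Phi> t * M' t ^ n) = \<Phi> t * ((1 - M' t ^ K) / (1 - M' t))"
        by (simp add: sum_distrib_left [symmetric])
      then have "(\<Sum>n<K. \<Phi> t * M' t ^ n) - \<Phi> t / (1 - M' t) = - (\<Phi> t * (M' t ^ K / (1 - M' t)))"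
        by (simp only: diff_divide_distrib right_diff_distrib) simp
      also have "norm \<dots> \<le> norm (\<Phi> t) * (m ^ K / (1 - m))"
        unfolding norm_minus_cancel norm_mult norm_divide
        using ne m norm_M_left_pow [of t K] by (intro mult_left_mono frac_le) (auto simp: M'_def)
      finally show "norm ((\<Sum>n<K. \<Phi> t * M' t ^ n) - \<Phi> t / (1 - M' t)) \<le> norm (\<Phi> t) * (m ^ K / (1 - m))" .
    qed (use \<Phi> in auto)
    finally show ?thesis by (simp add: mult.commute)
  qed
  have "(\<lambda>K. complex_of_real (S K) - l) \<longlonglongrightarrow> 0"
  proof (rule Lim_null_comparison)
    show "\<forall>\<^sub>F K in sequentially. norm (complex_of_real (S K) - l) \<le> m ^ K * ((LBINT t. norm (\<Phi> t)) / (1 - m))"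
      using diff by simp
    show "(\<lambda>K. m ^ K * ((LBINT t. norm (\<Phi> t)) / (1 - m))) \<longlonglongrightarrow> 0"
      using m by (intro tendsto_mult_left_zero LIMSEQ_realpow_zero) auto
  qed
  then have "(\<lambda>K. Re (complex_of_real (S K))) \<longlonglongrightarrow> Re l"
    by (intro tendsto_Re) (simp add: LIM_zero_iff)
  then have lim: "S \<longlonglongrightarrow> Re l" by simp
  \<comment> \<open>The terms are nonnegative, so every partial sum lies below the limit and the
    bound does not depend on N.\<close>
  have "incseq S"
    unfolding S_def by (intro incseq_SucI mult_left_mono) (auto simp: smooth_density_nonneg)
  then have "S N \<le> Re l" using lim by (rule incseq_le)
  then show ?thesis by (simp add: S_def l_def)
qed

end

text \<open>Defined outside the locale to make visible that \<theta>, \<mu> and m do not enter. The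
  factor 2 T is the length of the low-frequency window; inside it stand the kernel differences,
  summed geometrically with ratio A q, and the resolvent. The terms 3 / (1 - q) and 3 / D come from
  high frequencies, 3 being a bound for sqrt(2 \<pi>).\<close>

definition renewal_const :: "real \<Rightarrow> real \<Rightarrow> real \<Rightarrow> real \<Rightarrow> real \<Rightarrow> real" where
  "renewal_const r T q A D =
     exp (r\<^sup>2 / 2) * (2 * T * ((r\<^sup>2 + T\<^sup>2) * exp (r\<^sup>2 / 2) / (1 - A * q) + exp (r\<^sup>2 / 2) / D) + 3 / (1 - q) + 3 / D)"

section \<open>Smoothing with bandwidths that shrink with n\<close>

context renewal_spectrum
begin

definition bandwidth :: "nat \<Rightarrow> real" where "bandwidth n = q ^ (2 * n)"

lemma bandwidth: "0 < bandwidth n" "bandwidth n \<le> 1"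
  using q by (auto simp: bandwidth_def power_le_one)

lemma bandwidth_mono: "n \<le> k \<Longrightarrow> bandwidth k \<le> bandwidth n"
  unfolding bandwidth_def using q by (intro power_decreasing) auto

lemma integrable_window: "integrable lborel (indicat_real {- T..T})"
  by (rule integrable_real_indicator) (auto simp: emeasure_lborel_Icc_eq)

lemma q_le_1: "q ^ n \<le> 1" using q by (simp add: power_le_one)

lemma sqrt_2pi_le: "sqrt (2 * pi) \<le> 3"
  using pi_less_4 by (intro real_le_lsqrt) auto

lemma kappa_pow_bandwidth: "\<kappa> ^ n / bandwidth n \<le> q ^ n"
proof -
  have "\<kappa> ^ n \<le> (q ^ 3) ^ n" using \<kappa> q by (intro power_mono) auto
  also have "\<dots> = q ^ n * bandwidth n"
    by (simp add: bandwidth_def power_mult [symmetric] power_add [symmetric] algebra_simps)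
  finally show ?thesis using bandwidth(1) [of n] by (simp add: pos_divide_le_eq)
qed

lemma norm_kernel_right_le:
  assumes "0 < \<epsilon>" "\<epsilon> \<le> 1"
  shows "norm (gauss_kernel \<epsilon> y (Complex r t)) \<le> exp (r\<^sup>2 / 2) * exp (- r * y) * exp (- (\<epsilon>\<^sup>2 * t\<^sup>2 / 2))"
proof -
  have "\<epsilon>\<^sup>2 * r\<^sup>2 \<le> r\<^sup>2" using assms by (simp add: mult_left_le_one_le power_le_one)
  then show ?thesis unfolding norm_gauss_kernel exp_add [symmetric] by (intro iffD2 [OF exp_le_cancel_iff]) simp
qed

lemma norm_M_right_pow_le:
  "norm (M (Complex r t) ^ n) \<le> A ^ n * indicator {- T..T} t + \<kappa> ^ n * indicator (- {- T..T}) t"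
proof (cases "t \<in> {- T..T}")
  case True
  then show ?thesis using norm_M_right_pow by simp
next
  case False
  then have "norm (M (Complex r t)) \<le> \<kappa>"
    using norm_M_high [of "Complex r t"] r_pos \<theta>_pos by auto
  then show ?thesis using False by (simp add: norm_power power_mono)
qed

text \<open>A bound for a single n, used only on short edge intervals. Low frequencies contribute
  A^n over a window of length 2 T; high ones contribute \<kappa>^n times the Gaussian integral
  sqrt(2 \<pi>) / \<open>bandwidth n\<close>, which \<open>kappa_pow_bandwidth\<close> keeps below 3
  A^n.\<close>

lemma smooth_density_le:
  "smooth_density (bandwidth n) n y \<le> exp (r\<^sup>2 / 2) * exp (- r * y) * ((2 * T + 3) * A ^ n)"
proof -
  let ?E = "exp (r\<^sup>2 / 2) * exp (- r * y)"
  let ?\<epsilon> = "bandwidth n"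
  have "norm (CLBINT t. gauss_kernel ?\<epsilon> y (Complex r t) * M (Complex r t) ^ n) \<le>
      (LBINT t. ?E * (A ^ n * indicator {- T..T} t + \<kappa> ^ n * exp (- (?\<epsilon>\<^sup>2 * t\<^sup>2 / 2))))"
  proof (rule Bochner_Integration.integral_norm_bound_integral)
    show "integrable lborel (\<lambda>t. gauss_kernel ?\<epsilon> y (Complex r t) * M (Complex r t) ^ n)"
      by (rule integrable_kernel_times [OF bandwidth(1) _ norm_M_right_pow]) measurable
    show "integrable lborel (\<lambda>t. ?E * (A ^ n * indicator {- T..T} t + \<kappa> ^ n * exp (- (?\<epsilon>\<^sup>2 * t\<^sup>2 / 2))))"
      using gaussian_integral(1) [OF bandwidth(1)] integrable_window
      by (intro integrable_mult_right Bochner_Integration.integrable_add) auto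
    fix t :: real
    have "norm (gauss_kernel ?\<epsilon> y (Complex r t) * M (Complex r t) ^ n) \<le>
        (?E * exp (- (?\<epsilon>\<^sup>2 * t\<^sup>2 / 2))) * (A ^ n * indicator {- T..T} t + \<kappa> ^ n * indicator (- {- T..T}) t)"
      unfolding norm_mult by (intro mult_mono norm_kernel_right_le bandwidth norm_M_right_pow_le) auto
    also have "\<dots> = ?E * (A ^ n * (indicator {- T..T} t * exp (- (?\<epsilon>\<^sup>2 * t\<^sup>2 / 2))) + \<kappa> ^ n * (indicator (- {- T..T}) t * exp (- (?\<epsilon>\<^sup>2 * t\<^sup>2 / 2))))"
      by (simp add: algebra_simps)
    also have "\<dots> \<le> ?E * (A ^ n * indicator {- T..T} t + \<kappa> ^ n * exp (- (?\<epsilon>\<^sup>2 * t\<^sup>2 / 2)))"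
      using A \<kappa> by (intro mult_left_mono add_mono) (auto simp: indicator_def)
    finally show "norm (gauss_kernel ?\<epsilon> y (Complex r t) * M (Complex r t) ^ n) \<le>
        ?E * (A ^ n * indicator {- T..T} t + \<kappa> ^ n * exp (- (?\<epsilon>\<^sup>2 * t\<^sup>2 / 2)))" .
  qed
  also have "\<dots> = ?E * (A ^ n * (2 * T) + sqrt (2 * pi) * (\<kappa> ^ n / ?\<epsilon>))"
    using gaussian_integral [OF bandwidth(1)] T_pos by (simp add: mult_ac)
  also have "\<dots> \<le> ?E * (A ^ n * (2 * T) + 3 * A ^ n)"
  proof (intro mult_left_mono add_mono mult_mono sqrt_2pi_le)
    have "1 \<le> A ^ n" using A by (intro one_le_power)
    then show "\<kappa> ^ n / bandwidth n \<le> A ^ n" using kappa_pow_bandwidth [of n] q_le_1 [of n] by linarith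
  qed (use A \<kappa> bandwidth(1) [of n] in auto)
  finally have "norm (complex_of_real (2 * pi * smooth_density ?\<epsilon> n y)) \<le> ?E * (A ^ n * (2 * T) + 3 * A ^ n)"
    using smooth_density_inversion [OF bandwidth(1), of r n n y] by simp
  then have "2 * pi * smooth_density ?\<epsilon> n y \<le> ?E * ((2 * T + 3) * A ^ n)"
    unfolding norm_of_real by (simp add: algebra_simps)
  moreover have "1 * smooth_density ?\<epsilon> n y \<le> 2 * pi * smooth_density ?\<epsilon> n y"
    using pi_gt3 by (intro mult_right_mono smooth_density_nonneg) simp
  ultimately show ?thesis by simp
qed

text \<open>Replacing one bandwidth by another costs q^n at low frequency, enough to beat the growth
  A^n of the transform on the line Re s = r.\<close>

lemma kernel_diff_le:
  assumes "n \<le> N" "\<bar>t\<bar> \<le> T"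
  shows "norm (gauss_kernel (bandwidth n) y (Complex r t) - gauss_kernel (bandwidth N) y (Complex r t)) \<le>
    exp (- r * y) * ((r\<^sup>2 + T\<^sup>2) * exp (r\<^sup>2 / 2) * q ^ n)"
proof -
  define s where "s = Complex r t"
  have s2: "norm (s\<^sup>2) \<le> r\<^sup>2 + T\<^sup>2"
    using power_mono [OF assms(2) abs_ge_zero, of 2] by (simp add: norm_power cmod_power2 s_def)
  \<comment> \<open>Both kernels are compared with the unsmoothed exp(-s y); each deviates by half
    of the claimed amount, because the square of the bandwidth is at most q^n.\<close>
  have one: "norm (exp (of_real ((bandwidth k)\<^sup>2 / 2) * s\<^sup>2) - 1) \<le> (r\<^sup>2 + T\<^sup>2) * exp (r\<^sup>2 / 2) * q ^ n / 2" if "n \<le> k" for k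
  proof -
    have sc: "(bandwidth k)\<^sup>2 \<le> q ^ n"
    proof -
      have "(bandwidth k)\<^sup>2 \<le> bandwidth k" using bandwidth [of k] by (simp add: power2_eq_square mult_left_le_one_le)
      also have "\<dots> \<le> bandwidth n" using that by (rule bandwidth_mono)
      also have "\<dots> \<le> q ^ n" unfolding bandwidth_def using q by (intro power_decreasing) auto
      finally show ?thesis .
    qed
    have "norm (exp (of_real ((bandwidth k)\<^sup>2 / 2) * s\<^sup>2) - 1) \<le>
       norm (of_real ((bandwidth k)\<^sup>2 / 2) * s\<^sup>2) * max 1 (exp (Re (of_real ((bandwidth k)\<^sup>2 / 2) * s\<^sup>2)))"
      by (rule norm_exp_minus_one_le)
    also have "\<dots> \<le> (q ^ n / 2 * (r\<^sup>2 + T\<^sup>2)) * exp (r\<^sup>2 / 2)"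
    proof (intro mult_mono)
      show "norm (of_real ((bandwidth k)\<^sup>2 / 2) * s\<^sup>2) \<le> q ^ n / 2 * (r\<^sup>2 + T\<^sup>2)"
        unfolding norm_mult norm_of_real using sc s2 q by (intro mult_mono) auto
      have "(bandwidth k)\<^sup>2 \<le> 1" using sc q_le_1 [of n] by simp
      have "Re (of_real ((bandwidth k)\<^sup>2 / 2) * s\<^sup>2) = (bandwidth k)\<^sup>2 / 2 * (r\<^sup>2 - t\<^sup>2)"
        by (simp add: s_def power2_eq_square)
      also have "\<dots> \<le> (bandwidth k)\<^sup>2 / 2 * r\<^sup>2" by (intro mult_left_mono) auto
      also have "\<dots> \<le> r\<^sup>2 / 2" using \<open>(bandwidth k)\<^sup>2 \<le> 1\<close> by (simp add: mult_left_le_one_le)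
      finally show "max 1 (exp (Re (of_real ((bandwidth k)\<^sup>2 / 2) * s\<^sup>2))) \<le> exp (r\<^sup>2 / 2)" by simp
    qed (use q in auto)
    finally show ?thesis by (simp add: mult_ac)
  qed
  have split: "gauss_kernel \<epsilon> y s = exp (- s * of_real y) * exp (of_real (\<epsilon>\<^sup>2 / 2) * s\<^sup>2)" for \<epsilon>
    by (simp add: gauss_kernel_def flip: exp_add)
  have "gauss_kernel (bandwidth n) y s - gauss_kernel (bandwidth N) y s =
      exp (- s * of_real y) * ((exp (of_real ((bandwidth n)\<^sup>2 / 2) * s\<^sup>2) - 1) - (exp (of_real ((bandwidth N)\<^sup>2 / 2) * s\<^sup>2) - 1))"
    unfolding split by (simp add: algebra_simps)
  also have "norm \<dots> \<le> exp (- r * y) * ((r\<^sup>2 + T\<^sup>2) * exp (r\<^sup>2 / 2) * q ^ n / 2 + (r\<^sup>2 + T\<^sup>2) * exp (r\<^sup>2 / 2) * q ^ n / 2)"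
    unfolding norm_mult
  proof (intro mult_mono)
    show "norm ((exp (of_real ((bandwidth n)\<^sup>2 / 2) * s\<^sup>2) - 1) - (exp (of_real ((bandwidth N)\<^sup>2 / 2) * s\<^sup>2) - 1)) \<le>
        (r\<^sup>2 + T\<^sup>2) * exp (r\<^sup>2 / 2) * q ^ n / 2 + (r\<^sup>2 + T\<^sup>2) * exp (r\<^sup>2 / 2) * q ^ n / 2"
      using norm_triangle_le_diff [OF add_mono [OF one one]] assms(1) by blast
  qed (simp_all add: s_def)
  finally show ?thesis by (simp add: s_def mult_ac)
qed

text \<open>
  Only a single common bandwidth makes the series geometric, so the widths are compared with the
  smallest one, \<open>bandwidth N\<close>, and the constant must not depend on N.
\<close>
lemma sum_smooth_density_bandwidth_le:
  "(\<Sum>n<N. smooth_density (bandwidth n) n y) \<le> 1 / \<mu> + renewal_const r T q A D * exp (- r * y)"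
proof -
  let ?m = "\<lambda>t. M (Complex r t)"
  let ?g = "\<lambda>n t. gauss_kernel (bandwidth n) y (Complex r t)"
  let ?E = "exp (r\<^sup>2 / 2) * exp (- r * y)"
  \<comment> \<open>Resolvent at the common bandwidth, plus the correction of each term back to its
    own bandwidth. The correction is small for |t| \<le> T only; elsewhere the two parts have to be
    estimated together.\<close>
  define F where "F = (\<lambda>t. ?g N t / (1 - ?m t) + (\<Sum>n<N. ?g n t * ?m t ^ n - ?g N t * ?m t ^ n))"
  define c1 where "c1 = (r\<^sup>2 + T\<^sup>2) * exp (r\<^sup>2 / 2) / (1 - A * q) + exp (r\<^sup>2 / 2) / D"
  \<comment> \<open>Majorant of F: a constant on the low-frequency window plus Gaussians weighted by
    \<kappa>^n, whose integrals are at most of order q^n.\<close>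
  define B where "B = (\<lambda>t. exp (- r * y) * c1 * indicator {- T..T} t +
      ?E * ((\<Sum>n<N. \<kappa> ^ n * exp (- ((bandwidth n)\<^sup>2 * t\<^sup>2 / 2))) + \<kappa> ^ N * exp (- ((bandwidth N)\<^sup>2 * t\<^sup>2 / 2)) / D))"
  have c1: "0 \<le> c1" using A D_pos by (auto simp: c1_def)
  have int_pow: "integrable lborel (\<lambda>t. ?g k t * ?m t ^ n)" for k n
    by (rule integrable_kernel_times [OF bandwidth(1) _ norm_M_right_pow]) measurable
  have int_res: "integrable lborel (\<lambda>t. ?g N t / (1 - ?m t))"
    by (rule kernel_resolvent(3) [OF bandwidth(1)])
  note ind = integrable_window
  have gauss: "integrable lborel (\<lambda>t. exp (- ((bandwidth n)\<^sup>2 * t\<^sup>2 / 2)))" for n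
    by (rule gaussian_integral(1) [OF bandwidth(1)])
  have int_B: "integrable lborel B"
    unfolding B_def using gauss ind
    by (intro Bochner_Integration.integrable_add integrable_mult_right Bochner_Integration.integrable_sum integrable_divide) auto
  have int_F: "integrable lborel F"
    unfolding F_def by (intro Bochner_Integration.integrable_add int_res Bochner_Integration.integrable_sum Bochner_Integration.integrable_diff int_pow)
  have F_le: "norm (F t) \<le> B t" for t
  proof (cases "t \<in> {- T..T}")
    case True
    have res: "norm (?g N t / (1 - ?m t)) \<le> exp (- r * y) * (exp (r\<^sup>2 / 2) / D)"
    proof -
      have "norm (?g N t) \<le> ?E * exp (- ((bandwidth N)\<^sup>2 * t\<^sup>2 / 2))" by (intro norm_kernel_right_le bandwidth)
      also have "\<dots> \<le> ?E * 1" by (intro mult_left_mono) auto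
      finally have "norm (?g N t / (1 - ?m t)) \<le> ?E / D"
        unfolding norm_divide using D_right [of t] D_pos by (intro frac_le) auto
      then show ?thesis by (simp add: mult_ac)
    qed
    have "norm (\<Sum>n<N. ?g n t * ?m t ^ n - ?g N t * ?m t ^ n) \<le>
        (\<Sum>n<N. exp (- r * y) * ((r\<^sup>2 + T\<^sup>2) * exp (r\<^sup>2 / 2) * q ^ n) * A ^ n)"
    proof (rule sum_norm_le)
      fix n assume "n \<in> {..<N}"
      then show "norm (?g n t * ?m t ^ n - ?g N t * ?m t ^ n) \<le> exp (- r * y) * ((r\<^sup>2 + T\<^sup>2) * exp (r\<^sup>2 / 2) * q ^ n) * A ^ n"
        unfolding left_diff_distrib [symmetric] norm_mult
        using True by (intro mult_mono kernel_diff_le norm_M_right_pow) (use q in auto)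
    qed
    also have "\<dots> = exp (- r * y) * ((r\<^sup>2 + T\<^sup>2) * exp (r\<^sup>2 / 2)) * (\<Sum>n<N. (A * q) ^ n)"
      by (simp add: sum_distrib_left power_mult_distrib mult_ac)
    also have "\<dots> \<le> exp (- r * y) * ((r\<^sup>2 + T\<^sup>2) * exp (r\<^sup>2 / 2)) * (1 / (1 - A * q))"
      using A q by (intro mult_left_mono) (auto simp: sum_gp_strict divide_right_mono)
    finally have "norm (F t) \<le> exp (- r * y) * (exp (r\<^sup>2 / 2) / D) + exp (- r * y) * ((r\<^sup>2 + T\<^sup>2) * exp (r\<^sup>2 / 2)) * (1 / (1 - A * q))"
      unfolding F_def using res norm_triangle_le add_mono by blast
    also have "\<dots> = exp (- r * y) * c1" by (simp add: c1_def algebra_simps add_divide_distrib)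
    also have "\<dots> \<le> B t"
      using True \<kappa> D_pos unfolding B_def
      by (auto intro!: mult_nonneg_nonneg add_nonneg_nonneg sum_nonneg divide_nonneg_nonneg)
    finally show ?thesis .
  next
    case False
    have m1: "?m t \<noteq> 1" using D_right [of t] D_pos by auto
    have "norm (?m t ^ n) \<le> \<kappa> ^ n" for n using norm_M_right_pow_le [of t n] False by simp
    note high = this
    \<comment> \<open>The geometric sum recombines here: only \<open>M ^ N / (1 - M)\<close> is left of the resolvent, and it is as small as \<open>\<kappa> ^ N\<close>.\<close>
    have "(\<Sum>n<N. ?g N t * ?m t ^ n) = ?g N t * ((1 - ?m t ^ N) / (1 - ?m t))"
      using m1 by (simp add: sum_distrib_left [symmetric] sum_gp_strict)
    then have "F t = (\<Sum>n<N. ?g n t * ?m t ^ n) + ?g N t * ?m t ^ N / (1 - ?m t)"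
      by (simp add: F_def sum_subtractf diff_divide_distrib algebra_simps)
    also have "norm \<dots> \<le> (\<Sum>n<N. (?E * exp (- ((bandwidth n)\<^sup>2 * t\<^sup>2 / 2))) * \<kappa> ^ n) + (?E * exp (- ((bandwidth N)\<^sup>2 * t\<^sup>2 / 2))) * \<kappa> ^ N / D"
    proof (intro norm_triangle_le add_mono sum_norm_le)
      show "norm (?g n t * ?m t ^ n) \<le> (?E * exp (- ((bandwidth n)\<^sup>2 * t\<^sup>2 / 2))) * \<kappa> ^ n" for n
        unfolding norm_mult by (intro mult_mono norm_kernel_right_le bandwidth high) auto
      then show "norm (?g N t * ?m t ^ N / (1 - ?m t)) \<le> (?E * exp (- ((bandwidth N)\<^sup>2 * t\<^sup>2 / 2))) * \<kappa> ^ N / D"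
        unfolding norm_divide using D_right [of t] D_pos \<kappa> by (intro frac_le) auto
    qed
    also have "\<dots> = B t"
      using False by (simp add: B_def sum_distrib_left algebra_simps)
    finally show ?thesis .
  qed
  have int_B_eq: "(LBINT t. B t) = exp (- r * y) * c1 * (2 * T) +
      ?E * ((\<Sum>n<N. \<kappa> ^ n * (sqrt (2 * pi) / bandwidth n)) + \<kappa> ^ N * (sqrt (2 * pi) / bandwidth N) / D)"
  proof -
    have "(LBINT t. B t) = (LBINT t. exp (- r * y) * c1 * indicator {- T..T} t) +
      (LBINT t. ?E * ((\<Sum>n<N. \<kappa> ^ n * exp (- ((bandwidth n)\<^sup>2 * t\<^sup>2 / 2))) + \<kappa> ^ N * exp (- ((bandwidth N)\<^sup>2 * t\<^sup>2 / 2)) / D))"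
      unfolding B_def using gauss ind
      by (intro Bochner_Integration.integral_add)
         (intro Bochner_Integration.integrable_add integrable_mult_right Bochner_Integration.integrable_sum integrable_divide; simp)+
    also have "(LBINT t. exp (- r * y) * c1 * indicator {- T..T} t) = exp (- r * y) * c1 * (2 * T)"
      using T_pos by simp
    also have "(LBINT t. ?E * ((\<Sum>n<N. \<kappa> ^ n * exp (- ((bandwidth n)\<^sup>2 * t\<^sup>2 / 2))) + \<kappa> ^ N * exp (- ((bandwidth N)\<^sup>2 * t\<^sup>2 / 2)) / D)) =
        ?E * ((LBINT t. (\<Sum>n<N. \<kappa> ^ n * exp (- ((bandwidth n)\<^sup>2 * t\<^sup>2 / 2)))) + (LBINT t. \<kappa> ^ N * exp (- ((bandwidth N)\<^sup>2 * t\<^sup>2 / 2)) / D))"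
      using gauss
      by (subst integral_mult_right_zero, subst Bochner_Integration.integral_add)
         (auto intro!: integrable_mult_right Bochner_Integration.integrable_sum integrable_divide)
    also have "(LBINT t. (\<Sum>n<N. \<kappa> ^ n * exp (- ((bandwidth n)\<^sup>2 * t\<^sup>2 / 2)))) = (\<Sum>n<N. \<kappa> ^ n * (sqrt (2 * pi) / bandwidth n))"
      using gauss by (subst Bochner_Integration.integral_sum) (auto simp: gaussian_integral(2) [OF bandwidth(1)])
    also have "(LBINT t. \<kappa> ^ N * exp (- ((bandwidth N)\<^sup>2 * t\<^sup>2 / 2)) / D) = \<kappa> ^ N * (sqrt (2 * pi) / bandwidth N) / D"
      by (simp add: gaussian_integral(2) [OF bandwidth(1)])
    finally show ?thesis .
  qed
  have kap: "\<kappa> ^ n * (sqrt (2 * pi) / bandwidth n) \<le> 3 * q ^ n" for n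
  proof -
    have "\<kappa> ^ n * (sqrt (2 * pi) / bandwidth n) = sqrt (2 * pi) * (\<kappa> ^ n / bandwidth n)" by simp
    also have "\<dots> \<le> 3 * q ^ n"
      using \<kappa> bandwidth(1) [of n] by (intro mult_mono sqrt_2pi_le kappa_pow_bandwidth) auto
    finally show ?thesis .
  qed
  have "2 * pi * (\<Sum>n<N. smooth_density (bandwidth n) n y) \<le> 2 * pi / \<mu> + norm (CLBINT t. F t)"
  proof -
    have "complex_of_real (2 * pi * (\<Sum>n<N. smooth_density (bandwidth n) n y)) - of_real (2 * pi * (\<Sum>n<N. smooth_density (bandwidth N) n y)) =
        (\<Sum>n<N. complex_of_real (2 * pi * smooth_density (bandwidth n) n y) - of_real (2 * pi * smooth_density (bandwidth N) n y))"
      by (simp add: sum_distrib_left sum_subtractf)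
    also have "\<dots> = (\<Sum>n<N. (CLBINT t. ?g n t * ?m t ^ n) - (CLBINT t. ?g N t * ?m t ^ n))"
      using smooth_density_inversion [OF bandwidth(1), of r] by (intro sum.cong) auto
    also have "\<dots> = (CLBINT t. (\<Sum>n<N. ?g n t * ?m t ^ n - ?g N t * ?m t ^ n))"
      using int_pow by (subst Bochner_Integration.integral_sum) auto
    finally have eq: "complex_of_real (2 * pi * (\<Sum>n<N. smooth_density (bandwidth n) n y)) - of_real (2 * pi * (\<Sum>n<N. smooth_density (bandwidth N) n y)) =
        (CLBINT t. (\<Sum>n<N. ?g n t * ?m t ^ n - ?g N t * ?m t ^ n))" .
    have "2 * pi * (\<Sum>n<N. smooth_density (bandwidth n) n y) - 2 * pi * (\<Sum>n<N. smooth_density (bandwidth N) n y) =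
        Re (CLBINT t. (\<Sum>n<N. ?g n t * ?m t ^ n - ?g N t * ?m t ^ n))"
      unfolding eq [symmetric] by (simp only: minus_complex.sel Re_complex_of_real)
    moreover have "(CLBINT t. F t) = (CLBINT t. ?g N t / (1 - ?m t)) + (CLBINT t. (\<Sum>n<N. ?g n t * ?m t ^ n - ?g N t * ?m t ^ n))"
      unfolding F_def using int_res int_pow by (intro Bochner_Integration.integral_add) auto
    moreover note sum_smooth_density_le [OF bandwidth(1) [of N], where N = N and y = y] complex_Re_le_cmod [of "CLBINT t. F t"]
    ultimately show ?thesis by simp
  qed
  also have "norm (CLBINT t. F t) \<le> (LBINT t. B t)"
    by (rule Bochner_Integration.integral_norm_bound_integral [OF int_F int_B]) (rule F_le)
  also have "(LBINT t. B t) \<le> exp (- r * y) * c1 * (2 * T) + ?E * (3 / (1 - q) + 3 / D)"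
    unfolding int_B_eq
  proof (intro add_left_mono mult_left_mono add_mono divide_right_mono)
    have "(\<Sum>n<N. \<kappa> ^ n * (sqrt (2 * pi) / bandwidth n)) \<le> (\<Sum>n<N. 3 * q ^ n)"
      by (intro sum_mono kap)
    also have "\<dots> = 3 * (\<Sum>n<N. q ^ n)" by (simp add: sum_distrib_left)
    also have "\<dots> \<le> 3 * (1 / (1 - q))"
      using q by (intro mult_left_mono) (auto simp: sum_gp_strict divide_right_mono)
    finally show "(\<Sum>n<N. \<kappa> ^ n * (sqrt (2 * pi) / bandwidth n)) \<le> 3 / (1 - q)" by simp
    show "\<kappa> ^ N * (sqrt (2 * pi) / bandwidth N) \<le> 3" using kap [of N] q_le_1 [of N] by linarith
  qed (use D_pos in auto)
  also have "\<dots> \<le> 2 * pi * (renewal_const r T q A D * exp (- r * y))"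
  proof -
    \<comment> \<open>Since exp(r^2 / 2) \<ge> 1, both parts can be put under the same prefactor of
      \<open>renewal_const\<close>.\<close>
    have "exp (- r * y) * c1 * (2 * T) + ?E * (3 / (1 - q) + 3 / D) \<le>
        ?E * (2 * T * c1) + ?E * (3 / (1 - q) + 3 / D)"
      using c1 T_pos by (simp add: mult_le_cancel_left1)
    also have "\<dots> = renewal_const r T q A D * exp (- r * y)"
      by (simp add: renewal_const_def c1_def algebra_simps)
    also have "\<dots> \<le> 2 * pi * (renewal_const r T q A D * exp (- r * y))"
    proof -
      have "0 \<le> renewal_const r T q A D"
        unfolding renewal_const_def using A q D_pos T_pos
        by (intro mult_nonneg_nonneg add_nonneg_nonneg divide_nonneg_nonneg) auto
      then have "1 * (renewal_const r T q A D * exp (- r * y)) \<le> 2 * pi * (renewal_const r T q A D * exp (- r * y))"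
        using pi_gt3 by (intro mult_right_mono mult_nonneg_nonneg) auto
      then show ?thesis by simp
    qed
    finally show ?thesis .
  qed
  finally have "2 * pi * (\<Sum>n<N. smooth_density (bandwidth n) n y) \<le>
      2 * pi * (1 / \<mu> + renewal_const r T q A D * exp (- r * y))"
    by (simp add: algebra_simps)
  then show ?thesis by (rule mult_left_le_imp_le) simp
qed

end

section \<open>From smoothed densities to measures of intervals\<close>

lemma normal_window_bound:
  assumes "\<epsilon> > 0" "a > 0" "z \<le> x" "x \<le> z + L"
  shows "1 - \<epsilon>\<^sup>2 / a\<^sup>2 \<le> (LBINT y. normal_density 0 \<epsilon> (y - x) * indicator {z - a..z + L + a} y)"
proof -
  have eq: "normal_density 0 \<epsilon> (y - x) = normal_density x \<epsilon> y" for y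
    by (simp add: normal_density_def)
  have n1: "has_bochner_integral lborel (normal_density x \<epsilon>) 1"
    using assms(1) by (simp add: has_bochner_integral_iff)
  have n2: "has_bochner_integral lborel (\<lambda>y. normal_density x \<epsilon> y * (y - x)\<^sup>2) (\<epsilon>\<^sup>2)"
    using normal_moment_even [OF assms(1), of x 1] assms(1) by (simp add: fact_2)
  \<comment> \<open>Chebyshev in integrated form: 1 - (y - x)^2 / a^2 is at most the indicator of
    the enlarged window, since it is nonpositive at distance a or more from x.\<close>
  have n3: "has_bochner_integral lborel (\<lambda>y. normal_density x \<epsilon> y - normal_density x \<epsilon> y * (y - x)\<^sup>2 / a\<^sup>2) (1 - \<epsilon>\<^sup>2 / a\<^sup>2)"
    by (intro has_bochner_integral_diff n1 has_bochner_integral_divide n2)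
  then have "1 - \<epsilon>\<^sup>2 / a\<^sup>2 = (LBINT y. normal_density x \<epsilon> y - normal_density x \<epsilon> y * (y - x)\<^sup>2 / a\<^sup>2)"
    by (simp add: has_bochner_integral_iff)
  also have "\<dots> \<le> (LBINT y. normal_density x \<epsilon> y * indicator {z - a..z + L + a} y)"
  proof (rule integral_mono)
    show "integrable lborel (\<lambda>y. normal_density x \<epsilon> y - normal_density x \<epsilon> y * (y - x)\<^sup>2 / a\<^sup>2)"
      using n3 by (simp add: has_bochner_integral_iff)
    show "integrable lborel (\<lambda>y. normal_density x \<epsilon> y * indicator {z - a..z + L + a} y)"
      using assms(1) by (intro integrable_real_mult_indicator) auto
    fix y
    show "normal_density x \<epsilon> y - normal_density x \<epsilon> y * (y - x)\<^sup>2 / a\<^sup>2 \<le> normal_density x \<epsilon> y * indicator {z - a..z + L + a} y"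
    proof (cases "y \<in> {z - a..z + L + a}")
      case False
      then have "a \<le> \<bar>y - x\<bar>" using assms by auto
      then have "a\<^sup>2 \<le> (y - x)\<^sup>2" using assms(2) by (metis abs_ge_zero less_imp_le power2_abs power_mono)
      then have "1 \<le> (y - x)\<^sup>2 / a\<^sup>2" using assms(2) by (simp add: pos_le_divide_eq)
      then have "normal_density x \<epsilon> y * 1 \<le> normal_density x \<epsilon> y * ((y - x)\<^sup>2 / a\<^sup>2)"
        by (intro mult_left_mono) (simp_all add: normal_density_nonneg)
      then show ?thesis using False by simp
    qed (simp add: normal_density_nonneg)
  qed
  finally show ?thesis unfolding eq .
qed

context renewal_spectrum
begin

lemma integrable_pair_normal:
  assumes "\<epsilon> > 0" "J \<in> sets borel"
  shows "integrable (\<nu> n \<Otimes>\<^sub>M lborel) (\<lambda>(x, y). normal_density 0 \<epsilon> (y - x) * indicator J y)"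
proof -
  interpret N: prob_space "\<nu> n" by (rule prob_\<nu>)
  interpret pair_sigma_finite "\<nu> n" lborel ..
  have [measurable]: "J \<in> sets borel" by fact
  have eq: "normal_density 0 \<epsilon> (y - x) = normal_density x \<epsilon> y" for x y
    by (simp add: normal_density_def)
  have int: "integrable lborel (\<lambda>y. normal_density 0 \<epsilon> (y - x) * indicator J y)" for x
    unfolding eq using assms by (intro integrable_real_mult_indicator) auto
  have le: "norm (LBINT y. norm (normal_density 0 \<epsilon> (y - x) * indicator J y)) \<le> 1" for x
  proof -
    have "(LBINT y. norm (normal_density 0 \<epsilon> (y - x) * indicator J y)) \<le> (LBINT y. normal_density x \<epsilon> y)"
      using int [of x] assms(1)
      by (intro integral_mono) (auto simp: eq normal_density_nonneg indicator_def)
    also have "\<dots> = 1" using assms(1) by simp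
    finally show ?thesis by simp
  qed
  have meas: "(\<lambda>(x, y). normal_density 0 \<epsilon> (y - x) * indicator J y) \<in> borel_measurable (\<nu> n \<Otimes>\<^sub>M lborel)"
    unfolding normal_density_def by measurable
  show ?thesis
  proof (rule Fubini_integrable [OF meas])
    have "(\<lambda>x. LBINT y. norm (normal_density 0 \<epsilon> (y - x) * indicator J y)) \<in> borel_measurable (\<nu> n)"
      unfolding normal_density_def by measurable
    then show "integrable (\<nu> n) (\<lambda>x. LBINT y. norm (case (x, y) of (x, y) \<Rightarrow> normal_density 0 \<epsilon> (y - x) * indicator J y))"
      using le by (intro N.integrable_const_bound [where B = 1]) auto
    show "AE x in \<nu> n. integrable lborel (\<lambda>y. case (x, y) of (x, y) \<Rightarrow> normal_density 0 \<epsilon> (y - x) * indicator J y)"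
      using int by simp
  qed
qed

lemma integrable_smooth_density:
  assumes "\<epsilon> > 0" "J \<in> sets borel"
  shows "integrable lborel (\<lambda>y. smooth_density \<epsilon> n y * indicator J y)"
proof -
  interpret N: prob_space "\<nu> n" by (rule prob_\<nu>)
  interpret pair_sigma_finite "\<nu> n" lborel ..
  show ?thesis
    using integrable_snd [OF integrable_pair_normal [OF assms]] by (simp add: smooth_density_def)
qed

text \<open>Removes the smoothing at the price of enlarging the interval by a on each side and
  losing the Chebyshev fraction. Points outside the interval may be ignored because their
  contribution is nonnegative.\<close>

lemma interval_measure_le:
  assumes "\<epsilon> > 0" "a > 0"
  shows "measure (\<nu> n) {z<..z + L} * (1 - \<epsilon>\<^sup>2 / a\<^sup>2) \<le> (LBINT y. smooth_density \<epsilon> n y * indicator {z - a..z + L + a} y)"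
proof -
  interpret N: prob_space "\<nu> n" by (rule prob_\<nu>)
  interpret pair_sigma_finite "\<nu> n" lborel ..
  let ?J = "{z - a..z + L + a}"
  note int = integrable_pair_normal [OF assms(1), of ?J n, simplified]
  have "(LINT x|\<nu> n. indicator {z<..z + L} x * (1 - \<epsilon>\<^sup>2 / a\<^sup>2)) \<le>
      (LINT x|\<nu> n. (LBINT y. normal_density 0 \<epsilon> (y - x) * indicator ?J y))"
  proof (rule integral_mono)
    show "integrable (\<nu> n) (\<lambda>x. indicator {z<..z + L} x * (1 - \<epsilon>\<^sup>2 / a\<^sup>2))"
      by (intro integrable_mult_left integrable_real_indicator) (auto simp: less_top [symmetric])
    show "integrable (\<nu> n) (\<lambda>x. LBINT y. normal_density 0 \<epsilon> (y - x) * indicator ?J y)"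
      using integrable_fst [OF int] by simp
    fix x
    show "indicator {z<..z + L} x * (1 - \<epsilon>\<^sup>2 / a\<^sup>2) \<le> (LBINT y. normal_density 0 \<epsilon> (y - x) * indicator ?J y)"
    proof (cases "x \<in> {z<..z + L}")
      case True
      then show ?thesis using normal_window_bound [OF assms, of z x L] by simp
    next
      case False
      have "0 \<le> (LBINT y. normal_density 0 \<epsilon> (y - x) * indicator ?J y)"
        by (intro integral_nonneg_AE AE_I2) (simp add: normal_density_nonneg)
      then show ?thesis using False by simp
    qed
  qed
  also have "\<dots> = (LBINT y. (LINT x|\<nu> n. normal_density 0 \<epsilon> (y - x) * indicator ?J y))"
    using Fubini_integral [OF int] by simp
  also have "\<dots> = (LBINT y. smooth_density \<epsilon> n y * indicator ?J y)"
    by (simp add: smooth_density_def)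
  finally show ?thesis by (simp add: sets_\<nu> sets_eq_imp_space_eq [OF sets_\<nu>])
qed

text \<open>Chernoff bound with exponent r. It makes the Chebyshev loss exponentially small in z,
  not merely summable in n.\<close>

lemma tail_measure_le: "measure (\<nu> n) {z<..} \<le> exp (- r * z) * A ^ n"
proof -
  interpret N: prob_space "\<nu> n" by (rule prob_\<nu>)
  have i: "integrable (\<nu> n) (\<lambda>x. exp (r * x))" by (rule exp_\<nu>) simp
  have "(LINT x|\<nu> n. indicator {z<..} x) \<le> (LINT x|\<nu> n. exp (- r * z) * exp (r * x))"
  proof (rule integral_mono)
    show "integrable (\<nu> n) (indicat_real {z<..})"
      by (intro integrable_real_indicator) (auto simp: less_top [symmetric])
    show "integrable (\<nu> n) (\<lambda>x. exp (- r * z) * exp (r * x))" by (rule integrable_mult_right [OF i])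
    fix x
    show "indicator {z<..} x \<le> exp (- r * z) * exp (r * x)"
      unfolding exp_add [symmetric] using r_pos by (auto simp: indicator_def)
  qed
  also have "\<dots> = exp (- r * z) * (LINT x|\<nu> n. exp (r * x))" by simp
  also have "(LINT x|\<nu> n. exp (r * x)) \<le> A ^ n"
  proof -
    have "complex_of_real (LINT x|\<nu> n. exp (r * x)) = (CLINT x|\<nu> n. exp (of_real r * of_real x))"
      unfolding integral_complex_of_real [symmetric] exp_of_real [symmetric] by simp
    also have "\<dots> = M (Complex r 0) ^ n"
      using transform_\<nu> [of "of_real r" n] by (simp add: complex_of_real_def)
    finally have "norm (complex_of_real (LINT x|\<nu> n. exp (r * x))) \<le> A ^ n"
      using norm_M_right_pow by simp
    then show ?thesis by simp
  qed
  finally show ?thesis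
    by (simp add: sets_\<nu> sets_eq_imp_space_eq [OF sets_\<nu>])
qed

text \<open>The sign of z is unrestricted, which matters later: a large jump across b may start far
  below 0. The coefficient L / \<mu> is exact; all errors are multiples of exp(-r z) free of
  L.\<close>

theorem renewal_interval_bound:
  assumes "L \<ge> 0"
  shows "(\<Sum>n<N. measure (\<nu> n) {z<..z + L}) \<le> L / \<mu> +
    (1 / (1 - A * q) + renewal_const r T q A D / r + 2 * exp (r\<^sup>2 / 2) * exp r * (2 * T + 3) / (1 - A * q)) * exp (- r * z)"
proof -
  define I where "I = {z<..z + L}"
  \<comment> \<open>Density bound on everything to the right of z - 1, which contains both edges
    because the margin q^n is at most 1.\<close>
  define e where "e = exp (r\<^sup>2 / 2) * exp (- r * (z - 1)) * (2 * T + 3)"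
  have e: "0 \<le> e" using T_pos by (simp add: e_def)
  have geo: "(\<Sum>n<N. (A * q) ^ n) \<le> 1 / (1 - A * q)"
    using A q by (auto simp: sum_gp_strict divide_right_mono)
  have sd_int: "integrable lborel (\<lambda>y. smooth_density (bandwidth n) n y * indicator J y)" if "J \<in> sets borel" for J n
    by (rule integrable_smooth_density [OF bandwidth(1) that])
  have edge: "(LBINT y. smooth_density (bandwidth n) n y * indicator {u..u + q ^ n} y) \<le> e * (A * q) ^ n"
    if u: "z - 1 \<le> u" for n u
  proof -
    have "(LBINT y. smooth_density (bandwidth n) n y * indicator {u..u + q ^ n} y) \<le> (LBINT y. (e * A ^ n) * indicator {u..u + q ^ n} y)"
    proof (rule integral_mono [OF sd_int])
      show "integrable lborel (\<lambda>y. (e * A ^ n) * indicator {u..u + q ^ n} y)"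
        by (intro integrable_mult_right integrable_real_indicator) (auto simp: emeasure_lborel_Icc_eq)
      fix y
      have "smooth_density (bandwidth n) n y \<le> e * A ^ n" if "u \<le> y"
      proof -
        have "exp (- r * y) \<le> exp (- r * (z - 1))" using that u r_pos by simp
        then have "exp (r\<^sup>2 / 2) * exp (- r * y) * ((2 * T + 3) * A ^ n) \<le> exp (r\<^sup>2 / 2) * exp (- r * (z - 1)) * ((2 * T + 3) * A ^ n)"
          using T_pos A by (intro mult_right_mono mult_left_mono) auto
        then show ?thesis using smooth_density_le [of n y] by (simp add: e_def mult_ac)
      qed
      then show "smooth_density (bandwidth n) n y * indicator {u..u + q ^ n} y \<le> e * A ^ n * indicator {u..u + q ^ n} y"
        by (auto simp: indicator_def)
    qed simp
    also have "\<dots> = e * (A * q) ^ n" using q by (simp add: power_mult_distrib)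
    finally show ?thesis .
  qed
  have one: "measure (\<nu> n) I \<le> exp (- r * z) * (A * q) ^ n +
     (LBINT y. smooth_density (bandwidth n) n y * indicator {z..z + L} y) + 2 * (e * (A * q) ^ n)" for n
  proof -
    let ?p = "smooth_density (bandwidth n) n"
    have a: "0 < q ^ n" "q ^ n \<le> 1" using q q_le_1 by auto
    \<comment> \<open>Chebyshev loss for bandwidth q^(2n) and margin q^n.\<close>
    have sq: "(bandwidth n)\<^sup>2 / (q ^ n)\<^sup>2 = q ^ (2 * n)"
      using q by (simp add: bandwidth_def power_mult [symmetric] field_simps flip: power_add)
    have "measure (\<nu> n) I * (1 - q ^ (2 * n)) \<le> (LBINT y. ?p y * indicator {z - q ^ n..z + L + q ^ n} y)"
      using interval_measure_le [OF bandwidth(1) a(1), of n z L n] unfolding sq I_def by simp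
    \<comment> \<open>The enlarged window splits into the interval itself, which carries the main
      term, and two edges of length q^n.\<close>
    also have "\<dots> \<le> (LBINT y. ?p y * indicator {z - q ^ n..(z - q ^ n) + q ^ n} y + ?p y * indicator {z..z + L} y + ?p y * indicator {z + L..(z + L) + q ^ n} y)"
    proof (rule integral_mono)
      fix y
      show "?p y * indicator {z - q ^ n..z + L + q ^ n} y \<le> ?p y * indicator {z - q ^ n..(z - q ^ n) + q ^ n} y + ?p y * indicator {z..z + L} y + ?p y * indicator {z + L..(z + L) + q ^ n} y"
        using smooth_density_nonneg [of "bandwidth n" n y] assms a by (auto simp: indicator_def)
    qed (auto intro!: sd_int Bochner_Integration.integrable_add)
    also have "\<dots> = (LBINT y. ?p y * indicator {z - q ^ n..(z - q ^ n) + q ^ n} y) + (LBINT y. ?p y * indicator {z..z + L} y) + (LBINT y. ?p y * indicator {z + L..(z + L) + q ^ n} y)"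
      using sd_int [of _ n] by (simp add: Bochner_Integration.integrable_add)
    also have "\<dots> \<le> e * (A * q) ^ n + (LBINT y. ?p y * indicator {z..z + L} y) + e * (A * q) ^ n"
      using a assms by (intro add_mono edge) auto
    finally have "measure (\<nu> n) I \<le> q ^ (2 * n) * measure (\<nu> n) I + (LBINT y. ?p y * indicator {z..z + L} y) + 2 * (e * (A * q) ^ n)"
      by (simp add: algebra_simps)
    \<comment> \<open>The lost fraction is moved to the right-hand side and paid for by the tail
      bound, giving another term of ratio A q.\<close>
    moreover have "q ^ (2 * n) * measure (\<nu> n) I \<le> q ^ n * (exp (- r * z) * A ^ n)"
    proof (intro mult_mono)
      interpret N: prob_space "\<nu> n" by (rule prob_\<nu>)
      have "measure (\<nu> n) I \<le> measure (\<nu> n) {z<..}"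
        by (rule N.finite_measure_mono) (auto simp: I_def sets_\<nu>)
      then show "measure (\<nu> n) I \<le> exp (- r * z) * A ^ n" using tail_measure_le [of n z] by simp
      show "q ^ (2 * n) \<le> q ^ n" using q by (intro power_decreasing) auto
    qed (use q in auto)
    ultimately show ?thesis by (simp add: power_mult_distrib mult_ac)
  qed
  have "(\<Sum>n<N. measure (\<nu> n) I) \<le> (\<Sum>n<N. exp (- r * z) * (A * q) ^ n +
     (LBINT y. smooth_density (bandwidth n) n y * indicator {z..z + L} y) + 2 * (e * (A * q) ^ n))"
    by (intro sum_mono one)
  also have "\<dots> = (exp (- r * z) + 2 * e) * (\<Sum>n<N. (A * q) ^ n) + (LBINT y. (\<Sum>n<N. smooth_density (bandwidth n) n y * indicator {z..z + L} y))"
    using sd_int by (subst Bochner_Integration.integral_sum) (auto simp: sum.distrib sum_distrib_left algebra_simps)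
  also have "\<dots> \<le> (exp (- r * z) + 2 * e) * (1 / (1 - A * q)) + (L / \<mu> + renewal_const r T q A D / r * exp (- r * z))"
  proof (intro add_mono mult_left_mono geo)
    let ?K = "renewal_const r T q A D"
    have K: "0 \<le> ?K"
      unfolding renewal_const_def using A q D_pos T_pos
      by (intro mult_nonneg_nonneg add_nonneg_nonneg divide_nonneg_nonneg) auto
    have hb: "has_bochner_integral lborel (\<lambda>y. (1 / \<mu> + ?K * exp (- r * y)) * indicator {z..z + L} y)
        (((z + L) / \<mu> - ?K / r * exp (- r * (z + L))) - (z / \<mu> - ?K / r * exp (- r * z)))"
      using r_pos \<mu>_pos assms
      by (intro has_bochner_integral_FTC_Icc_real [where F = "\<lambda>y. y / \<mu> - ?K / r * exp (- r * y)"])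
         (auto intro!: derivative_eq_intros simp: field_simps)
    have "(LBINT y. (\<Sum>n<N. smooth_density (bandwidth n) n y * indicator {z..z + L} y)) \<le>
       (LBINT y. (1 / \<mu> + ?K * exp (- r * y)) * indicator {z..z + L} y)"
    proof (rule integral_mono)
      show "integrable lborel (\<lambda>y. (\<Sum>n<N. smooth_density (bandwidth n) n y * indicator {z..z + L} y))"
        by (intro Bochner_Integration.integrable_sum sd_int) auto
      show "integrable lborel (\<lambda>y. (1 / \<mu> + ?K * exp (- r * y)) * indicator {z..z + L} y)"
        using hb by (simp add: has_bochner_integral_iff)
      fix y
      show "(\<Sum>n<N. smooth_density (bandwidth n) n y * indicator {z..z + L} y) \<le> (1 / \<mu> + ?K * exp (- r * y)) * indicator {z..z + L} y"
        unfolding sum_distrib_right [symmetric] by (intro mult_right_mono sum_smooth_density_bandwidth_le) auto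
    qed
    also have "\<dots> = ((z + L) / \<mu> - ?K / r * exp (- r * (z + L))) - (z / \<mu> - ?K / r * exp (- r * z))"
      using hb by (simp add: has_bochner_integral_iff)
    also have "\<dots> \<le> L / \<mu> + ?K / r * exp (- r * z)"
      using K r_pos by (simp add: add_divide_distrib)
    finally show "(LBINT y. (\<Sum>n<N. smooth_density (bandwidth n) n y * indicator {z..z + L} y)) \<le> L / \<mu> + ?K / r * exp (- r * z)" .
  qed (use e in auto)
  also have "e = exp (r\<^sup>2 / 2) * exp r * (2 * T + 3) * exp (- r * z)"
    by (simp add: e_def algebra_simps flip: exp_add)
  finally show ?thesis
    unfolding I_def by (simp add: algebra_simps add_divide_distrib)
qed

end

section \<open>Moments of the overshoot by layers\<close>

lemma power_layer_cake:
  fixes w :: real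
  assumes "k \<ge> 1"
  shows "ennreal ((max 0 w) ^ k) = (\<integral>\<^sup>+v. ennreal (real k * v ^ (k - 1)) * indicator {0..<w} v \<partial>lborel)"
proof (cases "w > 0")
  case True
  have "(\<integral>\<^sup>+v. ennreal (real k * v ^ (k - 1)) * indicator {0..<w} v \<partial>lborel) =
      (\<integral>\<^sup>+v. ennreal (real k * v ^ (k - 1)) * indicator {0..w} v \<partial>lborel)"
  proof (rule nn_integral_cong_AE)
    show "AE v in lborel. ennreal (real k * v ^ (k - 1)) * indicator {0..<w} v = ennreal (real k * v ^ (k - 1)) * indicator {0..w} v"
      using AE_lborel_singleton [of w] by eventually_elim (auto simp: indicator_def)
  qed
  also have "\<dots> = ennreal (w ^ k - 0 ^ k)"
    using True by (intro nn_integral_FTC_Icc) (auto intro!: derivative_eq_intros)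
  finally show ?thesis using True assms by (simp add: max_def)
next
  case False
  then show ?thesis using assms by (simp add: max_def)
qed

text \<open>The Gamma integral for (k - 1)! after the substitution x = r v; the weight k raises it
  to k!.\<close>

lemma nn_integral_power_exp:
  assumes "r > 0" "k \<ge> 1"
  shows "(\<integral>\<^sup>+v. ennreal (real k * v ^ (k - 1) * exp (- r * v)) * indicator {0..} v \<partial>lborel) = ennreal (fact k / r ^ k)"
proof -
  obtain j where k: "k = Suc j" using assms(2) by (cases k) auto
  have "ennreal (real (fact j)) = (\<integral>\<^sup>+x. ennreal (x ^ j * exp (- x)) * indicator {0..} x \<partial>lborel)"
    by (rule nn_intergal_power_times_exp_Ici [symmetric])
  also have "\<dots> = \<bar>r\<bar> * (\<integral>\<^sup>+v. ennreal ((0 + r * v) ^ j * exp (- (0 + r * v))) * indicator {0..} (0 + r * v) \<partial>lborel)"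
    using assms(1) by (intro nn_integral_real_affine) auto
  also have "(\<integral>\<^sup>+v. ennreal ((0 + r * v) ^ j * exp (- (0 + r * v))) * indicator {0..} (0 + r * v) \<partial>lborel) =
      (\<integral>\<^sup>+v. ennreal (r ^ j / k) * (ennreal (real k * v ^ j * exp (- r * v)) * indicator {0..} v) \<partial>lborel)"
  proof (rule nn_integral_cong)
    fix v
    show "ennreal ((0 + r * v) ^ j * exp (- (0 + r * v))) * indicator {0..} (0 + r * v) =
        ennreal (r ^ j / k) * (ennreal (real k * v ^ j * exp (- r * v)) * indicator {0..} v)"
    proof (cases "v \<ge> 0")
      case True
      have ind: "indicator {0..} (0 + r * v) = (1::ennreal)" "indicator {0..} v = (1::ennreal)"
        using True assms by auto
      have eq: "(0 + r * v) ^ j * exp (- (0 + r * v)) = r ^ j / k * (real k * v ^ j * exp (- r * v))"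
        using assms by (simp add: power_mult_distrib)
      show ?thesis
        unfolding ind mult_1_right eq using assms by (intro ennreal_mult') auto
    next
      case False
      then show ?thesis using assms by (simp add: zero_le_mult_iff)
    qed
  qed
  also have "ennreal \<bar>r\<bar> * \<dots> = ennreal r * (ennreal (r ^ j / k) * (\<integral>\<^sup>+v. ennreal (real k * v ^ j * exp (- r * v)) * indicator {0..} v \<partial>lborel))"
    using assms by (subst nn_integral_cmult) auto
  also have "\<dots> = ennreal (r ^ k / k) * (\<integral>\<^sup>+v. ennreal (real k * v ^ j * exp (- r * v)) * indicator {0..} v \<partial>lborel)"
    using assms k by (simp add: mult.assoc [symmetric] flip: ennreal_mult')
  finally have eq: "ennreal (real (fact j)) = ennreal (r ^ k / k) * (\<integral>\<^sup>+v. ennreal (real k * v ^ j * exp (- r * v)) * indicator {0..} v \<partial>lborel)" .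
  have "ennreal (fact k / r ^ k) = ennreal (k / r ^ k) * ennreal (real (fact j))"
    using assms k by (simp flip: ennreal_mult')
  also have "\<dots> = ennreal (k / r ^ k * (r ^ k / k)) * (\<integral>\<^sup>+v. ennreal (real k * v ^ j * exp (- r * v)) * indicator {0..} v \<partial>lborel)"
    unfolding eq mult.assoc [symmetric] using assms by (subst ennreal_mult' [symmetric]) auto
  also have "k / r ^ k * (r ^ k / k) = 1" using assms by simp
  finally show ?thesis using k by simp
qed

text \<open>Here x is the size of the jump, held fixed, and s the position before it. The overshoot
  exceeds v exactly when s > b - x + v, so together with s \<le> b each layer is an interval of
  length x - v.\<close>

lemma overshoot_moment_layers:
  fixes b x r \<mu> C :: real and \<nu> :: "nat \<Rightarrow> real measure"
  assumes prob: "\<And>n. prob_space (\<nu> n)" and sets [measurable_cong]: "\<And>n. sets (\<nu> n) = sets borel"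
    and bound: "\<And>N z L. L \<ge> 0 \<Longrightarrow> (\<Sum>n<N. measure (\<nu> n) {z<..z + L}) \<le> L / \<mu> + C * exp (- r * z)"
    and pos: "\<mu> > 0" "r > 0" "C \<ge> 0" and k: "k \<ge> 1"
  shows "(\<Sum>n. \<integral>\<^sup>+s. ennreal (if s \<le> b then (max 0 (s + x - b)) ^ k else 0) \<partial>\<nu> n) \<le>
    ennreal ((max x 0) ^ (k + 1) / ((k + 1) * \<mu>) + C * exp (- r * b) * exp (r * x) * (fact k / r ^ k))"
proof -
  let ?w = "\<lambda>v. ennreal (real k * v ^ (k - 1))"
  have layer: "(\<integral>\<^sup>+s. ennreal (if s \<le> b then (max 0 (s + x - b)) ^ k else 0) \<partial>\<nu> n) =
      (\<integral>\<^sup>+v. ?w v * indicator {0..} v * emeasure (\<nu> n) {b - x + v<..b} \<partial>lborel)" for n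
  proof -
    interpret N: prob_space "\<nu> n" by (rule prob)
    interpret pair_sigma_finite "\<nu> n" lborel ..
    have "(\<integral>\<^sup>+s. ennreal (if s \<le> b then (max 0 (s + x - b)) ^ k else 0) \<partial>\<nu> n) =
        (\<integral>\<^sup>+s. (\<integral>\<^sup>+v. ?w v * indicator {0..} v * (if b - x + v < s \<and> s \<le> b then 1 else 0) \<partial>lborel) \<partial>\<nu> n)"
    proof (rule nn_integral_cong)
      fix s
      show "ennreal (if s \<le> b then (max 0 (s + x - b)) ^ k else 0) =
          (\<integral>\<^sup>+v. ?w v * indicator {0..} v * (if b - x + v < s \<and> s \<le> b then 1 else 0) \<partial>lborel)"
        using power_layer_cake [OF k, of "s + x - b"]
        by (cases "s \<le> b") (auto intro!: nn_integral_cong simp: indicator_def)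
    qed
    also have "\<dots> = (\<integral>\<^sup>+v. (\<integral>\<^sup>+s. ?w v * indicator {0..} v * (if b - x + v < s \<and> s \<le> b then 1 else 0) \<partial>\<nu> n) \<partial>lborel)"
      by (rule Fubini' [symmetric]) measurable
    also have "\<dots> = (\<integral>\<^sup>+v. ?w v * indicator {0..} v * emeasure (\<nu> n) {b - x + v<..b} \<partial>lborel)"
    proof (rule nn_integral_cong)
      fix v
      have "(\<integral>\<^sup>+s. (if b - x + v < s \<and> s \<le> b then 1 else 0) \<partial>\<nu> n) = (\<integral>\<^sup>+s. indicator {b - x + v<..b} s \<partial>\<nu> n)"
        by (intro nn_integral_cong) (auto simp: indicator_def)
      also have "\<dots> = emeasure (\<nu> n) {b - x + v<..b}" by simp
      finally show "(\<integral>\<^sup>+s. ?w v * indicator {0..} v * (if b - x + v < s \<and> s \<le> b then 1 else 0) \<partial>\<nu> n) =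
          ?w v * indicator {0..} v * emeasure (\<nu> n) {b - x + v<..b}"
        by (subst nn_integral_cmult) auto
    qed
    finally show ?thesis .
  qed
  \<comment> \<open>For v \<ge> x the interval is empty; this indicator truncates the main term at
    x.\<close>
  have emb: "(\<Sum>n. emeasure (\<nu> n) {b - x + v<..b}) \<le> ennreal ((x - v) / \<mu> + C * exp (- r * (b - x + v))) * indicator {..<x} v" for v
  proof (cases "v < x")
    case True
    have "(\<Sum>n. emeasure (\<nu> n) {b - x + v<..b}) \<le> ennreal ((x - v) / \<mu> + C * exp (- r * (b - x + v)))"
    proof (rule suminf_le_const [OF summableI])
      fix N
      interpret prob_space "\<nu> n" for n by (rule prob)
      have "(\<Sum>n<N. emeasure (\<nu> n) {b - x + v<..b}) = ennreal (\<Sum>n<N. measure (\<nu> n) {b - x + v<..(b - x + v) + (x - v)})"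
        by (simp add: emeasure_eq_measure)
      also have "\<dots> \<le> ennreal ((x - v) / \<mu> + C * exp (- r * (b - x + v)))"
        using bound [of "x - v" "b - x + v" N] True by (intro ennreal_leI) simp
      finally show "(\<Sum>n<N. emeasure (\<nu> n) {b - x + v<..b}) \<le> ennreal ((x - v) / \<mu> + C * exp (- r * (b - x + v)))" .
    qed
    then show ?thesis using True by simp
  next
    case False
    then show ?thesis by simp
  qed
  have "(\<Sum>n. \<integral>\<^sup>+s. ennreal (if s \<le> b then (max 0 (s + x - b)) ^ k else 0) \<partial>\<nu> n) =
      (\<integral>\<^sup>+v. (\<Sum>n. ?w v * indicator {0..} v * emeasure (\<nu> n) {b - x + v<..b}) \<partial>lborel)"
    unfolding layer
  proof (rule nn_integral_suminf [symmetric])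
    fix n
    interpret N: prob_space "\<nu> n" by (rule prob)
    have "(\<lambda>v. emeasure (\<nu> n) {b - x + v<..b}) = (\<lambda>v. \<integral>\<^sup>+s. (if b - x + v < s \<and> s \<le> b then 1 else 0) \<partial>\<nu> n)"
    proof
      fix v
      have "(\<integral>\<^sup>+s. (if b - x + v < s \<and> s \<le> b then 1 else 0) \<partial>\<nu> n) = (\<integral>\<^sup>+s. indicator {b - x + v<..b} s \<partial>\<nu> n)"
        by (intro nn_integral_cong) (auto simp: indicator_def)
      then show "emeasure (\<nu> n) {b - x + v<..b} = (\<integral>\<^sup>+s. (if b - x + v < s \<and> s \<le> b then 1 else 0) \<partial>\<nu> n)" by simp
    qed
    then have [measurable]: "(\<lambda>v. emeasure (\<nu> n) {b - x + v<..b}) \<in> borel_measurable borel"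
      by simp
    show "(\<lambda>v. ?w v * indicator {0..} v * emeasure (\<nu> n) {b - x + v<..b}) \<in> borel_measurable lborel"
      by measurable
  qed
  \<comment> \<open>The length term keeps the range up to x. In the exponential term the range is
    extended to all v \<ge> 0, which yields the full integral k! / r^k.\<close>
  also have "\<dots> \<le> (\<integral>\<^sup>+v. ?w v * indicator {0..<x} v * ennreal ((x - v) / \<mu>) +
      ennreal (C * exp (- r * b) * exp (r * x)) * (ennreal (real k * v ^ (k - 1) * exp (- r * v)) * indicator {0..} v) \<partial>lborel)"
  proof (rule nn_integral_mono)
    fix v
    have "(\<Sum>n. ?w v * indicator {0..} v * emeasure (\<nu> n) {b - x + v<..b}) \<le>
        ?w v * indicator {0..} v * (ennreal ((x - v) / \<mu> + C * exp (- r * (b - x + v))) * indicator {..<x} v)"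
      unfolding ennreal_suminf_cmult by (intro mult_left_mono emb) simp
    also have "\<dots> \<le> ?w v * indicator {0..<x} v * ennreal ((x - v) / \<mu>) +
        ennreal (C * exp (- r * b) * exp (r * x)) * (ennreal (real k * v ^ (k - 1) * exp (- r * v)) * indicator {0..} v)"
    proof (cases "0 \<le> v \<and> v < x")
      case True
      have "exp (- r * (b - x + v)) = exp (- r * b) * exp (r * x) * exp (- r * v)"
        by (simp add: algebra_simps flip: exp_add)
      then have "real k * v ^ (k - 1) * ((x - v) / \<mu> + C * exp (- r * (b - x + v))) =
          real k * v ^ (k - 1) * ((x - v) / \<mu>) + C * exp (- r * b) * exp (r * x) * (real k * v ^ (k - 1) * exp (- r * v))"
        by (simp add: algebra_simps)
      then show ?thesis
        using True pos by (simp add: ennreal_plus [symmetric] ennreal_mult' [symmetric] del: ennreal_plus)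
    qed (auto simp: indicator_def)
    finally show "(\<Sum>n. ?w v * indicator {0..} v * emeasure (\<nu> n) {b - x + v<..b}) \<le>
        ?w v * indicator {0..<x} v * ennreal ((x - v) / \<mu>) +
        ennreal (C * exp (- r * b) * exp (r * x)) * (ennreal (real k * v ^ (k - 1) * exp (- r * v)) * indicator {0..} v)" .
  qed
  also have "\<dots> = (\<integral>\<^sup>+v. ?w v * indicator {0..<x} v * ennreal ((x - v) / \<mu>) \<partial>lborel) +
      ennreal (C * exp (- r * b) * exp (r * x)) * ennreal (fact k / r ^ k)"
    unfolding nn_integral_power_exp [OF pos(2) k, symmetric]
    by (subst nn_integral_add) (auto simp: nn_integral_cmult)
  also have "(\<integral>\<^sup>+v. ?w v * indicator {0..<x} v * ennreal ((x - v) / \<mu>) \<partial>lborel) \<le> ennreal ((max x 0) ^ (k + 1) / ((k + 1) * \<mu>))"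
  proof (cases "x > 0")
    case True
    have "(\<integral>\<^sup>+v. ?w v * indicator {0..<x} v * ennreal ((x - v) / \<mu>) \<partial>lborel) \<le>
        (\<integral>\<^sup>+v. ennreal (real k * v ^ (k - 1) * ((x - v) / \<mu>)) * indicator {0..x} v \<partial>lborel)"
    proof (rule nn_integral_mono)
      fix v
      have "ennreal (real k * v ^ (k - 1) * ((x - v) / \<mu>)) = ?w v * ennreal ((x - v) / \<mu>)" if "0 \<le> v"
        using that by (intro ennreal_mult') auto
      then show "?w v * indicator {0..<x} v * ennreal ((x - v) / \<mu>) \<le>
          ennreal (real k * v ^ (k - 1) * ((x - v) / \<mu>)) * indicator {0..x} v"
        by (auto simp: indicator_def)
    qed
    \<comment> \<open>Antiderivative of k v^(k-1) (x - v) / \<mu>; between 0 and x it produces the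
      factor 1 / (k + 1) of the theorem.\<close>
    also have "\<dots> = ennreal (x / \<mu> * x ^ k - k / (real (k + 1) * \<mu>) * x ^ (k + 1) - (x / \<mu> * 0 ^ k - k / (real (k + 1) * \<mu>) * 0 ^ (k + 1)))"
    proof (rule nn_integral_FTC_Icc [where F = "\<lambda>v. x / \<mu> * v ^ k - k / (real (k + 1) * \<mu>) * v ^ (k + 1)"])
      fix v :: real
      have vk: "v ^ k = v * v ^ (k - 1)" using k by (cases k) auto
      have c: "k / (real (k + 1) * \<mu>) * (real (k + 1) * y) = k * y / \<mu>" for y :: real
        using pos by (simp add: divide_simps del: of_nat_add of_nat_Suc)
      have "((\<lambda>v. x / \<mu> * v ^ k - k / (real (k + 1) * \<mu>) * v ^ (k + 1)) has_real_derivative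
          x / \<mu> * (real k * v ^ (k - Suc 0)) - k / (real (k + 1) * \<mu>) * (real (k + 1) * v ^ (k + 1 - Suc 0))) (at v)"
        by (intro DERIV_diff DERIV_cmult DERIV_pow)
      moreover have "x / \<mu> * (real k * v ^ (k - Suc 0)) - k / (real (k + 1) * \<mu>) * (real (k + 1) * v ^ (k + 1 - Suc 0)) = real k * v ^ (k - 1) * ((x - v) / \<mu>)"
        unfolding c by (simp add: vk diff_divide_distrib algebra_simps)
      ultimately show "((\<lambda>v. x / \<mu> * v ^ k - k / (real (k + 1) * \<mu>) * v ^ (k + 1)) has_real_derivative real k * v ^ (k - 1) * ((x - v) / \<mu>)) (at v)"
        by (rule DERIV_cong)
    qed (use True pos in auto)
    also have "x / \<mu> * x ^ k - k / (real (k + 1) * \<mu>) * x ^ (k + 1) - (x / \<mu> * 0 ^ k - k / (real (k + 1) * \<mu>) * 0 ^ (k + 1)) = (max x 0) ^ (k + 1) / ((k + 1) * \<mu>)"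
    proof -
      have "x / \<mu> * x ^ k - k / (real (k + 1) * \<mu>) * x ^ (k + 1) = x ^ (k + 1) / \<mu> * (1 - k / real (k + 1))"
        by (simp add: algebra_simps)
      also have "1 - k / real (k + 1) = 1 / real (k + 1)" by (simp add: field_simps)
      finally show ?thesis using True k by (simp add: algebra_simps)
    qed
    finally show ?thesis .
  qed (use pos in simp)
  finally show ?thesis
    using pos by (simp add: ennreal_plus [symmetric] ennreal_mult' [symmetric] add.commute [of 1 "real k"] del: ennreal_plus)
qed

section \<open>Tilted laws and the random walk\<close>

context standard_exponential_family
begin

lemma exp_log_mgf:
  assumes "\<theta> \<in> param_space \<theta>max"
  shows "exp (log_mgf F0 \<theta>) = (LINT x|F0. exp (\<theta> * x))"
  using mgf_ge_1 [OF assms] by (simp add: log_mgf_def)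

lemma sets_tilted [measurable_cong, simp]: "sets (tilted F0 \<theta>) = sets borel"
  by (simp add: tilted_def)

lemma space_tilted [simp]: "space (tilted F0 \<theta>) = UNIV"
  by (simp add: tilted_def)

lemma prob_space_tilted:
  assumes "\<theta> \<in> param_space \<theta>max"
  shows "prob_space (tilted F0 \<theta>)"
proof (rule prob_spaceI)
  have "emeasure (tilted F0 \<theta>) (space (tilted F0 \<theta>)) = (\<integral>\<^sup>+x. ennreal (exp (\<theta> * x - log_mgf F0 \<theta>)) \<partial>F0)"
    by (simp add: tilted_def emeasure_density)
  also have "\<dots> = ennreal (LINT x|F0. exp (\<theta> * x - log_mgf F0 \<theta>))"
    using exp_integrable [OF assms] by (intro nn_integral_eq_integral) (auto simp: exp_diff)
  also have "(LINT x|F0. exp (\<theta> * x - log_mgf F0 \<theta>)) = 1"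
    using mgf_ge_1 [OF assms] by (simp add: exp_diff exp_log_mgf [OF assms])
  finally show "emeasure (tilted F0 \<theta>) (space (tilted F0 \<theta>)) = 1" by simp
qed

lemma integrable_tilted:
  fixes f :: "real \<Rightarrow> 'b::{banach, second_countable_topology}"
  assumes [measurable]: "f \<in> borel_measurable borel"
  shows "integrable (tilted F0 \<theta>) f \<longleftrightarrow> integrable F0 (\<lambda>x. exp (\<theta> * x - log_mgf F0 \<theta>) *\<^sub>R f x)"
  unfolding tilted_def by (rule integrable_density) auto

lemma integral_tilted:
  fixes f :: "real \<Rightarrow> 'b::{banach, second_countable_topology}"
  assumes [measurable]: "f \<in> borel_measurable borel"
  shows "integral\<^sup>L (tilted F0 \<theta>) f = integral\<^sup>L F0 (\<lambda>x. exp (\<theta> * x - log_mgf F0 \<theta>) *\<^sub>R f x)"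
  unfolding tilted_def by (rule integral_density) auto

lemma integrable_tilted_exp:
  assumes "\<theta> + Re s \<in> param_space \<theta>max"
  shows "integrable (tilted F0 \<theta>) (\<lambda>x. exp (s * complex_of_real x))"
proof -
  have "exp (\<theta> * x - log_mgf F0 \<theta>) *\<^sub>R exp (s * complex_of_real x) =
      exp (- log_mgf F0 \<theta>) *\<^sub>R exp ((of_real \<theta> + s) * complex_of_real x)" for x
    unfolding scaleR_conv_of_real exp_of_real [symmetric] exp_add [symmetric] by (simp add: algebra_simps)
  then show ?thesis
    using integrable_exp_of_real [of "of_real \<theta> + s"] assms by (simp add: integrable_tilted)
qed

text \<open>Tilting by \<theta> translates the argument by \<theta>; the normalisation
  exp(-\<psi>(\<theta>)) becomes the denominator.\<close>

lemma transform_tilted: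
  assumes "\<theta> \<in> param_space \<theta>max"
  shows "(CLINT x|tilted F0 \<theta>. exp (s * of_real x)) = cmgf F0 (of_real \<theta> + s) / cmgf F0 (of_real \<theta>)"
proof -
  have "exp (\<theta> * x - log_mgf F0 \<theta>) *\<^sub>R exp (s * complex_of_real x) =
      exp (- log_mgf F0 \<theta>) *\<^sub>R exp ((of_real \<theta> + s) * complex_of_real x)" for x
    unfolding scaleR_conv_of_real exp_of_real [symmetric] exp_add [symmetric] by (simp add: algebra_simps)
  then have "(CLINT x|tilted F0 \<theta>. exp (s * of_real x)) = exp (- log_mgf F0 \<theta>) *\<^sub>R cmgf F0 (of_real \<theta> + s)"
    by (simp add: integral_tilted cmgf_def)
  then show ?thesis
    by (simp add: cmgf_of_real exp_minus exp_log_mgf [OF assms] scaleR_conv_of_real field_simps)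
qed

lemma integrable_tilted_real_exp:
  assumes "\<theta> + \<sigma> \<in> param_space \<theta>max"
  shows "integrable (tilted F0 \<theta>) (\<lambda>x. exp (\<sigma> * x))"
proof -
  have "integrable (tilted F0 \<theta>) (\<lambda>x. norm (exp (of_real \<sigma> * complex_of_real x)))"
    by (intro integrable_norm integrable_tilted_exp) (use assms in simp)
  then show ?thesis by simp
qed

lemma mean_tilted:
  assumes "\<theta> \<in> param_space \<theta>max"
  shows "(LINT x|tilted F0 \<theta>. x) = (LINT x|F0. x * exp (\<theta> * x)) / (LINT x|F0. exp (\<theta> * x))"
proof -
  have "(LINT x|tilted F0 \<theta>. x) = (LINT x|F0. (x * exp (\<theta> * x)) / exp (log_mgf F0 \<theta>))"
    by (subst integral_tilted) (auto simp: exp_diff mult.commute)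
  then show ?thesis by (simp add: exp_log_mgf [OF assms])
qed

text \<open>For x \<ge> 0 a single term of the exponential series of \<sigma> x dominates the
  power.\<close>

lemma integrable_tilted_positive_part:
  assumes "\<theta> + \<sigma> \<in> param_space \<theta>max" "\<sigma> > 0" "n > 0"
  shows "integrable (tilted F0 \<theta>) (\<lambda>x. (max x 0) ^ n)"
proof (rule Bochner_Integration.integrable_bound)
  show "integrable (tilted F0 \<theta>) (\<lambda>x. fact n / \<sigma> ^ n * exp (\<sigma> * x))"
    by (intro integrable_mult_right integrable_tilted_real_exp assms)
  show "AE x in tilted F0 \<theta>. norm ((max x 0) ^ n) \<le> norm (fact n / \<sigma> ^ n * exp (\<sigma> * x))"
  proof (rule AE_I2)
    fix x :: real
    have "(max x 0) ^ n \<le> fact n / \<sigma> ^ n * exp (\<sigma> * x)"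
    proof (cases "x \<ge> 0")
      case True
      have "(\<sigma> * x) ^ n /\<^sub>R fact n \<le> (\<Sum>j. (\<sigma> * x) ^ j /\<^sub>R fact j)"
        using sum_le_suminf [OF summable_exp_generic [of "\<sigma> * x"], of "{n}"] True assms(2) by simp
      also have "\<dots> = exp (\<sigma> * x)" by (simp add: exp_def)
      finally show ?thesis using True assms(2) by (simp add: power_mult_distrib field_simps)
    next
      case False
      then have "max x 0 = 0" by simp
      then show ?thesis using assms(2,3) by (simp add: zero_power)
    qed
    then show "norm ((max x 0) ^ n) \<le> norm (fact n / \<sigma> ^ n * exp (\<sigma> * x))"
      using assms(2) by simp
  qed
qed simp

end

section \<open>The random walk on sequence space\<close>

lemma walk_measurable [measurable]:
  assumes "\<And>i. sets (P i) = sets borel"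
  shows "(\<lambda>\<omega>. walk \<omega> n) \<in> borel_measurable (Pi\<^sub>M UNIV P)"
  unfolding walk_def
  by (intro borel_measurable_sum) (metis UNIV_I assms measurable_cong_sets measurable_component_singleton)

text \<open>Independence amounts to the joint law being the product of the marginals, and under a
  product measure the joint law of the coordinates is that measure itself.\<close>

lemma indep_vars_PiM_coordinates:
  assumes P: "\<And>i. i \<in> I \<Longrightarrow> prob_space (P i)" "\<And>i. sets (P i) = sets borel" and I: "I \<noteq> {}"
  shows "prob_space.indep_vars (Pi\<^sub>M I P) (\<lambda>_. borel) (\<lambda>i \<omega>. \<omega> i) I"
proof -
  interpret prob_space "Pi\<^sub>M I P" by (rule prob_space_PiM) (fact P)
  have rv: "(\<lambda>\<omega>. \<omega> i) \<in> borel_measurable (Pi\<^sub>M I P)" if "i \<in> I" for i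
    using measurable_component_singleton [OF that, of P] P(2) measurable_cong_sets by blast
  have sets: "sets (Pi\<^sub>M I (\<lambda>_. borel)) = sets (Pi\<^sub>M I P)"
    using P(2) by (intro sets_PiM_cong) auto
  have "distr (Pi\<^sub>M I P) (Pi\<^sub>M I (\<lambda>_. borel)) (\<lambda>x. \<lambda>i\<in>I. x i) = distr (Pi\<^sub>M I P) (Pi\<^sub>M I P) (\<lambda>x. x)"
    using sets by (intro distr_cong) (auto simp: space_PiM PiE_def extensional_def restrict_def fun_eq_iff)
  also have "\<dots> = Pi\<^sub>M I P" by (simp add: distr_id2)
  also have "\<dots> = Pi\<^sub>M I (\<lambda>i. distr (Pi\<^sub>M I P) borel (\<lambda>\<omega>. \<omega> i))"
  proof (intro PiM_cong refl)
    fix i assume "i \<in> I"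
    then have "P i = distr (Pi\<^sub>M I P) (P i) (\<lambda>\<omega>. \<omega> i)"
      using distr_PiM_component [of I P i] P(1) by simp
    also have "\<dots> = distr (Pi\<^sub>M I P) borel (\<lambda>\<omega>. \<omega> i)" using P(2) by (intro distr_cong) auto
    finally show "P i = distr (Pi\<^sub>M I P) borel (\<lambda>\<omega>. \<omega> i)" .
  qed
  finally show ?thesis
    using indep_vars_iff_distr_eq_PiM' [OF I, where M' = "\<lambda>_. borel" and X = "\<lambda>i \<omega>. \<omega> i"] rv by simp
qed

context
  fixes F :: "real measure"
  assumes prob_F: "prob_space F" and sets_F [measurable_cong, simp]: "sets F = sets borel"
begin

abbreviation "seq_law \<equiv> Pi\<^sub>M (UNIV :: nat set) (\<lambda>_. F)"

interpretation S: prob_space seq_law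
  by (rule prob_space_PiM) (rule prob_F)

lemma coordinate_measurable [measurable]: "(\<lambda>\<omega>. \<omega> i) \<in> borel_measurable seq_law"
  using measurable_component_singleton [of i UNIV "\<lambda>_. F"] measurable_cong_sets [OF refl sets_F] by blast

lemma walk_seq_measurable [measurable]: "(\<lambda>\<omega>. walk \<omega> n) \<in> borel_measurable seq_law"
  by (rule walk_measurable) simp

lemma distr_coordinate: "distr seq_law borel (\<lambda>\<omega>. \<omega> i) = F"
proof -
  have "distr seq_law borel (\<lambda>\<omega>. \<omega> i) = distr seq_law F (\<lambda>\<omega>. \<omega> i)" by (intro distr_cong) auto
  also have "\<dots> = F" using distr_PiM_component [of UNIV "\<lambda>_. F" i] prob_F by simp
  finally show ?thesis .
qed

lemma integral_coordinate:
  fixes f :: "real \<Rightarrow> 'b::{banach, second_countable_topology}"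
  assumes "f \<in> borel_measurable borel"
  shows "integral\<^sup>L seq_law (\<lambda>\<omega>. f (\<omega> i)) = integral\<^sup>L F f"
  by (subst distr_coordinate [symmetric, of i], subst integral_distr) (use assms in auto)

text \<open>Since coordinates are numbered from 0, \<open>walk \<omega> n\<close> uses the
  coordinates below n, and \<omega> n is the next jump, independent of it.\<close>

lemma walk_step_distr:
  "distr seq_law (borel \<Otimes>\<^sub>M borel) (\<lambda>\<omega>. (\<omega> n, walk \<omega> n)) = F \<Otimes>\<^sub>M distr seq_law borel (\<lambda>\<omega>. walk \<omega> n)"
proof -
  have "S.indep_vars (\<lambda>_. borel) (\<lambda>i \<omega>. \<omega> i) (insert n {..<n})"
    by (rule S.indep_vars_subset [OF indep_vars_PiM_coordinates]) (auto simp: prob_F)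
  then have "S.indep_var borel (\<lambda>\<omega>. \<omega> n) borel (\<lambda>\<omega>. walk \<omega> n)"
    unfolding walk_def by (intro S.indep_vars_sum) auto
  then show ?thesis
    by (simp add: S.indep_var_distribution_eq distr_coordinate)
qed

lemma walk_transform:
  assumes "integrable F (\<lambda>x. exp (s * complex_of_real x))"
  shows "integrable seq_law (\<lambda>\<omega>. exp (s * complex_of_real (walk \<omega> n)))"
    and "(CLINT \<omega>|seq_law. exp (s * of_real (walk \<omega> n))) = (CLINT x|F. exp (s * of_real x)) ^ n"
proof -
  have eq: "exp (s * complex_of_real (walk \<omega> n)) = (\<Prod>i<n. exp (s * of_real (\<omega> i)))" for \<omega>
    by (simp add: walk_def sum_distrib_left exp_sum)
  have ind: "S.indep_vars (\<lambda>_. borel) (\<lambda>i \<omega>. exp (s * complex_of_real (\<omega> i))) {..<n}"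
  proof (rule S.indep_vars_compose2 [where M' = "\<lambda>_. borel" and X = "\<lambda>i \<omega>. \<omega> i" and Y = "\<lambda>i x. exp (s * complex_of_real x)"])
    show "S.indep_vars (\<lambda>_. borel) (\<lambda>i \<omega>. \<omega> i) {..<n}"
      by (rule S.indep_vars_subset [OF indep_vars_PiM_coordinates]) (auto simp: prob_F)
  qed auto
  have int: "integrable seq_law (\<lambda>\<omega>. exp (s * complex_of_real (\<omega> i)))" for i
    using assms by (subst (asm) distr_coordinate [symmetric, of i]) (simp add: integrable_distr_eq)
  show "integrable seq_law (\<lambda>\<omega>. exp (s * complex_of_real (walk \<omega> n)))"
    unfolding eq by (rule S.indep_vars_integrable [OF _ ind int]) simp
  show "(CLINT \<omega>|seq_law. exp (s * of_real (walk \<omega> n))) = (CLINT x|F. exp (s * of_real x)) ^ n"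
    unfolding eq
    by (subst S.indep_vars_lebesgue_integral [OF _ ind int])
       (simp_all add: integral_coordinate [where f = "\<lambda>x. exp (s * complex_of_real x)"])
qed

text \<open>The summand at the index just before the passage time equals the left side; the others
  are nonnegative.\<close>

lemma overshoot_power_le:
  assumes "b \<ge> 0" "\<exists>n\<ge>1. walk \<omega> n > b"
  shows "overshoot b \<omega> ^ k \<le> (\<Sum>n. ennreal (if walk \<omega> n \<le> b then (max 0 (walk \<omega> n + \<omega> n - b)) ^ k else 0))"
proof -
  define n where "n = (LEAST n. 1 \<le> n \<and> walk \<omega> n > b)"
  have n: "1 \<le> n" "walk \<omega> n > b" using LeastI_ex [OF assms(2)] unfolding n_def by blast+
  have least: "\<not> (1 \<le> j \<and> walk \<omega> j > b)" if "j < n" for j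
    using not_less_Least [of j] that unfolding n_def by blast
  have "passage_time b \<omega> = enat n"
    unfolding passage_time_def
  proof (rule antisym)
    show "Inf {enat n |n. 1 \<le> n \<and> b < walk \<omega> n} \<le> enat n" by (rule Inf_lower) (use n in auto)
    show "enat n \<le> Inf {enat n |n. 1 \<le> n \<and> b < walk \<omega> n}"
      by (rule Inf_greatest) (use least in \<open>force simp: not_less\<close>)
  qed
  then have os: "overshoot b \<omega> = ennreal (walk \<omega> n - b)" by (simp add: overshoot_def)
  obtain j where j: "n = Suc j" using n(1) by (cases n) auto
  \<comment> \<open>Minimality of n says nothing about time 0, which the passage time excludes;
    there the walk is 0, and b \<ge> 0 is used.\<close>
  have "walk \<omega> j \<le> b"
    using least [of j] j assms(1) by (cases "j = 0") (auto simp: walk_def)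
  moreover have "walk \<omega> j + \<omega> j = walk \<omega> n" by (simp add: j walk_def)
  moreover have "max 0 (walk \<omega> n - b) = walk \<omega> n - b" using n(2) by simp
  ultimately have "overshoot b \<omega> ^ k = ennreal (if walk \<omega> j \<le> b then (max 0 (walk \<omega> j + \<omega> j - b)) ^ k else 0)"
    using n(2) by (simp only: os if_True) (simp add: ennreal_power)
  also have "\<dots> \<le> (\<Sum>n. ennreal (if walk \<omega> n \<le> b then (max 0 (walk \<omega> n + \<omega> n - b)) ^ k else 0))"
    using sum_le_suminf [OF summableI, of "{j}" "\<lambda>n. ennreal (if walk \<omega> n \<le> b then (max 0 (walk \<omega> n + \<omega> n - b)) ^ k else 0)"]
    by (simp only: sum.insert sum.empty finite.emptyI empty_iff not_False_eq_True add_0_right finite_insert zero_le simp_thms UNIV_I)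
  finally show ?thesis .
qed

text \<open>Chernoff bound with the negative exponent -\<sigma>: staying below b up to time n has
  probability at most exp(\<sigma> b) m^n. Paths that never exceed b have infinite overshoot, so
  they must be shown to be null.\<close>

lemma AE_walk_exceeds:
  assumes "\<sigma> > 0" "integrable F (\<lambda>x. exp (- \<sigma> * x))" "(LINT x|F. exp (- \<sigma> * x)) < 1"
  shows "AE \<omega> in seq_law. \<exists>n\<ge>1. walk \<omega> n > b"
proof -
  define m where "m = (LINT x|F. exp (- \<sigma> * x))"
  have m: "0 \<le> m" "m < 1" using assms(3) by (auto simp: m_def)
  define E where "E = {\<omega> \<in> space seq_law. \<forall>n\<ge>1. walk \<omega> n \<le> b}"
  have [measurable]: "E \<in> sets seq_law" unfolding E_def by measurable
  have le: "S.prob E \<le> exp (\<sigma> * b) * m ^ n" if "n \<ge> 1" for n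
  proof -
    have ci: "integrable F (\<lambda>x. exp (of_real (- \<sigma>) * complex_of_real x))"
      using integrable_of_real [OF assms(2), where 'a = complex]
      by (simp only: of_real_mult [symmetric] exp_of_real)
    have cm: "(CLINT x|F. exp (of_real (- \<sigma>) * complex_of_real x)) = of_real m"
      unfolding m_def integral_complex_of_real [symmetric] exp_of_real [symmetric] by simp
    have "integrable seq_law (\<lambda>\<omega>. norm (exp (of_real (- \<sigma>) * complex_of_real (walk \<omega> n))))"
      by (rule integrable_norm [OF walk_transform(1) [OF ci]])
    then have int: "integrable seq_law (\<lambda>\<omega>. exp (- \<sigma> * walk \<omega> n))" by simp
    have "complex_of_real (LINT \<omega>|seq_law. exp (- \<sigma> * walk \<omega> n)) = of_real (m ^ n)"
      using walk_transform(2) [OF ci, of n] cm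
      unfolding integral_complex_of_real [symmetric] exp_of_real [symmetric] by simp
    then have eq: "(LINT \<omega>|seq_law. exp (- \<sigma> * walk \<omega> n)) = m ^ n" by (simp only: of_real_eq_iff)
    have "S.prob E = (LINT \<omega>|seq_law. indicator E \<omega>)" by simp
    also have "\<dots> \<le> (LINT \<omega>|seq_law. exp (\<sigma> * b) * exp (- \<sigma> * walk \<omega> n))"
    proof (rule integral_mono)
      fix \<omega> assume "\<omega> \<in> space seq_law"
      show "indicator E \<omega> \<le> exp (\<sigma> * b) * exp (- \<sigma> * walk \<omega> n)"
        using that assms(1) by (auto simp: E_def indicator_def simp flip: exp_add)
    qed (use int in \<open>auto intro!: integrable_real_indicator simp: less_top [symmetric]\<close>)
    also have "\<dots> = exp (\<sigma> * b) * m ^ n" using eq by simp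
    finally show ?thesis .
  qed
  have "(\<lambda>n. exp (\<sigma> * b) * m ^ n) \<longlonglongrightarrow> exp (\<sigma> * b) * 0"
    using m by (intro tendsto_mult_left LIMSEQ_realpow_zero)
  then have "S.prob E \<le> 0"
    by (intro LIMSEQ_le_const [where X = "\<lambda>n. exp (\<sigma> * b) * m ^ n"]) (use le in auto)
  then have "emeasure seq_law E = 0"
    by (simp add: S.emeasure_eq_measure measure_le_0_iff)
  then have "AE \<omega> in seq_law. \<omega> \<notin> E" by (intro AE_not_in null_setsI) auto
  then show ?thesis using AE_space by eventually_elim (auto simp: E_def not_le)
qed

text \<open>Independence of jump and position separates the integrals, and Tonelli moves the sum
  inside the integral over the jump x. For fixed x only the renewal measure of the walk is then
  involved.\<close>

lemma overshoot_moment_le_sum: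
  assumes "b \<ge> 0" "\<sigma> > 0" "integrable F (\<lambda>x. exp (- \<sigma> * x))" "(LINT x|F. exp (- \<sigma> * x)) < 1"
  shows "(\<integral>\<^sup>+\<omega>. overshoot b \<omega> ^ k \<partial>seq_law) \<le>
    (\<integral>\<^sup>+x. (\<Sum>n. \<integral>\<^sup>+s. ennreal (if s \<le> b then (max 0 (s + x - b)) ^ k else 0) \<partial>distr seq_law borel (\<lambda>\<omega>. walk \<omega> n)) \<partial>F)"
proof -
  let ?g = "\<lambda>x s. ennreal (if s \<le> b then (max 0 (s + x - b)) ^ k else 0)"
  have "(\<integral>\<^sup>+\<omega>. overshoot b \<omega> ^ k \<partial>seq_law) \<le> (\<integral>\<^sup>+\<omega>. (\<Sum>n. ?g (\<omega> n) (walk \<omega> n)) \<partial>seq_law)"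
    using AE_walk_exceeds [OF assms(2-4), of b]
    by (intro nn_integral_mono_AE) (auto elim!: eventually_mono intro!: overshoot_power_le assms(1))
  also have "\<dots> = (\<Sum>n. \<integral>\<^sup>+\<omega>. ?g (\<omega> n) (walk \<omega> n) \<partial>seq_law)"
    by (rule nn_integral_suminf) measurable
  also have "\<dots> = (\<Sum>n. \<integral>\<^sup>+x. (\<integral>\<^sup>+s. ?g x s \<partial>distr seq_law borel (\<lambda>\<omega>. walk \<omega> n)) \<partial>F)"
  proof (rule suminf_cong)
    fix n
    interpret D: prob_space "distr seq_law borel (\<lambda>\<omega>. walk \<omega> n)" by (rule S.prob_space_distr) measurable
    have "(\<integral>\<^sup>+\<omega>. ?g (\<omega> n) (walk \<omega> n) \<partial>seq_law) = (\<integral>\<^sup>+p. ?g (fst p) (snd p) \<partial>distr seq_law (borel \<Otimes>\<^sub>M borel) (\<lambda>\<omega>. (\<omega> n, walk \<omega> n)))"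
      by (subst nn_integral_distr) (auto cong: if_cong)
    also have "\<dots> = (\<integral>\<^sup>+x. (\<integral>\<^sup>+s. ?g x s \<partial>distr seq_law borel (\<lambda>\<omega>. walk \<omega> n)) \<partial>F)"
      unfolding walk_step_distr by (subst D.nn_integral_fst [symmetric]) (auto cong: if_cong)
    finally show "(\<integral>\<^sup>+\<omega>. ?g (\<omega> n) (walk \<omega> n) \<partial>seq_law) = (\<integral>\<^sup>+x. (\<integral>\<^sup>+s. ?g x s \<partial>distr seq_law borel (\<lambda>\<omega>. walk \<omega> n)) \<partial>F)" .
  qed
  also have "\<dots> = (\<integral>\<^sup>+x. (\<Sum>n. \<integral>\<^sup>+s. ?g x s \<partial>distr seq_law borel (\<lambda>\<omega>. walk \<omega> n)) \<partial>F)"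
  proof (rule nn_integral_suminf [symmetric])
    fix n
    interpret D: prob_space "distr seq_law borel (\<lambda>\<omega>. walk \<omega> n)" by (rule S.prob_space_distr) measurable
    show "(\<lambda>x. \<integral>\<^sup>+s. ?g x s \<partial>distr seq_law borel (\<lambda>\<omega>. walk \<omega> n)) \<in> borel_measurable F"
      by measurable
  qed
  finally show ?thesis .
qed

end

section \<open>Spectral hypotheses for the tilted walk, and assembly\<close>

context standard_exponential_family
begin

text \<open>Under w = \<theta> + s the strip -\<theta> < Re s < 2 r becomes 0 < Re w < \<theta> + 2
  r, which lies within 3 r because \<theta> \<le> r; so the estimates on \<open>cmgf F0\<close>
  apply with constants free of \<theta>.\<close>

lemma renewal_spectrum_tilted:
  assumes c: "r > 0" "T > 0" "0 < \<kappa>" "\<kappa> < 1" "0 < q" "q < 1" "\<kappa> \<le> q ^ 3" "1 \<le> A" "A * q < 1"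
    and par: "3 * r \<in> param_space \<theta>max"
    and high: "\<And>w. 0 \<le> Re w \<Longrightarrow> Re w \<le> 3 * r \<Longrightarrow> T \<le> \<bar>Im w\<bar> \<Longrightarrow> norm (cmgf F0 w) \<le> \<kappa>"
    and low: "\<And>w \<theta>. 0 < Re w \<Longrightarrow> Re w < 3 * r \<Longrightarrow> \<bar>Im w\<bar> \<le> T \<Longrightarrow> 0 < \<theta> \<Longrightarrow> \<theta> < 3 * r \<Longrightarrow>
       norm (w - of_real \<theta>) * norm (w + of_real \<theta>) / 4 \<le> norm (cmgf F0 w - cmgf F0 (of_real \<theta>))"
    and mgf_le: "\<And>\<sigma>. 0 \<le> \<sigma> \<Longrightarrow> \<sigma> \<le> 3 * r \<Longrightarrow> (LINT x|F0. exp (\<sigma> * x)) \<le> A"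
    and mean_pos: "\<And>\<theta>. 0 < \<theta> \<Longrightarrow> \<theta> \<le> 3 * r \<Longrightarrow> 0 < (LINT x|F0. x * exp (\<theta> * x))"
    and \<theta>: "0 < \<theta>" "\<theta> \<le> r"
  shows "renewal_spectrum (\<lambda>s. cmgf F0 (of_real \<theta> + s) / cmgf F0 (of_real \<theta>))
      (\<lambda>n. distr (iid_law F0 \<theta>) borel (\<lambda>\<omega>. walk \<omega> n)) (LINT x|tilted F0 \<theta>. x) \<theta> r T \<kappa> q A
      (min (r\<^sup>2 / (4 * A)) (1 - \<kappa>)) (LINT x|tilted F0 \<theta>. exp (- (\<theta> / 2) * x))"
    and "(LINT x|tilted F0 \<theta>. exp (- (\<theta> / 2) * x)) < 1"
proof -
  define g where "g = (\<lambda>\<sigma>. LINT x|F0. exp (\<sigma> * x))"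
  have p: "\<sigma> \<in> param_space \<theta>max" if "0 \<le> \<sigma>" "\<sigma> \<le> 3 * r" for \<sigma>
    using param_space_mono [OF par] that by simp
  have g1: "1 \<le> g \<sigma>" "g \<sigma> \<le> A" if "0 \<le> \<sigma>" "\<sigma> \<le> 3 * r" for \<sigma>
    using mgf_ge_1 [OF p] mgf_le that by (auto simp: g_def)
  have g\<theta>: "1 \<le> g \<theta>" "g \<theta> \<le> A" using g1 [of \<theta>] \<theta> by auto
  have cm: "cmgf F0 (of_real \<sigma>) = of_real (g \<sigma>)" for \<sigma> by (simp add: g_def cmgf_of_real)
  have p\<theta>: "\<theta> \<in> param_space \<theta>max" using p \<theta> by simp
  interpret P: prob_space "tilted F0 \<theta>" by (rule prob_space_tilted [OF p\<theta>])
  define M where "M = (\<lambda>s. cmgf F0 (of_real \<theta> + s) / cmgf F0 (of_real \<theta>))"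
  have normM: "norm (M s) = norm (cmgf F0 (of_real \<theta> + s)) / g \<theta>" for s
    using g\<theta> by (simp add: M_def cm norm_divide)
  have M_high: "norm (M s) \<le> \<kappa>" if "- \<theta> < Re s" "Re s < 2 * r" "T \<le> \<bar>Im s\<bar>" for s
  proof -
    have "norm (cmgf F0 (of_real \<theta> + s)) \<le> \<kappa>" using that \<theta> by (intro high) auto
    moreover have "\<kappa> \<le> \<kappa> * g \<theta>" using g\<theta> c by simp
    ultimately show ?thesis using g\<theta> unfolding normM by (simp add: pos_divide_le_eq)
  qed
  \<comment> \<open>The factors are w - \<theta> = s and w + \<theta> = s + 2 \<theta>, divided by
    the normalisation g \<theta>.\<close>
  have M_low: "norm s * norm (2 * of_real \<theta> + s) / (4 * g \<theta>) \<le> norm (1 - M s)"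
    if "- \<theta> < Re s" "Re s < 2 * r" "\<bar>Im s\<bar> \<le> T" for s
  proof -
    have "norm s * norm (2 * of_real \<theta> + s) / 4 \<le> norm (cmgf F0 (of_real \<theta> + s) - cmgf F0 (of_real \<theta>))"
      using low [of "of_real \<theta> + s" \<theta>] that \<theta> by (simp add: algebra_simps)
    moreover have "norm (1 - M s) = norm (cmgf F0 (of_real \<theta> + s) - cmgf F0 (of_real \<theta>)) / g \<theta>"
    proof -
      have "1 - M s = - ((cmgf F0 (of_real \<theta> + s) - cmgf F0 (of_real \<theta>)) / cmgf F0 (of_real \<theta>))"
        using g\<theta> by (simp add: M_def cm diff_divide_distrib)
      then show ?thesis using g\<theta> by (simp only: norm_minus_cancel norm_divide) (simp add: cm)
    qed
    ultimately show ?thesis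
      using g\<theta> by (simp add: pos_divide_le_eq pos_le_divide_eq field_simps)
  qed
  have tr: "(CLINT x|tilted F0 \<theta>. exp (s * of_real x)) = M s" for s
    unfolding M_def by (rule transform_tilted [OF p\<theta>])
  define m where "m = (LINT x|tilted F0 \<theta>. exp (- (\<theta> / 2) * x))"
  have m_eq: "m = g (\<theta> / 2) / g \<theta>"
  proof -
    have "complex_of_real m = (CLINT x|tilted F0 \<theta>. exp (of_real (- (\<theta> / 2)) * of_real x))"
      unfolding m_def integral_complex_of_real [symmetric] exp_of_real [symmetric] by simp
    also have "\<dots> = cmgf F0 (of_real (\<theta> / 2)) / cmgf F0 (of_real \<theta>)"
      unfolding tr M_def by (intro arg_cong2 [where f = "(/)"] arg_cong [where f = "cmgf F0"]) (simp_all add: complex_eq_iff)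
    also have "\<dots> = of_real (g (\<theta> / 2) / g \<theta>)" unfolding cm by simp
    finally show ?thesis by (simp only: of_real_eq_iff)
  qed
  \<comment> \<open>This puts |M| below 1 on the line -\<theta>/2. The weak inequality follows from
    mean zero and u^2 - u \<ge> u - 1 \<ge> \<theta> x / 2 with u = exp(\<theta> x / 2); strictness
    comes from the low-frequency bound at w = \<theta>/2.\<close>
  have "g (\<theta> / 2) < g \<theta>"
  proof -
    have ix: "integrable F0 (\<lambda>x. x)"
      by (rule Bochner_Integration.integrable_bound [where f = "\<lambda>x. 1 + x\<^sup>2"])
         (use square_integrable abs_le_weight in auto)
    have "0 = (LINT x|F0. \<theta> / 2 * x)" using mean_zero by simp
    also have "\<dots> \<le> (LINT x|F0. exp (\<theta> * x) - exp (\<theta> / 2 * x))"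
    proof (rule integral_mono)
      show "integrable F0 (\<lambda>x. exp (\<theta> * x) - exp (\<theta> / 2 * x))"
        using exp_integrable [OF p\<theta>] exp_integrable [OF p, of "\<theta> / 2"] \<theta> by auto
      fix x
      have sq: "exp (\<theta> * x) = (exp (\<theta> / 2 * x))\<^sup>2" by (simp add: power2_eq_square flip: exp_add)
      have "0 \<le> (exp (\<theta> / 2 * x) - 1)\<^sup>2" by simp
      then have "exp (\<theta> / 2 * x) - 1 \<le> exp (\<theta> * x) - exp (\<theta> / 2 * x)"
        unfolding sq by (simp add: power2_eq_square algebra_simps)
      moreover have "1 + \<theta> / 2 * x \<le> exp (\<theta> / 2 * x)" by (rule exp_ge_add_one_self)
      ultimately show "\<theta> / 2 * x \<le> exp (\<theta> * x) - exp (\<theta> / 2 * x)" by linarith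
    qed (use ix in simp)
    also have "\<dots> = g \<theta> - g (\<theta> / 2)"
      unfolding g_def using exp_integrable [OF p\<theta>] exp_integrable [OF p, of "\<theta> / 2"] \<theta>
      by (intro Bochner_Integration.integral_diff) auto
    finally have "g (\<theta> / 2) \<le> g \<theta>" by simp
    moreover have "g (\<theta> / 2) \<noteq> g \<theta>"
    proof
      assume "g (\<theta> / 2) = g \<theta>"
      have "norm (of_real (\<theta> / 2) - complex_of_real \<theta>) * norm (of_real (\<theta> / 2) + complex_of_real \<theta>) / 4 \<le>
          norm (cmgf F0 (of_real (\<theta> / 2)) - cmgf F0 (of_real \<theta>))"
        by (rule low) (use \<theta> c in auto)
      also have "\<dots> = 0" unfolding cm \<open>g (\<theta> / 2) = g \<theta>\<close> by simp
      finally have "norm (of_real (\<theta> / 2) - complex_of_real \<theta>) * norm (of_real (\<theta> / 2) + complex_of_real \<theta>) / 4 \<le> 0" .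
      moreover have "norm (of_real (\<theta> / 2) - complex_of_real \<theta>) = \<theta> / 2" "norm (of_real (\<theta> / 2) + complex_of_real \<theta>) = 3 * \<theta> / 2"
        unfolding of_real_diff [symmetric] of_real_add [symmetric] norm_of_real using \<theta> by auto
      ultimately show False using \<theta> by (simp add: mult_le_0_iff)
    qed
    ultimately show ?thesis by simp
  qed
  then have m1: "m < 1" using g\<theta> by (simp add: m_eq)
  then show "(LINT x|tilted F0 \<theta>. exp (- (\<theta> / 2) * x)) < 1" by (simp add: m_def)
  define \<mu> where "\<mu> = (LINT x|tilted F0 \<theta>. x)"
  have \<mu>: "\<mu> = (LINT x|F0. x * exp (\<theta> * x)) / g \<theta>"
    unfolding \<mu>_def g_def by (rule mean_tilted [OF p\<theta>])
  have iexp: "integrable (tilted F0 \<theta>) (\<lambda>x. exp (s * complex_of_real x))" if "Re s \<in> {- \<theta> / 2, r}" for s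
    using that \<theta> by (intro integrable_tilted_exp p) auto
  \<comment> \<open>At low frequency both |s| and |s + 2 \<theta>| are at least r and g \<theta>
    \<le> A; at high frequency |M| \<le> \<kappa>. Neither bound involves \<theta>.\<close>
  have D_right: "min (r\<^sup>2 / (4 * A)) (1 - \<kappa>) \<le> norm (1 - M (Complex r t))" for t
  proof (cases "\<bar>t\<bar> \<le> T")
    case True
    have "r \<le> norm (Complex r t)" "r \<le> norm (2 * of_real \<theta> + Complex r t)"
      using complex_Re_le_cmod [of "Complex r t"] complex_Re_le_cmod [of "2 * of_real \<theta> + Complex r t"] \<theta> by auto
    then have "r * r \<le> norm (Complex r t) * norm (2 * of_real \<theta> + Complex r t)" using c by (intro mult_mono) auto
    then have "r\<^sup>2 / (4 * A) \<le> norm (Complex r t) * norm (2 * of_real \<theta> + Complex r t) / (4 * g \<theta>)"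
      using g\<theta> by (intro frac_le) (auto simp: power2_eq_square)
    also have "\<dots> \<le> norm (1 - M (Complex r t))" using True \<theta> c by (intro M_low) auto
    finally show ?thesis by simp
  next
    case False
    then have "norm (M (Complex r t)) \<le> \<kappa>" using \<theta> c by (intro M_high) auto
    then show ?thesis using norm_triangle_ineq2 [of 1 "M (Complex r t)"] by simp
  qed
  have "renewal_spectrum M (\<lambda>n. distr (iid_law F0 \<theta>) borel (\<lambda>\<omega>. walk \<omega> n)) \<mu> \<theta> r T \<kappa> q A
      (min (r\<^sup>2 / (4 * A)) (1 - \<kappa>)) m"
  \<comment> \<open>The cases are numbered in the order of the assumptions of
    \<open>renewal_spectrum\<close>, every conjunct counted separately.\<close>
  proof (rule renewal_spectrum.intro, goal_cases)
    case 12
    then show ?case using \<mu> mean_pos [of \<theta>] g\<theta> \<theta> by simp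
  next
    case 15
    have der: "(cmgf F0 has_field_derivative (CLINT x|F0. of_real x * exp (w * of_real x))) (at w)"
      if "0 < Re w" "Re w < 3 * r" for w
      using cmgf_has_field_derivative [OF par that] .
    have "cmgf F0 holomorphic_on {w. 0 < Re w \<and> Re w < 3 * r}"
      unfolding holomorphic_on_def field_differentiable_def
      using der by (blast intro: has_field_derivative_at_within)
    then have "(\<lambda>s. cmgf F0 (of_real \<theta> + s)) holomorphic_on {s. - \<theta> < Re s \<and> Re s < 2 * r}"
      by (rule holomorphic_on_compose_gen [unfolded o_def, rotated]) (use \<theta> in \<open>auto intro!: holomorphic_intros\<close>)
    then show ?case unfolding M_def using g\<theta> by (intro holomorphic_intros) (auto simp: cm)
  next
    case (16 s)
    show ?case
    proof (cases "\<bar>Im s\<bar> \<le> T")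
      case True
      \<comment> \<open>The second root s = -2 \<theta> lies outside the strip, so only s = 0 can
        give M s = 1 at low frequency.\<close>
      have "0 < Re (2 * of_real \<theta> + s)" using 16 \<theta> by simp
      then have "2 * of_real \<theta> + s \<noteq> 0" by (metis less_irrefl zero_complex.sel(1))
      then have "0 < norm s * norm (2 * of_real \<theta> + s) / (4 * g \<theta>)" using 16 g\<theta> by simp
      also have "\<dots> \<le> norm (1 - M s)" using 16 True by (intro M_low) auto
      finally show ?thesis by auto
    next
      case False
      then show ?thesis using M_high [of s] 16 c by auto
    qed
  next
    case 17
    then show ?case using g\<theta> by (simp add: M_def cm)
  next
    case 18
    have "(cmgf F0 has_field_derivative (CLINT x|F0. of_real x * exp (of_real \<theta> * of_real x))) (at (of_real \<theta> + 0))"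
      using cmgf_has_field_derivative [OF par, of "of_real \<theta>"] \<theta> c by simp
    then have "((\<lambda>s. cmgf F0 (of_real \<theta> + s)) has_field_derivative (CLINT x|F0. of_real x * exp (of_real \<theta> * of_real x)) * 1) (at 0)"
      by (rule DERIV_chain2) (auto intro!: derivative_eq_intros)
    then have "(M has_field_derivative (CLINT x|F0. of_real x * exp (of_real \<theta> * of_real x)) / cmgf F0 (of_real \<theta>)) (at 0)"
      unfolding M_def by (auto intro: DERIV_cdivide)
    moreover have "(CLINT x|F0. of_real x * exp (of_real \<theta> * of_real x)) = of_real (LINT x|F0. x * exp (\<theta> * x))"
      unfolding integral_complex_of_real [symmetric] of_real_mult exp_of_real [symmetric] by simp
    ultimately show ?case by (simp add: cm \<mu>)
  next
    case (19 s)
    then show ?case by (rule M_high)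
  next
    case (20 t)
    have "norm (cmgf F0 (of_real \<theta> + Complex r t)) \<le> g (\<theta> + r)"
      using norm_cmgf_le [of "of_real \<theta> + Complex r t"] p [of "\<theta> + r"] \<theta> by (simp add: g_def)
    also have "\<dots> \<le> A" using g1 [of "\<theta> + r"] \<theta> by simp
    also have "\<dots> \<le> A * g \<theta>" using g\<theta> c by simp
    finally show ?case using g\<theta> unfolding normM by (simp add: pos_divide_le_eq)
  next
    case (21 t)
    then show ?case by (rule D_right)
  next
    case (22 t)
    have "norm (cmgf F0 (of_real \<theta> + Complex (- \<theta> / 2) t)) \<le> g (\<theta> / 2)"
      using norm_cmgf_le [of "of_real \<theta> + Complex (- \<theta> / 2) t"] p [of "\<theta> / 2"] \<theta> by (simp add: g_def)
    then show ?case unfolding normM m_eq using g\<theta> by (simp add: divide_right_mono)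
  next
    case (23 n)
    show ?case unfolding iid_law_def
      by (intro prob_space.prob_space_distr prob_space_PiM walk_measurable) (auto intro: P.prob_space_axioms)
  next
    case (24 n)
    show ?case by simp
  next
    case (25 n \<sigma>)
    have i: "integrable (tilted F0 \<theta>) (\<lambda>x. exp (of_real \<sigma> * complex_of_real x))"
      using 25 by (intro iexp) auto
    have "integrable (iid_law F0 \<theta>) (\<lambda>\<omega>. norm (exp (of_real \<sigma> * complex_of_real (walk \<omega> n))))"
      unfolding iid_law_def
      by (intro integrable_norm walk_transform(1) [OF P.prob_space_axioms _ i]) simp
    then show ?case
      by (subst integrable_distr_eq) (auto simp: iid_law_def intro!: walk_measurable)
  next
    case (26 n s)
    have "(CLINT \<omega>|iid_law F0 \<theta>. exp (s * of_real (walk \<omega> n))) = (CLINT x|tilted F0 \<theta>. exp (s * of_real x)) ^ n"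
      unfolding iid_law_def by (rule walk_transform(2) [OF P.prob_space_axioms _ iexp]) (use 26 in auto)
    then show ?case
      by (subst integral_distr) (auto simp: tr iid_law_def intro!: walk_measurable)
  qed (use c \<theta> m1 in \<open>auto simp: m_def intro!: integral_nonneg_AE AE_I2\<close>)
  then show "renewal_spectrum (\<lambda>s. cmgf F0 (of_real \<theta> + s) / cmgf F0 (of_real \<theta>))
      (\<lambda>n. distr (iid_law F0 \<theta>) borel (\<lambda>\<omega>. walk \<omega> n)) (LINT x|tilted F0 \<theta>. x) \<theta> r T \<kappa> q A
      (min (r\<^sup>2 / (4 * A)) (1 - \<kappa>)) (LINT x|tilted F0 \<theta>. exp (- (\<theta> / 2) * x))"
    by (simp add: M_def \<mu>_def m_def)
qed

text \<open>The pointwise bound for a fixed jump x is integrated over the tilted law. The same r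
  serves as decay rate and as upper end of the range of \<theta>.\<close>

lemma overshoot_moment_bound:
  obtains C r where "C > 0" "r > 0" "{0..r} \<subseteq> param_space \<theta>max"
    "\<And>k b \<theta>. k \<ge> 1 \<Longrightarrow> b > 0 \<Longrightarrow> \<theta> \<in> {0<..r} \<Longrightarrow>
      (\<integral>\<^sup>+\<omega>. overshoot b \<omega> ^ k \<partial>iid_law F0 \<theta>)
        \<le> ennreal (1 / (real k + 1) * ((\<integral>\<omega>. (max (\<omega> 0) 0) ^ (k + 1) \<partial>iid_law F0 \<theta>) / (\<integral>\<omega>. \<omega> 0 \<partial>iid_law F0 \<theta>))
            + C * (fact k / r ^ k) * exp (- r * b))"
proof -
  obtain r T \<kappa> q A where c: "r > 0" "T > 0" "0 < \<kappa>" "\<kappa> < 1" "0 < q" "q < 1" "\<kappa> \<le> q ^ 3" "1 \<le> A" "A * q < 1"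
    and par: "3 * r \<in> param_space \<theta>max"
    and spec: "\<And>w. 0 \<le> Re w \<Longrightarrow> Re w \<le> 3 * r \<Longrightarrow> T \<le> \<bar>Im w\<bar> \<Longrightarrow> norm (cmgf F0 w) \<le> \<kappa>"
      "\<And>w \<theta>. 0 < Re w \<Longrightarrow> Re w < 3 * r \<Longrightarrow> \<bar>Im w\<bar> \<le> T \<Longrightarrow> 0 < \<theta> \<Longrightarrow> \<theta> < 3 * r \<Longrightarrow>
         norm (w - of_real \<theta>) * norm (w + of_real \<theta>) / 4 \<le> norm (cmgf F0 w - cmgf F0 (of_real \<theta>))"
      "\<And>\<sigma>. 0 \<le> \<sigma> \<Longrightarrow> \<sigma> \<le> 3 * r \<Longrightarrow> (LINT x|F0. exp (\<sigma> * x)) \<le> A"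
      "\<And>\<theta>. 0 < \<theta> \<Longrightarrow> \<theta> \<le> 3 * r \<Longrightarrow> 0 < (LINT x|F0. x * exp (\<theta> * x))"
    using spectral_constants by blast
  define D where "D = min (r\<^sup>2 / (4 * A)) (1 - \<kappa>)"
  define C where "C = 1 / (1 - A * q) + renewal_const r T q A D / r + 2 * exp (r\<^sup>2 / 2) * exp r * (2 * T + 3) / (1 - A * q)"
  have "0 < D" using c by (simp add: D_def)
  have "0 \<le> renewal_const r T q A D"
    unfolding renewal_const_def using c \<open>0 < D\<close>
    by (intro mult_nonneg_nonneg add_nonneg_nonneg divide_nonneg_nonneg) auto
  then have C: "0 < C"
    unfolding C_def using c by (intro add_pos_nonneg divide_pos_pos divide_nonneg_nonneg mult_nonneg_nonneg) auto
  show ?thesis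
  \<comment> \<open>The additional factor A bounds the tilted expectation of exp(r x), left over
    from intervals that start at b - x + v.\<close>
  proof (rule that [of "C * A" r])
    show "C * A > 0" using C c by simp
    show "{0..r} \<subseteq> param_space \<theta>max" using param_space_mono [OF par] c by auto
    fix k :: nat and b \<theta> :: real
    assume k: "k \<ge> 1" and b: "b > 0" and "\<theta> \<in> {0<..r}"
    then have \<theta>: "0 < \<theta>" "\<theta> \<le> r" by auto
    have p: "\<sigma> \<in> param_space \<theta>max" if "0 \<le> \<sigma>" "\<sigma> \<le> 3 * r" for \<sigma>
      using param_space_mono [OF par] that by simp
    have p\<theta>: "\<theta> \<in> param_space \<theta>max" using p \<theta> by simp
    interpret P: prob_space "tilted F0 \<theta>" by (rule prob_space_tilted [OF p\<theta>])
    note rs = renewal_spectrum_tilted [OF c par spec \<theta>]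
    interpret R: renewal_spectrum "\<lambda>s. cmgf F0 (of_real \<theta> + s) / cmgf F0 (of_real \<theta>)"
      "\<lambda>n. distr (iid_law F0 \<theta>) borel (\<lambda>\<omega>. walk \<omega> n)" "LINT x|tilted F0 \<theta>. x" \<theta> r T \<kappa> q A
      "min (r\<^sup>2 / (4 * A)) (1 - \<kappa>)" "LINT x|tilted F0 \<theta>. exp (- (\<theta> / 2) * x)"
      by (rule rs(1)) assumption+
    define \<mu> where "\<mu> = (LINT x|tilted F0 \<theta>. x)"
    have \<mu>: "\<mu> > 0" using R.\<mu>_pos by (simp add: \<mu>_def)
    define e where "e = C * exp (- r * b) * (fact k / r ^ k)"
    have e: "0 \<le> e" using C c by (simp add: e_def)
    have ir: "integrable (tilted F0 \<theta>) (\<lambda>x. exp (r * x))"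
      by (intro integrable_tilted_real_exp p) (use \<theta> in auto)
    have ip: "integrable (tilted F0 \<theta>) (\<lambda>x. (max x 0) ^ (k + 1))"
      using \<theta> c by (intro integrable_tilted_positive_part [of \<theta> r] p) auto
    have er: "(LINT x|tilted F0 \<theta>. exp (r * x)) \<le> A"
    proof -
      have "complex_of_real (LINT x|tilted F0 \<theta>. exp (r * x)) = (CLINT x|tilted F0 \<theta>. exp (of_real r * of_real x))"
        unfolding integral_complex_of_real [symmetric] exp_of_real [symmetric] by simp
      also have "\<dots> = cmgf F0 (of_real \<theta> + Complex r 0) / cmgf F0 (of_real \<theta>)"
        using transform_tilted [OF p\<theta>, of "of_real r"] by (simp add: complex_of_real_def)
      finally have "norm (complex_of_real (LINT x|tilted F0 \<theta>. exp (r * x))) \<le> A"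
        using R.norm_M_right [of 0] by simp
      then show ?thesis by simp
    qed
    have "(\<integral>\<^sup>+\<omega>. overshoot b \<omega> ^ k \<partial>iid_law F0 \<theta>) \<le>
      (\<integral>\<^sup>+x. (\<Sum>n. \<integral>\<^sup>+s. ennreal (if s \<le> b then (max 0 (s + x - b)) ^ k else 0) \<partial>distr (iid_law F0 \<theta>) borel (\<lambda>\<omega>. walk \<omega> n)) \<partial>tilted F0 \<theta>)"
      unfolding iid_law_def
    proof (rule overshoot_moment_le_sum [OF P.prob_space_axioms])
      show "integrable (tilted F0 \<theta>) (\<lambda>x. exp (- (\<theta> / 2) * x))"
        by (intro integrable_tilted_real_exp p) (use \<theta> in auto)
      show "(LINT x|tilted F0 \<theta>. exp (- (\<theta> / 2) * x)) < 1" by (rule R.m(2))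
    qed (use b \<theta> in auto)
    also have "\<dots> \<le> (\<integral>\<^sup>+x. ennreal ((max x 0) ^ (k + 1) / ((real k + 1) * \<mu>) + e * exp (r * x)) \<partial>tilted F0 \<theta>)"
    proof (rule nn_integral_mono)
      fix x
      have "(\<Sum>n. \<integral>\<^sup>+s. ennreal (if s \<le> b then (max 0 (s + x - b)) ^ k else 0) \<partial>distr (iid_law F0 \<theta>) borel (\<lambda>\<omega>. walk \<omega> n)) \<le>
          ennreal ((max x 0) ^ (k + 1) / ((real k + 1) * \<mu>) + C * exp (- r * b) * exp (r * x) * (fact k / r ^ k))"
      proof (rule overshoot_moment_layers)
        show "(\<Sum>n<N. measure (distr (iid_law F0 \<theta>) borel (\<lambda>\<omega>. walk \<omega> n)) {z<..z + L}) \<le> L / \<mu> + C * exp (- r * z)"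
          if "0 \<le> L" for N z L
          using R.renewal_interval_bound [OF that] unfolding C_def D_def \<mu>_def .
      qed (use R.prob_\<nu> \<mu> c(1) k C in auto)
      then show "(\<Sum>n. \<integral>\<^sup>+s. ennreal (if s \<le> b then (max 0 (s + x - b)) ^ k else 0) \<partial>distr (iid_law F0 \<theta>) borel (\<lambda>\<omega>. walk \<omega> n)) \<le>
          ennreal ((max x 0) ^ (k + 1) / ((real k + 1) * \<mu>) + e * exp (r * x))"
        by (simp add: e_def mult_ac)
    qed
    also have "\<dots> = ennreal (LINT x|tilted F0 \<theta>. (max x 0) ^ (k + 1) / ((real k + 1) * \<mu>) + e * exp (r * x))"
      using ir ip \<mu> e by (intro nn_integral_eq_integral) (auto simp del: power_Suc)
    also have "(LINT x|tilted F0 \<theta>. (max x 0) ^ (k + 1) / ((real k + 1) * \<mu>) + e * exp (r * x)) =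
        (LINT x|tilted F0 \<theta>. (max x 0) ^ (k + 1)) / ((real k + 1) * \<mu>) + e * (LINT x|tilted F0 \<theta>. exp (r * x))"
      using ir ip by (subst Bochner_Integration.integral_add) (auto simp del: power_Suc)
    also have "\<dots> \<le> (LINT x|tilted F0 \<theta>. (max x 0) ^ (k + 1)) / ((real k + 1) * \<mu>) + e * A"
      using er e by (intro add_left_mono mult_left_mono)
    also have "\<dots> = 1 / (real k + 1) * ((\<integral>\<omega>. (max (\<omega> 0) 0) ^ (k + 1) \<partial>iid_law F0 \<theta>) / (\<integral>\<omega>. \<omega> 0 \<partial>iid_law F0 \<theta>))
            + (C * A) * (fact k / r ^ k) * exp (- r * b)"
    proof -
      have "(\<integral>\<omega>. (max (\<omega> 0) 0) ^ (k + 1) \<partial>iid_law F0 \<theta>) = (LINT x|tilted F0 \<theta>. (max x 0) ^ (k + 1))"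
        unfolding iid_law_def
        using integral_coordinate [OF P.prob_space_axioms, where f = "\<lambda>x. (max x 0) ^ (k + 1)" and i = 0] by simp
      moreover have "(\<integral>\<omega>. \<omega> 0 \<partial>iid_law F0 \<theta>) = \<mu>"
        unfolding iid_law_def \<mu>_def
        using integral_coordinate [OF P.prob_space_axioms, where f = "\<lambda>x. x" and i = 0] by simp
      ultimately show ?thesis by (simp add: e_def field_simps)
    qed
    finally show "(\<integral>\<^sup>+\<omega>. overshoot b \<omega> ^ k \<partial>iid_law F0 \<theta>)
        \<le> ennreal (1 / (real k + 1) * ((\<integral>\<omega>. (max (\<omega> 0) 0) ^ (k + 1) \<partial>iid_law F0 \<theta>) / (\<integral>\<omega>. \<omega> 0 \<partial>iid_law F0 \<theta>))
            + (C * A) * (fact k / r ^ k) * exp (- r * b))"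
      by (simp add: ennreal_leI)
  qed (use c in simp)
qed

end

theorem theorem2:
  fixes F0 :: "real measure" and \<theta>max :: ereal
  assumes "standard_exponential_family F0 \<theta>max"
  shows "\<exists>C r \<theta>s :: real. C > 0 \<and> r > 0 \<and> \<theta>s > 0 \<and> {0..\<theta>s} \<subseteq> param_space \<theta>max \<and>
    (\<forall>k::nat. \<forall>b::real. \<forall>\<theta>::real. k \<ge> 1 \<longrightarrow> b > 0 \<longrightarrow> \<theta> \<in> {0<..\<theta>s} \<longrightarrow>
      (\<integral>\<^sup>+\<omega>. overshoot b \<omega> ^ k \<partial>iid_law F0 \<theta>)
        \<le> ennreal (1 / (real k + 1)
              * ((\<integral>\<omega>. (max (\<omega> 0) 0) ^ (k + 1) \<partial>iid_law F0 \<theta>) / (\<integral>\<omega>. \<omega> 0 \<partial>iid_law F0 \<theta>))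
            + C * (real k * Gamma (real k) / r ^ k) * exp (- r * b)))"
proof -
  interpret standard_exponential_family F0 \<theta>max by fact
  \<comment> \<open>Gamma at k is (k - 1)!, so the factor k completes the factorial that came from
    the layers.\<close>
  have G: "real k * Gamma (real k) = fact k" if "k \<ge> 1" for k :: nat
    using that Gamma_fact [of "k - 1", where 'a = real] by (cases k) (auto simp: add.commute)
  obtain C r where Cr: "C > 0" "r > 0" "{0..r} \<subseteq> param_space \<theta>max"
    "\<And>k b \<theta>. k \<ge> 1 \<Longrightarrow> b > 0 \<Longrightarrow> \<theta> \<in> {0<..r} \<Longrightarrow>
      (\<integral>\<^sup>+\<omega>. overshoot b \<omega> ^ k \<partial>iid_law F0 \<theta>)
        \<le> ennreal (1 / (real k + 1) * ((\<integral>\<omega>. (max (\<omega> 0) 0) ^ (k + 1) \<partial>iid_law F0 \<theta>) / (\<integral>\<omega>. \<omega> 0 \<partial>iid_law F0 \<theta>))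
            + C * (fact k / r ^ k) * exp (- r * b))"
    using overshoot_moment_bound by blast
  show ?thesis
    by (intro exI [of _ C] exI [of _ r] conjI allI impI Cr(1-3))
       (simp only: G Cr(4))
qed

end
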